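(* Let $g(\cdot,t)=u(\cdot,t)\,ds_p^2$, $t\in(-\infty,0)$, be an ancient solution of the Ricci flow $\partial_t g_{ij}=-2R_{ij}$ on $S^2$ which becomes singular at time $t=0$, where $u>0$ is smooth on $S^2\times(-\infty,0)$ and satisfies $u_t=\Delta_{S^2}\log u-2$ in $S^2\times(-\infty,0)$. Let $v=u^{-1}$, and assume that the coordinates $(\psi,\theta)$ on $S^2$ are chosen such that $\lim_{t\to-\infty}v(\psi,\theta,t)=C_0\cos^2\psi$ for all $|\psi|\le\pi/2$, $0\le\theta\le2\pi$, with a constant $C_0>0$. Suppose there exist constants $0<\alpha<1$, $t_0<0$, $0<a<3$ and $C>0$ such that $$v_\theta^2\le C\,v^{1+a}\cos^2\psi\quad\text{on } S^2\times(-\infty,t_0]$$ (so that $v=v(\psi,t)$ is independent of $\theta$), $$(\cos\psi)^{1-\alpha}|v_{\psi\psi\psi}|\le C\quad\text{on } S^2\times(-\infty,t_0],$$ and $$|\Delta_{S^2}v(\rho,t)-\Delta_{S^2}v(\psi,t)|\le C|\rho-\psi|^\alpha\quad\forall \rho,\psi\in(-\pi/2,\pi/2),\ t\le t_0.$$ Then there is a constant $\mu>0$ such that $$v(\psi,t)=-\mu\coth(2\mu t)+\mu\tanh(2\mu t)\sin^2\psi\quad\forall t<0,\ -\frac{\pi}{2}\le\psi\le\frac{\pi}{2}.$$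
   Context: $ds_p^2=d\psi^2+\cos^2\psi\,d\theta^2$ is the standard round metric on the unit sphere $S^2$ with latitude-longitude coordinates $(\psi,\theta)$, $-\pi/2\le\psi\le\pi/2$, $0\le\theta\le 2\pi$; the poles are $\psi=\pm\pi/2$. $\Delta_{S^2}$ is its Laplacian, $\Delta_{S^2}f=f_{\psi\psi}-(\tan\psi)f_\psi+(\sec^2\psi)f_{\theta\theta}$. "Ancient" means defined for all $t<0$. By known results, $v(\cdot,t)$ decreases as $t\to-\infty$ and converges in $C^{1,\alpha}(S^2)$ for every $0<\alpha<1$; after a conformal change of $S^2$ the limit has the form $C_0\cos^2\psi$ with $C_0\ge 0$, and the assumption on the coordinates refers to this normalization. Independence of $v$ of $\theta$ under the first bound is a separate theorem of the paper and is recalled only to justify the notation $v(\psi,t)$, $\Delta_{S^2}v(\psi,t)$.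
   Formalization: The limit C_0 cos^2(psi) fixes the coordinates only up to conformal dilations along the polar axis, and a dilated Rosenau solution violates the formula; so the formula for v is asserted after such a further dilation of S^2. *)

theory Defs
  imports "HOL-Analysis.Analysis"
begin

section \<open>Smooth functions on subsets of Euclidean spaces\<close>

text \<open>\<open>Ck_on k f S\<close> is meant for open \<open>S\<close>.\<close>

primrec Ck_on :: "nat \<Rightarrow> ('a::euclidean_space \<Rightarrow> real) \<Rightarrow> 'a set \<Rightarrow> bool" where
  "Ck_on 0 f S \<longleftrightarrow> continuous_on S f"
| "Ck_on (Suc k) f S \<longleftrightarrow>
     (\<forall>x\<in>S. f differentiable (at x)) \<and>
     (\<forall>b\<in>Basis. Ck_on k (\<lambda>x. frechet_derivative f (at x) b) S)"

text \<open>On an embedded submanifold (here the sphere times an open interval) being smooth in the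
  sense of charts is the same as being the restriction of a smooth function on an open
  neighbourhood in the ambient space.\<close>

definition smooth_on :: "('a::euclidean_space \<Rightarrow> real) \<Rightarrow> 'a set \<Rightarrow> bool" where
  "smooth_on f S \<longleftrightarrow>
     (\<exists>T F. open T \<and> S \<subseteq> T \<and> (\<forall>k. Ck_on k F T) \<and> (\<forall>x\<in>S. F x = f x))"


section \<open>Curvature and Ricci flow in a coordinate chart\<close>

definition partial :: "'n::finite \<Rightarrow> (real^'n \<Rightarrow> real) \<Rightarrow> real^'n \<Rightarrow> real" where
  "partial i f x = frechet_derivative f (at x) (axis i 1)"

text \<open>\<open>christoffel g i j k\<close> is the symbol with upper index \<open>i\<close> and lower indices \<open>j\<close>, \<open>k\<close>.\<close>

definition christoffel ::
  "(real^'n::finite \<Rightarrow> real^'n^'n) \<Rightarrow> 'n \<Rightarrow> 'n \<Rightarrow> 'n \<Rightarrow> real^'n \<Rightarrow> real" where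
  "christoffel g i j k x = (1/2) * (\<Sum>l\<in>UNIV. matrix_inv (g x) $ i $ l *
     (partial j (\<lambda>y. g y $ l $ k) x + partial k (\<lambda>y. g y $ l $ j) x
        - partial l (\<lambda>y. g y $ j $ k) x))"

text \<open>The sign is such that round spheres have positive Ricci curvature.\<close>

definition ricci ::
  "(real^'n::finite \<Rightarrow> real^'n^'n) \<Rightarrow> 'n \<Rightarrow> 'n \<Rightarrow> real^'n \<Rightarrow> real" where
  "ricci g j k x = (\<Sum>i\<in>UNIV.
     partial i (christoffel g i j k) x - partial k (christoffel g i j i) x
     + (\<Sum>p\<in>UNIV. christoffel g i i p x * christoffel g p j k x
                 - christoffel g i k p x * christoffel g p j i x))"

definition scalar_curvature ::
  "(real^'n::finite \<Rightarrow> real^'n^'n) \<Rightarrow> real^'n \<Rightarrow> real" where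
  "scalar_curvature g x = (\<Sum>j\<in>UNIV. \<Sum>k\<in>UNIV. matrix_inv (g x) $ j $ k * ricci g j k x)"

definition ricci_flow_on ::
  "(real \<Rightarrow> real^'n::finite \<Rightarrow> real^'n^'n) \<Rightarrow> (real^'n) set \<Rightarrow> real set \<Rightarrow> bool" where
  "ricci_flow_on g X I \<longleftrightarrow>
     (\<forall>t\<in>I. \<forall>x\<in>X. \<forall>i j.
        ((\<lambda>s. g s x $ i $ j) has_real_derivative (- 2 * ricci (g t) i j x)) (at t))"

text \<open>The flow becomes singular at time \<open>T\<close> when its curvature is unbounded as \<open>t\<close> tends to \<open>T\<close>
  from below.  In dimension two the scalar curvature determines the full curvature tensor.\<close>

definition singular_at_time ::
  "(real \<Rightarrow> real^2 \<Rightarrow> real^2^2) \<Rightarrow> (real^2) set \<Rightarrow> real \<Rightarrow> bool" where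
  "singular_at_time g X T \<longleftrightarrow>
     (\<forall>M. \<forall>t1<T. \<exists>t. t1 < t \<and> t < T \<and> (\<exists>x\<in>X. \<bar>scalar_curvature (g t) x\<bar> > M))"


section \<open>The unit sphere in latitude-longitude coordinates\<close>

definition sph :: "real \<Rightarrow> real \<Rightarrow> real^3" where
  "sph \<psi> \<theta> = vector [cos \<psi> * cos \<theta>, cos \<psi> * sin \<theta>, sin \<psi>]"

text \<open>Coordinate vectors are \<open>x = (\<psi>, \<theta>)\<close>.  The chart misses the two poles, where the metrics below
  degenerate as matrices; identities between smooth tensors extend to the poles by continuity.\<close>

definition chart_domain :: "(real^2) set" where
  "chart_domain = {x. \<bar>x $ 1\<bar> < pi / 2}"

definition round_metric :: "real^2 \<Rightarrow> real^2^2" where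
  "round_metric x = (\<chi> i j. if i \<noteq> j then 0 else if i = 1 then 1 else (cos (x $ 1))\<^sup>2)"

definition conformal_metric :: "(real^3 \<Rightarrow> real \<Rightarrow> real) \<Rightarrow> real \<Rightarrow> real^2 \<Rightarrow> real^2^2" where
  "conformal_metric u t x = u (sph (x $ 1) (x $ 2)) t *\<^sub>R round_metric x"

text \<open>Only meaningful for \<open>\<bar>\<psi>\<bar> < pi / 2\<close>.\<close>

definition laplacian_S2 :: "(real \<Rightarrow> real \<Rightarrow> real) \<Rightarrow> real \<Rightarrow> real \<Rightarrow> real" where
  "laplacian_S2 f \<psi> \<theta> =
     (deriv ^^ 2) (\<lambda>y. f y \<theta>) \<psi> - tan \<psi> * deriv (\<lambda>y. f y \<theta>) \<psi>
       + (1 / cos \<psi>)\<^sup>2 * (deriv ^^ 2) (\<lambda>y. f \<psi> y) \<theta>"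

definition inverse_factor :: "(real^3 \<Rightarrow> real \<Rightarrow> real) \<Rightarrow> real \<Rightarrow> real \<Rightarrow> real \<Rightarrow> real" where
  "inverse_factor u \<psi> \<theta> t = inverse (u (sph \<psi> \<theta>) t)"

definition coth :: "real \<Rightarrow> real" where
  "coth x = cosh x / sinh x"


section \<open>Conformal dilations along the polar axis\<close>

text \<open>In the cylindrical coordinate \<open>x\<close> with \<open>tanh x = sin \<psi>\<close>, the round metric is
  \<open>(cos \<psi>)\<^sup>2 (dx\<^sup>2 + d\<theta>\<^sup>2)\<close>, and \<open>dilation s\<close> is the translation \<open>x \<mapsto> x + s\<close>.  Up to
  isometries preserving the axis, these are the conformal changes of the sphere preserving each pole.\<close>

definition dilation :: "real \<Rightarrow> real^3 \<Rightarrow> real^3" where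
  "dilation s p = (1 / (cosh s + sinh s * p $ 3)) *\<^sub>R
     vector [p $ 1, p $ 2, cosh s * p $ 3 + sinh s]"

text \<open>The conformal factor of the pull-back of \<open>u\<close> times the round metric; see
  \<open>dilation_conformal\<close> below.\<close>

definition dilate_factor ::
  "real \<Rightarrow> (real^3 \<Rightarrow> real \<Rightarrow> real) \<Rightarrow> real^3 \<Rightarrow> real \<Rightarrow> real" where
  "dilate_factor s u p t = u (dilation s p) t / (cosh s + sinh s * p $ 3)\<^sup>2"

lemma norm_eq_1_real3: "norm (p::real^3) = 1 \<longleftrightarrow> (p$1)\<^sup>2 + (p$2)\<^sup>2 + (p$3)\<^sup>2 = 1"
  by (simp add: norm_eq_1 inner_vec_def sum_3 power2_eq_square)

lemma sph_in_sphere: "sph \<psi> \<theta> \<in> sphere 0 1"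
proof -
  have "(cos \<psi> * cos \<theta>)\<^sup>2 + (cos \<psi> * sin \<theta>)\<^sup>2 + (sin \<psi>)\<^sup>2
      = (cos \<psi>)\<^sup>2 * ((cos \<theta>)\<^sup>2 + (sin \<theta>)\<^sup>2) + (sin \<psi>)\<^sup>2"
    by algebra
  then show ?thesis by (simp add: norm_eq_1_real3 sph_def)
qed

lemma dilation_denom_pos:
  assumes "\<bar>z\<bar> \<le> 1" shows "cosh s + sinh s * z > (0::real)"
proof -
  have "\<bar>sinh s * z\<bar> \<le> \<bar>sinh s\<bar>"
    using assms by (simp add: abs_mult mult_left_le)
  moreover have "\<bar>sinh s\<bar> < cosh s"
    by (metis abs_if cosh_minus sinh_less_cosh_real sinh_minus)
  ultimately show ?thesis by linarith
qed

lemma dilation_0: "dilation 0 p = p"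
  by (simp add: dilation_def vec_eq_iff forall_3)

lemma dilate_factor_0: "dilate_factor 0 u = u"
  by (simp add: dilate_factor_def dilation_0 fun_eq_iff)

lemma sphere_nth_bound: "p \<in> sphere 0 1 \<Longrightarrow> \<bar>(p::real^3) $ i\<bar> \<le> 1"
  using component_le_norm_cart[of p i] by simp

lemma dilation_in_sphere:
  assumes p: "p \<in> sphere 0 1" shows "dilation s p \<in> sphere 0 1"
proof -
  define d where "d = cosh s + sinh s * p $ 3"
  have d: "d > 0" unfolding d_def
    using p by (intro dilation_denom_pos sphere_nth_bound)
  have 1: "(p$1)\<^sup>2 + (p$2)\<^sup>2 + (p$3)\<^sup>2 = 1"
    using p by (simp add: norm_eq_1_real3)
  have 2: "(cosh s)\<^sup>2 = (sinh s)\<^sup>2 + 1" by (rule cosh_square_eq)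
  have 3: "(p$1)\<^sup>2 + (p$2)\<^sup>2 + (cosh s * p $ 3 + sinh s)\<^sup>2 = d\<^sup>2"
    using 1 2 unfolding d_def by algebra
  have "(p$1 / d)\<^sup>2 + (p$2 / d)\<^sup>2 + ((cosh s * p $ 3 + sinh s) / d)\<^sup>2
      = ((p$1)\<^sup>2 + (p$2)\<^sup>2 + (cosh s * p $ 3 + sinh s)\<^sup>2) / d\<^sup>2"
    unfolding power_divide by (simp only: add_divide_distrib)
  also have "\<dots> = 1" using 3 d by simp
  finally have "norm (dilation s p) = 1"
    unfolding norm_eq_1_real3 dilation_def d_def[symmetric] by simp
  then show ?thesis by simp
qed

text \<open>Letting \<open>q\<close> tend to \<open>p\<close> shows that \<open>dilation s\<close> is conformal on the sphere and pulls back
  the round metric to \<open>1 / (cosh s + sinh s * p $ 3)\<^sup>2\<close> times itself.\<close>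

lemma dilation_conformal:
  assumes p: "p \<in> sphere 0 1" and q: "q \<in> sphere 0 1"
  shows "(dist (dilation s p) (dilation s q))\<^sup>2 =
    (dist p q)\<^sup>2 / ((cosh s + sinh s * p $ 3) * (cosh s + sinh s * q $ 3))"
proof -
  define d e where "d = cosh s + sinh s * p $ 3" and "e = cosh s + sinh s * q $ 3"
  have de: "d > 0" "e > 0" unfolding d_def e_def
    using p q by (auto intro!: dilation_denom_pos sphere_nth_bound)
  have ch: "(cosh s)\<^sup>2 = (sinh s)\<^sup>2 + 1" by (rule cosh_square_eq)
  have dist2: "(dist x y)\<^sup>2 = 2 - 2 * (x \<bullet> y)"
    if "x \<in> sphere 0 1" "y \<in> sphere 0 1" for x y :: "real^3"
  proof -
    have "x \<bullet> x = 1" "y \<bullet> y = 1" using that by (auto simp: norm_eq_1)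
    then show ?thesis
      by (simp add: dist_norm power2_norm_eq_inner inner_diff_left inner_diff_right inner_commute)
  qed
  define N where "N = p$1 * q$1 + p$2 * q$2
                    + (cosh s * p $ 3 + sinh s) * (cosh s * q $ 3 + sinh s)"
  have ip: "dilation s p \<bullet> dilation s q = N / (d * e)"
    by (simp add: dilation_def N_def d_def[symmetric] e_def[symmetric] inner_vec_def sum_3
        add_divide_distrib)
  have "d * e - N = 1 - (p \<bullet> q)"
    using ch unfolding N_def d_def e_def inner_vec_def sum_3 inner_real_def by algebra
  then have "1 - N / (d * e) = (1 - (p \<bullet> q)) / (d * e)"
    using de by (simp add: field_simps)
  then have "2 - 2 * (N / (d * e)) = (2 - 2 * (p \<bullet> q)) / (d * e)"
    by (simp add: diff_divide_distrib)
  then show ?thesis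
    using p q ip by (simp only: dist2 dilation_in_sphere d_def[symmetric] e_def[symmetric])
qed

text \<open>Dilations preserve the normalization of the backward limit: in the coordinate \<open>x\<close> above, the
  limiting metric is a flat cylinder, which is invariant under translations of \<open>x\<close>.  Hence the
  normalization determines the coordinates only up to a dilation (and isometries).\<close>

lemma dilation_preserves_backward_limit:
  assumes lim: "\<And>p. p \<in> sphere 0 1 \<Longrightarrow>
      ((\<lambda>t. inverse (u p t)) \<longlongrightarrow> C0 * (1 - (p $ 3)\<^sup>2)) at_bot"
    and p: "p \<in> sphere 0 1"
  shows "((\<lambda>t. inverse (dilate_factor s u p t)) \<longlongrightarrow> C0 * (1 - (p $ 3)\<^sup>2)) at_bot"
proof -
  define d where "d = cosh s + sinh s * p $ 3"
  have d: "d > 0" unfolding d_def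
    using p by (intro dilation_denom_pos sphere_nth_bound)
  have z: "dilation s p $ 3 = (cosh s * p $ 3 + sinh s) / d"
    by (simp add: dilation_def d_def)
  have "d\<^sup>2 - (cosh s * p $ 3 + sinh s)\<^sup>2 = 1 - (p $ 3)\<^sup>2"
    using cosh_square_eq[of s] unfolding d_def by algebra
  then have "d\<^sup>2 * (1 - (dilation s p $ 3)\<^sup>2) = 1 - (p $ 3)\<^sup>2"
    unfolding z power_divide right_diff_distrib using d by simp
  then have eq: "d\<^sup>2 * (C0 * (1 - (dilation s p $ 3)\<^sup>2)) = C0 * (1 - (p $ 3)\<^sup>2)"
    by (metis mult.left_commute)
  have "((\<lambda>t. d\<^sup>2 * inverse (u (dilation s p) t)) \<longlongrightarrow>
      d\<^sup>2 * (C0 * (1 - (dilation s p $ 3)\<^sup>2))) at_bot"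
    by (intro tendsto_mult_left lim dilation_in_sphere p)
  then show ?thesis
    unfolding eq by (simp add: dilate_factor_def d_def[symmetric] divide_inverse mult.commute)
qed

end

(*
With tanh x = sin psi the flow becomes the logarithmic diffusion U_t = Laplacian (log U) on a flat
cylinder; put V = 1 / U.

1. Nonnegativity of the scalar curvature (log V)_t, by the maximum principle, makes V nondecreasing
   in time, so V >= C0.
2. The angular derivative of U vanishes: w = (log U)_y satisfies (w U)_t = Laplacian w.  Testing
   with the time integral of w bounds the space-time integral of U w^2 over (s, T) by a multiple of
   the integral of (w U)^2 at time s.  The latter is bounded as s tends to -infinity (this uses
   a < 3), so it is small along a sequence, and w = 0.
3. Then V_t = V V_xx - V_x^2, and G = V_xxx - 4 V_x satisfies
   G_t = V G_xx + V_x G_x - 2 V_xx G.  The integral of V^(-5/2) G^2 is nonincreasing, and its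
   dissipation forces it to be small along a sequence of times tending to -infinity, because the
   Hoelder bounds give |G| <= K (cos psi)^alpha.  Hence G = 0.
4. So V = A + B cosh 2x + D sinh 2x; the equation reduces to an ordinary differential system for
   A, B, D, whose solution is fixed, up to a dilation, by the limit C0 and the singularity at 0.
*)
theory Submission
  imports Defs
begin

section \<open>Functions with controlled growth on the cylinder\<close>

text \<open>In cylindrical coordinates the Laplacian is flat and commutes with the derivatives; the
  price is that the poles move to infinity. The maximum principle then needs a barrier, and every
  integration by parts is done on |x| \<le> X and leaves boundary terms. Their constants depend on
  the time slab, so the times are fixed before the cutoff X. As t tends to -infinity, V \<ge> C0, V
  \<le> N (cosh x)^2 and the assumed pointwise bounds keep the two energies bounded but not small;
  smallness comes from dissipation over a long time interval.

  V_x and V_xxx solve the same linear equation, and so does V_xxx - c V_x for every c. The value c =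
  4 is the one for which the growth of order (cosh x)^2 at the poles cancels; its kernel consists of
  the functions of step 4.

  The limit C0 fixes the conserved quantity of the final system and the blow-up of the curvature
  fixes the shift in time. The constant ratio D / B stays free, because the limiting cylinder is
  invariant under translations of x; this ratio is the dilation.\<close>

lemma mixed_partials_eq:
  fixes f fx fy fxy fyx :: "real \<Rightarrow> real \<Rightarrow> real"
  assumes fx: "\<And>x y. y \<in> U \<Longrightarrow> ((\<lambda>s. f s y) has_real_derivative fx x y) (at x)"
    and fy: "\<And>x y. y \<in> U \<Longrightarrow> ((\<lambda>s. f x s) has_real_derivative fy x y) (at y)"
    and fxy: "\<And>x y. y \<in> U \<Longrightarrow> ((\<lambda>s. fx x s) has_real_derivative fxy x y) (at y)"
    and fyx: "\<And>x y. y \<in> U \<Longrightarrow> ((\<lambda>s. fy s y) has_real_derivative fyx x y) (at x)"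
    and cont: "continuous_on (UNIV \<times> U) (\<lambda>(x, y). fxy x y)"
    and U: "open U" "convex U" and y: "y \<in> U"
  shows "fxy x y = fyx x y"
proof -
  define a where "a = x - 1"
  have int: "f x' y' - f a y' = integral {a..x'} (\<lambda>s. fx s y')" if "a \<le> x'" "y' \<in> U" for x' y'
  proof -
    have "((\<lambda>s. fx s y') has_integral f x' y' - f a y') {a..x'}"
      using that fx by (intro fundamental_theorem_of_calculus)
        (auto simp flip: has_real_derivative_iff_has_vector_derivative intro: DERIV_subset)
    then show ?thesis by (simp add: integral_unique)
  qed
  have cont_x: "continuous_on S (\<lambda>s. fxy s y)" for S
  proof -
    have "continuous_on S ((\<lambda>(x, y). fxy x y) \<circ> (\<lambda>s. (s, y)))"
      by (rule continuous_on_compose) (auto intro!: continuous_intros continuous_on_subset[OF cont] y)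
    then show ?thesis by (simp add: o_def)
  qed
  \<comment> \<open>Only fxy is assumed continuous. Writing f as its value on x = a plus the
    integral of fx and differentiating under the integral sign exhibits fy - fy(a) as an
    antiderivative of fxy in x; its derivative is also fyx.\<close>
  have eq: "fy x' y - fy a y = integral {a..x'} (\<lambda>s. fxy s y)" if x': "a \<le> x'" for x'
  proof -
    have "((\<lambda>y'. integral (cbox a x') (\<lambda>s. fx s y')) has_field_derivative
        integral (cbox a x') (\<lambda>s. fxy s y)) (at y within U)"
    proof (rule leibniz_rule_field_derivative[where fx = "\<lambda>y s. fxy s y"])
      show "continuous_on (U \<times> cbox a x') (\<lambda>(y, s). fxy s y)"
      proof -
        have "continuous_on (U \<times> cbox a x') ((\<lambda>(x, y). fxy x y) \<circ> prod.swap)"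
          by (rule continuous_on_compose)
            (auto intro!: continuous_intros continuous_on_subset[OF cont] simp: prod.swap_def)
        then show ?thesis by (simp add: o_def prod.swap_def split_beta)
      qed
      show "(\<lambda>s. fx s y') integrable_on cbox a x'" if "y' \<in> U" for y'
      proof -
        have "((\<lambda>s. fx s y') has_integral f x' y' - f a y') {a..x'}"
          using that x' fx by (intro fundamental_theorem_of_calculus)
            (auto simp flip: has_real_derivative_iff_has_vector_derivative intro: DERIV_subset)
        then show ?thesis by (auto simp: cbox_interval)
      qed
    qed (use fxy U y in \<open>auto intro: DERIV_subset\<close>)
    then have "((\<lambda>y'. integral {a..x'} (\<lambda>s. fx s y')) has_field_derivative
        integral {a..x'} (\<lambda>s. fxy s y)) (at y)"
      using U y at_within_open[of y U] by (simp add: cbox_interval)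
    moreover have "eventually (\<lambda>y'. integral {a..x'} (\<lambda>s. fx s y') = f x' y' - f a y') (nhds y)"
      using U y int x' by (auto simp: eventually_nhds)
    ultimately have "((\<lambda>y'. f x' y' - f a y') has_field_derivative
        integral {a..x'} (\<lambda>s. fxy s y)) (at y)"
      by (subst DERIV_cong_ev[OF refl _ refl, symmetric]) auto
    moreover have "((\<lambda>y'. f x' y' - f a y') has_field_derivative fy x' y - fy a y) (at y)"
      using y by (intro DERIV_diff fy)
    ultimately show ?thesis by (rule DERIV_unique[symmetric])
  qed
  have "((\<lambda>x'. integral {a..x'} (\<lambda>s. fxy s y)) has_real_derivative fxy x y) (at x within {a..x+1})"
    by (rule integral_has_real_derivative) (auto simp: a_def cont_x)
  then have "((\<lambda>x'. integral {a..x'} (\<lambda>s. fxy s y)) has_real_derivative fxy x y) (at x)"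
    by (subst (asm) at_within_interior) (auto simp: a_def)
  moreover have "eventually (\<lambda>x'. integral {a..x'} (\<lambda>s. fxy s y) = fy x' y - fy a y) (nhds x)"
    using eq eventually_nhds_in_open[of "{a<..}" x] by (auto simp: a_def elim!: eventually_mono)
  ultimately have "((\<lambda>x'. fy x' y - fy a y) has_real_derivative fxy x y) (at x)"
    by (subst DERIV_cong_ev[OF refl _ refl, symmetric]) auto
  moreover have "((\<lambda>x'. fy x' y - fy a y) has_real_derivative fyx x y - 0) (at x)"
    using y by (intro DERIV_diff fyx) auto
  ultimately show ?thesis by (metis DERIV_unique diff_zero)
qed

text \<open>The index \<open>n\<close> bounds the growth towards the poles \<open>x = \<plusminus>\<infinity>\<close> of a function and of all
  its derivatives, uniformly on compact time intervals: restrictions of smooth functions on the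
  sphere have index \<open>0\<close>, and their \<open>x\<close>- and \<open>y\<close>-derivatives have index \<open>-1\<close>.\<close>

definition C0_growth :: "real \<Rightarrow> (real \<Rightarrow> real \<Rightarrow> real \<Rightarrow> real) \<Rightarrow> bool" where
  "C0_growth n f \<longleftrightarrow> continuous_on (UNIV \<times> UNIV \<times> {..<0}) (\<lambda>(x, y, t). f x y t) \<and>
     (\<forall>a b. b < 0 \<longrightarrow> (\<exists>M. \<forall>x y. \<forall>t\<in>{a..b}. \<bar>f x y t\<bar> \<le> M * cosh x powr n))"

primrec Ck_growth :: "real \<Rightarrow> nat \<Rightarrow> (real \<Rightarrow> real \<Rightarrow> real \<Rightarrow> real) \<Rightarrow> bool" where
  "Ck_growth n 0 f \<longleftrightarrow> C0_growth n f"
| "Ck_growth n (Suc k) f \<longleftrightarrow> C0_growth n f \<and> (\<exists>fx fy ft.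
     (\<forall>x y t. t < 0 \<longrightarrow> ((\<lambda>s. f s y t) has_real_derivative fx x y t) (at x) \<and>
        ((\<lambda>s. f x s t) has_real_derivative fy x y t) (at y) \<and>
        ((\<lambda>s. f x y s) has_real_derivative ft x y t) (at t)) \<and>
     Ck_growth n k fx \<and> Ck_growth n k fy \<and> Ck_growth n k ft)"

definition tempered :: "real \<Rightarrow> (real \<Rightarrow> real \<Rightarrow> real \<Rightarrow> real) \<Rightarrow> bool" where
  "tempered n f \<longleftrightarrow> (\<forall>k. Ck_growth n k f)"

definition Dx :: "(real \<Rightarrow> real \<Rightarrow> real \<Rightarrow> real) \<Rightarrow> real \<Rightarrow> real \<Rightarrow> real \<Rightarrow> real" where
  "Dx f x y t = deriv (\<lambda>s. f s y t) x"
definition Dy :: "(real \<Rightarrow> real \<Rightarrow> real \<Rightarrow> real) \<Rightarrow> real \<Rightarrow> real \<Rightarrow> real \<Rightarrow> real" where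
  "Dy f x y t = deriv (\<lambda>s. f x s t) y"
definition Dt :: "(real \<Rightarrow> real \<Rightarrow> real \<Rightarrow> real) \<Rightarrow> real \<Rightarrow> real \<Rightarrow> real \<Rightarrow> real" where
  "Dt f x y t = deriv (\<lambda>s. f x y s) t"

lemma Ck_growth_C0: "Ck_growth n k f \<Longrightarrow> C0_growth n f" by (cases k) auto

lemma C0_growth_boundE:
  assumes "C0_growth n f" "b < 0"
  obtains M where "\<forall>x y. \<forall>t\<in>{a..b}. \<bar>f x y t\<bar> \<le> M * cosh x powr n"
proof -
  have "\<exists>M. \<forall>x y. \<forall>t\<in>{a..b}. \<bar>f x y t\<bar> \<le> M * cosh x powr n"
    using assms unfolding C0_growth_def by (elim conjE allE impE)
  with that show thesis by (elim exE)
qed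

lemma Ck_growth_SucE:
  assumes "Ck_growth n (Suc k) f"
  obtains fx fy ft where
    "\<And>x y t. t < 0 \<Longrightarrow> ((\<lambda>s. f s y t) has_real_derivative fx x y t) (at x)"
    "\<And>x y t. t < 0 \<Longrightarrow> ((\<lambda>s. f x s t) has_real_derivative fy x y t) (at y)"
    "\<And>x y t. t < 0 \<Longrightarrow> ((\<lambda>s. f x y s) has_real_derivative ft x y t) (at t)"
    "Ck_growth n k fx" "Ck_growth n k fy" "Ck_growth n k ft" "C0_growth n f"
proof -
  from assms obtain fx fy ft where *: "\<forall>x y t. t < 0 \<longrightarrow> ((\<lambda>s. f s y t) has_real_derivative fx x y t) (at x) \<and>
        ((\<lambda>s. f x s t) has_real_derivative fy x y t) (at y) \<and>
        ((\<lambda>s. f x y s) has_real_derivative ft x y t) (at t)" "Ck_growth n k fx" "Ck_growth n k fy" "Ck_growth n k ft" "C0_growth n f"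
    unfolding Ck_growth.simps(2) by (elim conjE exE)
  show thesis by (rule that[of fx fy ft]) (use * in \<open>simp_all\<close>)
qed

lemma Ck_growth_SucI:
  assumes "\<And>x y t. t < 0 \<Longrightarrow> ((\<lambda>s. f s y t) has_real_derivative fx x y t) (at x)"
    "\<And>x y t. t < 0 \<Longrightarrow> ((\<lambda>s. f x s t) has_real_derivative fy x y t) (at y)"
    "\<And>x y t. t < 0 \<Longrightarrow> ((\<lambda>s. f x y s) has_real_derivative ft x y t) (at t)"
    "Ck_growth n k fx" "Ck_growth n k fy" "Ck_growth n k ft" "C0_growth n f"
  shows "Ck_growth n (Suc k) f"
  unfolding Ck_growth.simps(2) by (intro conjI exI[of _ fx] exI[of _ fy] exI[of _ ft] allI impI assms)

lemma C0_growthI: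
  assumes "continuous_on (UNIV \<times> UNIV \<times> {..<0}) (\<lambda>(x, y, t). f x y t)"
    and "\<And>a b. b < 0 \<Longrightarrow> \<exists>M. \<forall>x y. \<forall>t\<in>{a..b}. \<bar>f x y t\<bar> \<le> M * cosh x powr n"
  shows "C0_growth n f"
  unfolding C0_growth_def by (intro conjI allI impI assms)

lemma C0_growth_continuous:
  "C0_growth n f \<Longrightarrow> continuous_on (UNIV \<times> UNIV \<times> {..<0}) (\<lambda>(x, y, t). f x y t)"
  unfolding C0_growth_def by (elim conjE)

lemma Ck_growth_pred: "Ck_growth n (Suc k) f \<Longrightarrow> Ck_growth n k f"
proof (induction k arbitrary: f)
  case 0
  then show ?case by (simp only: Ck_growth.simps)
next
  case (Suc k)
  from Suc.prems show ?case
    by (rule Ck_growth_SucE) (rule Ck_growth_SucI; (assumption | (rule Suc.IH, assumption)))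
qed

lemma C0_growth_cong:
  assumes "C0_growth n f" "\<And>x y t. t < 0 \<Longrightarrow> f x y t = g x y t"
  shows "C0_growth n g"
proof (rule C0_growthI)
  show "continuous_on (UNIV \<times> UNIV \<times> {..<0}) (\<lambda>(x, y, t). g x y t)"
    using C0_growth_continuous[OF assms(1)] by (rule continuous_on_eq) (use assms(2) in auto)
  show "\<exists>M. \<forall>x y. \<forall>t\<in>{a..b}. \<bar>g x y t\<bar> \<le> M * cosh x powr n" if b: "b < 0" for a b
  proof -
    obtain M where M: "\<forall>x y. \<forall>t\<in>{a..b}. \<bar>f x y t\<bar> \<le> M * cosh x powr n"
      by (rule C0_growth_boundE[OF assms(1) b])
    have "\<bar>g x y t\<bar> \<le> M * cosh x powr n" if "t \<in> {a..b}" for x y t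
      using M[rule_format, of t x y] that b assms(2)[of t x y] by simp
    then show ?thesis by blast
  qed
qed

lemma Ck_growth_cong:
  assumes "Ck_growth n k f" "\<And>x y t. t < 0 \<Longrightarrow> f x y t = g x y t"
  shows "Ck_growth n k g"
proof (cases k)
  case 0
  then show ?thesis using assms(1) C0_growth_cong[OF _ assms(2)] by simp
next
  case (Suc k')
  show ?thesis
  proof (rule Ck_growth_SucE[OF assms(1)[unfolded Suc]])
    fix fx fy ft assume
      d: "\<And>x y t. t < 0 \<Longrightarrow> ((\<lambda>s. f s y t) has_real_derivative fx x y t) (at x)"
        "\<And>x y t. t < 0 \<Longrightarrow> ((\<lambda>s. f x s t) has_real_derivative fy x y t) (at y)"
        "\<And>x y t. t < 0 \<Longrightarrow> ((\<lambda>s. f x y s) has_real_derivative ft x y t) (at t)"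
      and s: "Ck_growth n k' fx" "Ck_growth n k' fy" "Ck_growth n k' ft" "C0_growth n f"
    show "Ck_growth n k g" unfolding Suc
    proof (rule Ck_growth_SucI[OF _ _ _ s(1-3) C0_growth_cong[OF s(4) assms(2)]])
      fix x y t :: real assume t: "t < 0"
      \<comment> \<open>f and g agree only for t < 0, which suffices in the time direction because
        the half-line is open.\<close>
      show "((\<lambda>s. g x y s) has_real_derivative ft x y t) (at t)"
        by (rule has_field_derivative_transform_within_open[OF d(3)[OF t], of "{..<0}"])
          (use t assms(2) in auto)
      show "((\<lambda>s. g s y t) has_real_derivative fx x y t) (at x)"
        "((\<lambda>s. g x s t) has_real_derivative fy x y t) (at y)"
        using d(1,2)[OF t] unfolding assms(2)[OF t] .
    qed
  qed
qed

lemma tempered_cong: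
  assumes "tempered n f" "\<And>x y t. t < 0 \<Longrightarrow> f x y t = g x y t"
  shows "tempered n g"
  using assms(1) Ck_growth_cong[of n _ f g] assms(2) unfolding tempered_def by blast

lemma temperedD: "tempered n f \<Longrightarrow> Ck_growth n k f"
  by (simp add: tempered_def)

lemma tempered_C0_growth: "tempered n f \<Longrightarrow> C0_growth n f"
  by (rule Ck_growth_C0[OF temperedD[of n f 0]])

text \<open>The derivatives hidden in the existential quantifier of \<open>Ck_growth\<close> might
  differ from one k to the next. For t < 0 they all equal \<open>deriv\<close>, so that a single
  function \<open>Dx f\<close> carries the bounds of every order.\<close>

lemma tempered_D:
  assumes "tempered n f"
  shows "tempered n (Dx f)" "tempered n (Dy f)" "tempered n (Dt f)"
    and "\<And>x y t. t < 0 \<Longrightarrow> ((\<lambda>s. f s y t) has_real_derivative Dx f x y t) (at x)"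
    and "\<And>x y t. t < 0 \<Longrightarrow> ((\<lambda>s. f x s t) has_real_derivative Dy f x y t) (at y)"
    and "\<And>x y t. t < 0 \<Longrightarrow> ((\<lambda>s. f x y s) has_real_derivative Dt f x y t) (at t)"
proof -
  have *: "Ck_growth n k (Dx f) \<and> Ck_growth n k (Dy f) \<and> Ck_growth n k (Dt f) \<and> (\<forall>x y t. t < 0 \<longrightarrow>
      ((\<lambda>s. f s y t) has_real_derivative Dx f x y t) (at x) \<and>
      ((\<lambda>s. f x s t) has_real_derivative Dy f x y t) (at y) \<and>
      ((\<lambda>s. f x y s) has_real_derivative Dt f x y t) (at t))" for k
  proof (rule Ck_growth_SucE[OF temperedD[OF assms, of "Suc k"]])
    fix fx fy ft assume
      d: "\<And>x y t. t < 0 \<Longrightarrow> ((\<lambda>s. f s y t) has_real_derivative fx x y t) (at x)"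
        "\<And>x y t. t < 0 \<Longrightarrow> ((\<lambda>s. f x s t) has_real_derivative fy x y t) (at y)"
        "\<And>x y t. t < 0 \<Longrightarrow> ((\<lambda>s. f x y s) has_real_derivative ft x y t) (at t)"
      and s: "Ck_growth n k fx" "Ck_growth n k fy" "Ck_growth n k ft" "C0_growth n f"
    have e: "fx x y t = Dx f x y t" "fy x y t = Dy f x y t" "ft x y t = Dt f x y t" if "t < 0" for x y t
      unfolding Dx_def Dy_def Dt_def by (rule DERIV_imp_deriv[OF d(1)[OF that], symmetric]
          DERIV_imp_deriv[OF d(2)[OF that], symmetric] DERIV_imp_deriv[OF d(3)[OF that], symmetric])+
    show ?thesis
      using Ck_growth_cong[OF s(1) e(1)] Ck_growth_cong[OF s(2) e(2)] Ck_growth_cong[OF s(3) e(3)] d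
      by (simp add: e)
  qed
  show "tempered n (Dx f)" "tempered n (Dy f)" "tempered n (Dt f)"
    using * by (simp_all add: tempered_def)
  show "\<And>x y t. t < 0 \<Longrightarrow> ((\<lambda>s. f s y t) has_real_derivative Dx f x y t) (at x)"
    "\<And>x y t. t < 0 \<Longrightarrow> ((\<lambda>s. f x s t) has_real_derivative Dy f x y t) (at y)"
    "\<And>x y t. t < 0 \<Longrightarrow> ((\<lambda>s. f x y s) has_real_derivative Dt f x y t) (at t)"
    using * by blast+
qed

lemma tempered_continuous:
  "tempered n f \<Longrightarrow> continuous_on (UNIV \<times> UNIV \<times> {..<0}) (\<lambda>(x, y, t). f x y t)"
  by (rule C0_growth_continuous[OF tempered_C0_growth])

lemma tempered_bound:
  assumes "tempered n f" "b < 0"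
  obtains M where "M > 0" "\<And>x y t. t \<in> {a..b} \<Longrightarrow> \<bar>f x y t\<bar> \<le> M * cosh x powr n"
proof -
  obtain M where M: "\<forall>x y. \<forall>t\<in>{a..b}. \<bar>f x y t\<bar> \<le> M * cosh x powr n"
    by (rule C0_growth_boundE[OF tempered_C0_growth[OF assms(1)] assms(2)])
  have "\<bar>f x y t\<bar> \<le> (\<bar>M\<bar> + 1) * cosh x powr n" if "t \<in> {a..b}" for x y t
  proof -
    have "\<bar>f x y t\<bar> \<le> M * cosh x powr n" by (rule M[rule_format, OF that])
    also have "\<dots> \<le> (\<bar>M\<bar> + 1) * cosh x powr n" by (intro mult_right_mono) simp_all
    finally show ?thesis .
  qed
  then show thesis by (rule that[OF add_nonneg_pos[OF abs_ge_zero zero_less_one]])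
qed

section \<open>Closure properties of tempered functions\<close>

lemma C0_growth_mono:
  assumes "C0_growth m f" "m \<le> n" shows "C0_growth n f"
proof (rule C0_growthI[OF C0_growth_continuous[OF assms(1)]])
  fix a b :: real assume b: "b < 0"
  obtain M where M: "\<forall>x y. \<forall>t\<in>{a..b}. \<bar>f x y t\<bar> \<le> M * cosh x powr m"
    by (rule C0_growth_boundE[OF assms(1) b])
  have "\<bar>f x y t\<bar> \<le> \<bar>M\<bar> * cosh x powr n" if "t \<in> {a..b}" for x y t
  proof -
    have "\<bar>f x y t\<bar> \<le> M * cosh x powr m" by (rule M[rule_format, OF that])
    also have "\<dots> \<le> \<bar>M\<bar> * cosh x powr m" by (intro mult_right_mono) simp_all
    also have "\<dots> \<le> \<bar>M\<bar> * cosh x powr n"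
      using assms cosh_real_ge_1[of x] by (intro mult_left_mono powr_mono) simp_all
    finally show ?thesis .
  qed
  then show "\<exists>M. \<forall>x y. \<forall>t\<in>{a..b}. \<bar>f x y t\<bar> \<le> M * cosh x powr n" by blast
qed

lemma Ck_growth_mono: "Ck_growth m k f \<Longrightarrow> m \<le> n \<Longrightarrow> Ck_growth n k f"
proof (induction k arbitrary: f)
  case 0
  then show ?case by (simp add: C0_growth_mono)
next
  case (Suc k)
  note IH = Suc.IH[OF _ Suc.prems(2)]
  show ?case
    by (rule Ck_growth_SucE[OF Suc.prems(1)])
      (rule Ck_growth_SucI; (assumption | (rule IH, assumption) | (rule C0_growth_mono[OF _ Suc.prems(2)], assumption)))
qed

lemma tempered_mono: "tempered m f \<Longrightarrow> m \<le> n \<Longrightarrow> tempered n f"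
  using Ck_growth_mono unfolding tempered_def by blast

lemma C0_growth_add: assumes "C0_growth n f" "C0_growth n g" shows "C0_growth n (\<lambda>x y t. f x y t + g x y t)"
proof (rule C0_growthI)
  show "continuous_on (UNIV \<times> UNIV \<times> {..<0}) (\<lambda>(x, y, t). f x y t + g x y t)"
    using C0_growth_continuous[OF assms(1)] C0_growth_continuous[OF assms(2)] unfolding case_prod_unfold
    by (rule continuous_on_add)
  fix a b :: real assume b: "b < 0"
  obtain M1 where M1: "\<forall>x y. \<forall>t\<in>{a..b}. \<bar>f x y t\<bar> \<le> M1 * cosh x powr n"
    by (rule C0_growth_boundE[OF assms(1) b])
  obtain M2 where M2: "\<forall>x y. \<forall>t\<in>{a..b}. \<bar>g x y t\<bar> \<le> M2 * cosh x powr n"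
    by (rule C0_growth_boundE[OF assms(2) b])
  have "\<bar>f x y t + g x y t\<bar> \<le> (M1 + M2) * cosh x powr n" if "t \<in> {a..b}" for x y t
    using M1[rule_format, OF that, of x y] M2[rule_format, OF that, of x y]
    unfolding distrib_right by linarith
  then show "\<exists>M. \<forall>x y. \<forall>t\<in>{a..b}. \<bar>f x y t + g x y t\<bar> \<le> M * cosh x powr n" by blast
qed

lemma C0_growth_mult: assumes "C0_growth m f" "C0_growth n g" shows "C0_growth (m + n) (\<lambda>x y t. f x y t * g x y t)"
proof (rule C0_growthI)
  show "continuous_on (UNIV \<times> UNIV \<times> {..<0}) (\<lambda>(x, y, t). f x y t * g x y t)"
    using C0_growth_continuous[OF assms(1)] C0_growth_continuous[OF assms(2)] unfolding case_prod_unfold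
    by (rule continuous_on_mult)
  fix a b :: real assume b: "b < 0"
  obtain M1 where M1: "\<forall>x y. \<forall>t\<in>{a..b}. \<bar>f x y t\<bar> \<le> M1 * cosh x powr m"
    by (rule C0_growth_boundE[OF assms(1) b])
  obtain M2 where M2: "\<forall>x y. \<forall>t\<in>{a..b}. \<bar>g x y t\<bar> \<le> M2 * cosh x powr n"
    by (rule C0_growth_boundE[OF assms(2) b])
  have "\<bar>f x y t * g x y t\<bar> \<le> (M1 * M2) * cosh x powr (m + n)" if "t \<in> {a..b}" for x y t
  proof -
    have "\<bar>f x y t * g x y t\<bar> \<le> (M1 * cosh x powr m) * (M2 * cosh x powr n)"
      unfolding abs_mult using M1[rule_format, OF that, of x y] M2[rule_format, OF that, of x y]
      by (intro mult_mono) (simp_all add: order_trans[OF abs_ge_zero])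
    then show ?thesis by (simp add: powr_add mult_ac)
  qed
  then show "\<exists>M. \<forall>x y. \<forall>t\<in>{a..b}. \<bar>f x y t * g x y t\<bar> \<le> M * cosh x powr (m + n)" by blast
qed

lemma Ck_growth_add: "Ck_growth n k f \<Longrightarrow> Ck_growth n k g \<Longrightarrow> Ck_growth n k (\<lambda>x y t. f x y t + g x y t)"
proof (induction k arbitrary: f g)
  case 0
  then show ?case using C0_growth_add by simp
next
  case (Suc k)
  show ?case
    by (rule Ck_growth_SucE[OF Suc.prems(1)], rule Ck_growth_SucE[OF Suc.prems(2)], rule Ck_growth_SucI)
      (rule DERIV_add Suc.IH C0_growth_add; assumption)+
qed

text \<open>Derivatives carry the same index as the function itself, so both terms of the product
  rule have index m + n.\<close>

lemma Ck_growth_mult: "Ck_growth m k f \<Longrightarrow> Ck_growth n k g \<Longrightarrow> Ck_growth (m + n) k (\<lambda>x y t. f x y t * g x y t)"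
proof (induction k arbitrary: f g)
  case 0
  then show ?case using C0_growth_mult by simp
next
  case (Suc k)
  note fg = Ck_growth_pred[OF Suc.prems(1)] Ck_growth_pred[OF Suc.prems(2)]
  have gf: "Ck_growth (m + n) k (\<lambda>x y t. h x y t * f x y t)" if "Ck_growth n k h" for h
    using Suc.IH[OF fg(1) that] by (simp only: mult.commute)
  have p: "Ck_growth (m + n) k (\<lambda>x y t. h x y t * g x y t + h' x y t * f x y t)"
    if "Ck_growth m k h" "Ck_growth n k h'" for h h'
    by (rule Ck_growth_add[OF Suc.IH[OF that(1) fg(2)] gf[OF that(2)]])
  show ?case
    by (rule Ck_growth_SucE[OF Suc.prems(1)], rule Ck_growth_SucE[OF Suc.prems(2)], rule Ck_growth_SucI)
      (rule DERIV_mult p C0_growth_mult; assumption)+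
qed

lemma tempered_add: "tempered n f \<Longrightarrow> tempered n g \<Longrightarrow> tempered n (\<lambda>x y t. f x y t + g x y t)"
  using Ck_growth_add by (simp add: tempered_def)
lemma tempered_mult: "tempered m f \<Longrightarrow> tempered n g \<Longrightarrow> tempered (m + n) (\<lambda>x y t. f x y t * g x y t)"
  using Ck_growth_mult by (simp add: tempered_def)

lemma C0_growth_const: "C0_growth 0 (\<lambda>x y t. c)"
  by (rule C0_growthI) (auto intro: exI[of _ "\<bar>c\<bar>"])

lemma Ck_growth_const: "Ck_growth 0 k (\<lambda>x y t. c)"
proof (induction k arbitrary: c)
  case 0
  then show ?case by (simp add: C0_growth_const)
next
  case (Suc k)
  show ?case by (rule Ck_growth_SucI[OF DERIV_const DERIV_const DERIV_const Suc Suc Suc C0_growth_const])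
qed
lemma tempered_const: "tempered 0 (\<lambda>x y t. c)" by (simp add: tempered_def Ck_growth_const)

lemma tempered_cmult: "tempered n f \<Longrightarrow> tempered n (\<lambda>x y t. c * f x y t)"
  using tempered_mult[OF tempered_const, of n f c] by simp
lemma tempered_minus: "tempered n f \<Longrightarrow> tempered n (\<lambda>x y t. - f x y t)"
  using tempered_cmult[of n f "-1"] by simp
lemma Ck_growth_minus: "Ck_growth n k f \<Longrightarrow> Ck_growth n k (\<lambda>x y t. - f x y t)"
  using Ck_growth_mult[OF Ck_growth_const, of n k f "-1"] by simp

text \<open>Pointwise positivity would not bound the reciprocal near the poles: the lower bound has
  to be uniform on the noncompact cylinder.\<close>

definition slab_pos :: "(real \<Rightarrow> real \<Rightarrow> real \<Rightarrow> real) \<Rightarrow> bool" where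
  "slab_pos f \<longleftrightarrow> (\<forall>a b. b < 0 \<longrightarrow> (\<exists>c>0. \<forall>x y. \<forall>t\<in>{a..b}. f x y t \<ge> c))"

lemma slab_posE:
  assumes "slab_pos f" "b < 0"
  obtains c where "c > 0" "\<And>x y t. t \<in> {a..b} \<Longrightarrow> f x y t \<ge> c"
  using assms unfolding slab_pos_def by metis

lemma slab_pos_pos: "slab_pos f \<Longrightarrow> t < 0 \<Longrightarrow> f x y t > 0"
  by (rule slab_posE[of f t t]) (auto intro: less_le_trans)

lemma C0_growth_inverse:
  assumes f: "C0_growth 0 f" and pos: "slab_pos f"
  shows "C0_growth 0 (\<lambda>x y t. inverse (f x y t))"
proof (rule C0_growthI)
  show "continuous_on (UNIV \<times> UNIV \<times> {..<0}) (\<lambda>(x, y, t). inverse (f x y t))"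
    using C0_growth_continuous[OF f] slab_pos_pos[OF pos, THEN less_imp_neq] unfolding case_prod_unfold
    by (intro continuous_on_inverse) (auto dest: not_sym)
  fix a b :: real assume b: "b < 0"
  obtain c where c: "c > 0" "\<And>x y t. t \<in> {a..b} \<Longrightarrow> f x y t \<ge> c"
    by (rule slab_posE[OF pos b]) blast
  have "\<bar>inverse (f x y t)\<bar> \<le> inverse c * cosh x powr 0" if "t \<in> {a..b}" for x y t
  proof -
    have "f x y t \<ge> c" by (rule c(2)[OF that])
    moreover from this have "f x y t > 0" using c(1) by linarith
    ultimately show ?thesis using c(1) by (simp add: le_imp_inverse_le)
  qed
  then show "\<exists>M. \<forall>x y. \<forall>t\<in>{a..b}. \<bar>inverse (f x y t)\<bar> \<le> M * cosh x powr 0" by blast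
qed

lemma Ck_growth_inverse:
  assumes pos: "slab_pos f"
  shows "Ck_growth 0 k f \<Longrightarrow> Ck_growth 0 k (\<lambda>x y t. inverse (f x y t))"
proof (induction k)
  case 0
  then show ?case using C0_growth_inverse pos by simp
next
  case (Suc k)
  have i: "Ck_growth 0 k (\<lambda>x y t. inverse (f x y t))" using Suc.IH Ck_growth_pred[OF Suc.prems] .
  have p: "Ck_growth 0 k (\<lambda>x y t. - (inverse (f x y t) * g x y t * inverse (f x y t)))" if "Ck_growth 0 k g" for g
    using Ck_growth_minus[OF Ck_growth_mult[OF Ck_growth_mult[OF i that] i]] by simp
  note nz = slab_pos_pos[OF pos, THEN less_imp_neq, THEN not_sym]
  show ?case
    by (rule Ck_growth_SucE[OF Suc.prems], rule Ck_growth_SucI)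
      ((rule DERIV_inverse', assumption, erule nz) | (rule p, assumption)
        | (rule C0_growth_inverse[OF _ pos], assumption) | assumption)+
qed

lemma tempered_inverse:
  "slab_pos f \<Longrightarrow> tempered 0 f \<Longrightarrow> tempered 0 (\<lambda>x y t. inverse (f x y t))"
  using Ck_growth_inverse by (simp add: tempered_def)

text \<open>Only the logarithm itself needs a separate bound: its derivatives are the derivatives of
  f divided by f, which are already tempered to every order.\<close>

lemma tempered_ln:
  assumes pos: "slab_pos f" and f: "tempered 0 f"
  shows "tempered 0 (\<lambda>x y t. ln (f x y t))"
proof -
  have s0: "C0_growth 0 (\<lambda>x y t. ln (f x y t))"
  proof (rule C0_growthI)
    show "continuous_on (UNIV \<times> UNIV \<times> {..<0}) (\<lambda>(x, y, t). ln (f x y t))"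
      using tempered_continuous[OF f] slab_pos_pos[OF pos, THEN less_imp_neq] unfolding case_prod_unfold
      by (intro continuous_on_ln) (auto dest: not_sym)
    fix a b :: real assume b: "b < 0"
    obtain c where c: "c > 0" "\<And>x y t. t \<in> {a..b} \<Longrightarrow> f x y t \<ge> c"
      by (rule slab_posE[OF pos b]) blast
    obtain M where M: "M > 0" "\<And>x y t. t \<in> {a..b} \<Longrightarrow> \<bar>f x y t\<bar> \<le> M * cosh x powr 0"
      by (rule tempered_bound[OF f b, of a]) blast
    have "\<bar>ln (f x y t)\<bar> \<le> (\<bar>ln c\<bar> + \<bar>ln M\<bar>) * cosh x powr 0" if "t \<in> {a..b}" for x y t
    proof -
      have 1: "c \<le> f x y t" "f x y t \<le> M" using c(2)[OF that, of x y] M(2)[OF that, of x y] by simp_all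
      then have "ln c \<le> ln (f x y t)" "ln (f x y t) \<le> ln M" using c(1) by simp_all
      then show ?thesis by simp
    qed
    then show "\<exists>M. \<forall>x y. \<forall>t\<in>{a..b}. \<bar>ln (f x y t)\<bar> \<le> M * cosh x powr 0" by blast
  qed
  have i: "Ck_growth 0 k (\<lambda>x y t. inverse (f x y t) * g x y t)" if "tempered 0 g" for g k
    using temperedD[OF tempered_mult[OF tempered_inverse[OF pos f] that]] by simp
  have d: "((\<lambda>s. ln (g s)) has_real_derivative inverse (g s) * g') (at s)"
    if "(g has_real_derivative g') (at s)" "g s > 0" for g g' s
    using that by (auto intro!: derivative_eq_intros simp: field_simps)
  have "Ck_growth 0 (Suc k) (\<lambda>x y t. ln (f x y t))" for k
    by (rule Ck_growth_SucI[OF _ _ _ i[OF tempered_D(1)[OF f]] i[OF tempered_D(2)[OF f]] i[OF tempered_D(3)[OF f]] s0])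
      (rule d, rule tempered_D(4-6)[OF f], assumption, erule slab_pos_pos[OF pos])+
  then have "Ck_growth 0 k (\<lambda>x y t. ln (f x y t))" for k using Ck_growth_pred by blast
  then show ?thesis by (simp add: tempered_def)
qed

section \<open>Explicit functions on the cylinder\<close>

lemma cosh_powr_m1: "cosh x powr -1 = inverse (cosh (x::real))"
  by (simp add: powr_minus powr_one)

lemma abs_tanh_le_1: "\<bar>tanh (x::real)\<bar> \<le> 1"
  using tanh_real_bounds[of x] by (simp add: abs_le_iff)

lemma DERIV_sech: "((\<lambda>s. inverse (cosh s)) has_real_derivative - (inverse (cosh x) * tanh x)) (at x)"
  by (auto intro!: derivative_eq_intros simp: tanh_def field_simps power2_eq_square)

lemma DERIV_tanh: "((\<lambda>s. tanh s) has_real_derivative 1 + - (tanh x * tanh x)) (at (x::real))"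
  by (auto intro!: derivative_eq_intros simp: power2_eq_square)

lemma sech_tanh_squares: "(inverse (cosh x))\<^sup>2 + (tanh x)\<^sup>2 = (1::real)"
proof -
  have "(inverse (cosh x))\<^sup>2 + (tanh x)\<^sup>2 = (1 + (sinh x)\<^sup>2) / (cosh x)\<^sup>2"
    by (simp add: tanh_def power_divide power_inverse add_divide_distrib inverse_eq_divide)
  also have "1 + (sinh x)\<^sup>2 = (cosh x)\<^sup>2" by (simp add: cosh_square_eq)
  finally show ?thesis by simp
qed

lemma C0_growth_sech: "C0_growth (-1) (\<lambda>x y t. inverse (cosh x))"
proof (rule C0_growthI)
  fix a b :: real
  show "\<exists>M. \<forall>(x::real) y::real. \<forall>t\<in>{a..b}. \<bar>inverse (cosh x)\<bar> \<le> M * cosh x powr - 1"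
    by (intro exI[of _ 1]) (simp add: cosh_powr_m1 inverse_eq_divide)
qed (auto intro!: continuous_intros simp: case_prod_unfold)

lemma C0_growth_tanh: "C0_growth 0 (\<lambda>x y t. tanh x)"
proof (rule C0_growthI)
  fix a b :: real
  show "\<exists>M. \<forall>(x::real) y::real. \<forall>t\<in>{a..b}. \<bar>tanh x\<bar> \<le> M * cosh x powr 0"
    by (intro exI[of _ 1]) (simp add: abs_tanh_le_1)
qed (auto intro!: continuous_intros simp: case_prod_unfold)

text \<open>A joint induction, because the derivatives of sech and tanh are polynomials in the two.
  The derivative of sech keeps a factor sech and hence the index -1.\<close>

lemma Ck_growth_sech_tanh:
  "Ck_growth (-1) k (\<lambda>x y t. inverse (cosh x)) \<and> Ck_growth 0 k (\<lambda>x y t. tanh x)"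
proof (induction k)
  case 0
  then show ?case by (simp add: C0_growth_sech C0_growth_tanh)
next
  case (Suc k)
  have "Ck_growth (-1) k (\<lambda>x y t. - (inverse (cosh x) * tanh x))"
    using Ck_growth_minus[OF Ck_growth_mult[OF Suc[THEN conjunct1] Suc[THEN conjunct2]]] by simp
  moreover have "Ck_growth 0 k (\<lambda>x y t. 1 + - (tanh x * tanh x))"
  proof -
    have "Ck_growth 0 k (\<lambda>x y t. tanh x * tanh x)"
      using Ck_growth_mult[OF Suc[THEN conjunct2] Suc[THEN conjunct2]] by simp
    then show ?thesis by (intro Ck_growth_add Ck_growth_minus Ck_growth_const)
  qed
  moreover note z = Ck_growth_const[of k 0]
  moreover have z1: "Ck_growth (-1) k (\<lambda>x y t. 0)"
    using Ck_growth_mult[OF Suc[THEN conjunct1] Ck_growth_const[of k 0]] by simp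
  ultimately show ?case
    using Ck_growth_SucI[OF DERIV_sech DERIV_const DERIV_const _ z1 z1 C0_growth_sech]
      Ck_growth_SucI[OF DERIV_tanh DERIV_const DERIV_const _ z z C0_growth_tanh] by blast
qed

lemma tempered_sech: "tempered (-1) (\<lambda>x y t. inverse (cosh x))"
  and tempered_tanh: "tempered 0 (\<lambda>x y t. tanh x)"
  using Ck_growth_sech_tanh by (simp_all add: tempered_def)

lemma C0_growth_cosh: "C0_growth 1 (\<lambda>x y t. cosh x)"
proof (rule C0_growthI)
  fix a b :: real
  show "\<exists>M. \<forall>(x::real) y::real. \<forall>t\<in>{a..b}. \<bar>cosh x\<bar> \<le> M * cosh x powr 1"
    by (intro exI[of _ 1]) (simp add: powr_one)
qed (auto intro!: continuous_intros simp: case_prod_unfold)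

lemma C0_growth_sinh: "C0_growth 1 (\<lambda>x y t. sinh x)"
proof (rule C0_growthI)
  fix a b :: real
  have "\<bar>sinh x\<bar> \<le> cosh x" for x :: real
    using sinh_le_cosh_real[of x] sinh_le_cosh_real[of "-x"] by (simp add: abs_le_iff)
  then show "\<exists>M. \<forall>(x::real) y::real. \<forall>t\<in>{a..b}. \<bar>sinh x\<bar> \<le> M * cosh x powr 1"
    by (intro exI[of _ 1]) (simp add: powr_one)
qed (auto intro!: continuous_intros simp: case_prod_unfold)

lemma Ck_growth_zero: "Ck_growth n k (\<lambda>x y t. 0)"
proof -
  have "C0_growth n (\<lambda>x y t. 0)" for n by (rule C0_growthI) (auto intro: exI[of _ 0])
  then show ?thesis
  proof (induction k)
    case (Suc k)
    then show ?case by (intro Ck_growth_SucI[OF DERIV_const DERIV_const DERIV_const]) auto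
  qed auto
qed

lemma Ck_growth_cosh_sinh: "Ck_growth 1 k (\<lambda>x y t. cosh x) \<and> Ck_growth 1 k (\<lambda>x y t. sinh x)"
proof (induction k)
  case 0
  then show ?case by (simp add: C0_growth_cosh C0_growth_sinh)
next
  case (Suc k)
  have "((\<lambda>s. cosh s) has_real_derivative sinh x) (at x)"
    "((\<lambda>s. sinh s) has_real_derivative cosh x) (at x)" for x :: real
    by (auto intro!: derivative_eq_intros)
  with Suc show ?case
    by (intro conjI Ck_growth_SucI[OF _ DERIV_const DERIV_const _ Ck_growth_zero Ck_growth_zero] C0_growth_cosh C0_growth_sinh) auto
qed

lemma tempered_cosh: "tempered 1 (\<lambda>x y t. cosh x)"
  and tempered_sinh: "tempered 1 (\<lambda>x y t. sinh x)"
  using Ck_growth_cosh_sinh by (simp_all add: tempered_def)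

lemma C0_growth_cos: "C0_growth 0 (\<lambda>x y t. cos y)" and C0_growth_sin: "C0_growth 0 (\<lambda>x y t. sin y)"
  by (rule C0_growthI; auto intro!: continuous_intros exI[of _ 1] simp: case_prod_unfold)+

lemma Ck_growth_cos_sin: "Ck_growth 0 k (\<lambda>x y t. cos y) \<and> Ck_growth 0 k (\<lambda>x y t. sin y)"
proof (induction k)
  case 0
  then show ?case by (simp add: C0_growth_cos C0_growth_sin)
next
  case (Suc k)
  have "Ck_growth 0 k (\<lambda>x y t. - sin y)" using Ck_growth_minus Suc by blast
  then show ?case using Suc
    by (intro conjI Ck_growth_SucI[OF DERIV_const DERIV_cos DERIV_const Ck_growth_zero _ Ck_growth_zero]
      Ck_growth_SucI[OF DERIV_const DERIV_sin DERIV_const Ck_growth_zero _ Ck_growth_zero] C0_growth_cos C0_growth_sin) auto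
qed

lemma tempered_cos: "tempered 0 (\<lambda>x y t. cos y)"
  and tempered_sin: "tempered 0 (\<lambda>x y t. sin y)"
  using Ck_growth_cos_sin by (simp_all add: tempered_def)

section \<open>Mercator parametrization of the sphere without its poles\<close>

definition cyl :: "real \<Rightarrow> real \<Rightarrow> real^3" where
  "cyl x y = vector [inverse (cosh x) * cos y, inverse (cosh x) * sin y, tanh x]"

lemma cyl_in_sphere: "cyl x y \<in> sphere 0 1"
proof -
  have "(inverse (cosh x) * cos y)\<^sup>2 + (inverse (cosh x) * sin y)\<^sup>2 + (tanh x)\<^sup>2
      = (inverse (cosh x))\<^sup>2 * ((sin y)\<^sup>2 + (cos y)\<^sup>2) + (tanh x)\<^sup>2"
    unfolding power_mult_distrib by (simp only: distrib_left add_ac)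
  also have "\<dots> = 1" by (simp only: sin_cos_squared_add mult_1_right sech_tanh_squares)
  finally show ?thesis by (simp add: norm_eq_1_real3 cyl_def)
qed

definition ax :: "3 \<Rightarrow> (real^3) \<times> real" where "ax i = (axis i 1, 0)"

lemma cyl_pair_eq: "(cyl x y, t) = (inverse (cosh x) * cos y) *\<^sub>R ax 1
    + (inverse (cosh x) * sin y) *\<^sub>R ax 2 + tanh x *\<^sub>R ax 3 + t *\<^sub>R (0, 1)"
  by (simp add: cyl_def ax_def vec_eq_iff forall_3 axis_def)

lemma has_real_derivative_along_curve:
  fixes H :: "'a::real_normed_vector \<Rightarrow> real"
  assumes H: "H differentiable (at (g x))" and g: "(g has_vector_derivative g') (at x)"
  shows "((\<lambda>s. H (g s)) has_real_derivative frechet_derivative H (at (g x)) g') (at x)"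
proof -
  let ?D = "frechet_derivative H (at (g x))"
  have D: "(H has_derivative ?D) (at (g x))" using H frechet_derivative_works by blast
  have "((\<lambda>s. H (g s)) has_derivative (\<lambda>h. ?D (h *\<^sub>R g'))) (at x)"
    using has_derivative_compose[OF g[unfolded has_vector_derivative_def] D] by simp
  moreover have "(\<lambda>h. ?D (h *\<^sub>R g')) = (*) (?D g')"
    using has_derivative_linear[OF D] by (auto simp: linear_cmul mult.commute)
  ultimately show ?thesis by (simp add: has_field_derivative_def)
qed

lemma has_vector_derivative_scaleR_const:
  "(f has_real_derivative f') (at x) \<Longrightarrow> ((\<lambda>s. f s *\<^sub>R c) has_vector_derivative f' *\<^sub>R c) (at x)"
  using has_vector_derivative_scaleR[OF _ has_vector_derivative_const[of c], of f f' x UNIV] by simp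

lemma cyl_curve_x: "((\<lambda>s. (cyl s y, t)) has_vector_derivative
    (- (inverse (cosh x) * tanh x) * cos y) *\<^sub>R ax 1 + (- (inverse (cosh x) * tanh x) * sin y) *\<^sub>R ax 2
      + (inverse (cosh x) * inverse (cosh x)) *\<^sub>R ax 3) (at x)"
proof -
  have "1 + - (tanh x * tanh x) = inverse (cosh x) * inverse (cosh x)"
    using sech_tanh_squares[of x] by (simp add: power2_eq_square)
  then have t: "((\<lambda>s. tanh s) has_real_derivative inverse (cosh x) * inverse (cosh x)) (at x)"
    using DERIV_tanh[of x] by simp
  note d = has_vector_derivative_scaleR_const
  have s: "((\<lambda>s. inverse (cosh s) * c) has_real_derivative - (inverse (cosh x) * tanh x) * c) (at x)" for c
    using DERIV_cmult_right[OF DERIV_sech[of x], of c] by simp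
  show ?thesis unfolding cyl_pair_eq
    using has_vector_derivative_add[OF has_vector_derivative_add[OF has_vector_derivative_add[OF
      d[OF s[of "cos y"], of "ax 1"] d[OF s[of "sin y"], of "ax 2"]] d[OF t, of "ax 3"]]
      has_vector_derivative_const[of "t *\<^sub>R (0, 1)"]] by simp
qed

lemma cyl_curve_y: "((\<lambda>s. (cyl x s, t)) has_vector_derivative
    (- inverse (cosh x) * sin y) *\<^sub>R ax 1 + (inverse (cosh x) * cos y) *\<^sub>R ax 2) (at y)"
proof -
  note d = has_vector_derivative_scaleR_const
  have s: "((\<lambda>s. inverse (cosh x) * sin s) has_real_derivative inverse (cosh x) * cos y) (at y)"
    "((\<lambda>s. inverse (cosh x) * cos s) has_real_derivative - inverse (cosh x) * sin y) (at y)"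
    by (auto intro!: derivative_eq_intros)
  show ?thesis unfolding cyl_pair_eq
    using has_vector_derivative_add[OF has_vector_derivative_add[OF
      d[OF s(2), of "ax 1"] d[OF s(1), of "ax 2"]]
      has_vector_derivative_const[of "tanh x *\<^sub>R ax 3 + t *\<^sub>R (0, 1)"]] by (simp add: add.assoc)
qed

lemma cyl_curve_t: "((\<lambda>s. (cyl x y, s)) has_vector_derivative (0, 1)) (at t)"
  unfolding cyl_pair_eq by (auto intro!: derivative_eq_intros)

context
  fixes T :: "((real^3) \<times> real) set"
  assumes T: "sphere 0 1 \<times> {..<0} \<subseteq> T"
begin

lemma cyl_in_T: "t < 0 \<Longrightarrow> (cyl x y, t) \<in> T"
  using T cyl_in_sphere by blast

text \<open>Both coordinate tangent vectors of \<open>cyl\<close> have length inverse (cosh x). This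
  common factor is what lowers the index of the x- and y-derivatives to -1 in
  \<open>tempered_ambient_derivs\<close>.\<close>

lemma ambient_derivs:
  assumes H: "\<And>k. Ck_on k H T" and t: "t < 0"
  defines "P \<equiv> \<lambda>i x y t. frechet_derivative H (at (cyl x y, t)) (ax i)"
  shows "((\<lambda>s. H (cyl s y, t)) has_real_derivative inverse (cosh x) *
      (- (tanh x * cos y * P 1 x y t) + - (tanh x * sin y * P 2 x y t)
         + inverse (cosh x) * P 3 x y t)) (at x)"
    "((\<lambda>s. H (cyl x s, t)) has_real_derivative inverse (cosh x) *
      (- (sin y * P 1 x y t) + cos y * P 2 x y t)) (at y)"
    "((\<lambda>s. H (cyl x y, s)) has_real_derivative frechet_derivative H (at (cyl x y, t)) (0, 1)) (at t)"
proof -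
  have d: "H differentiable (at (cyl x y, t))"
    using H[of "Suc 0"] cyl_in_T[OF t] by auto
  have l: "linear (frechet_derivative H (at (cyl x y, t)))"
    by (rule linear_frechet_derivative[OF d])
  show "((\<lambda>s. H (cyl x y, s)) has_real_derivative frechet_derivative H (at (cyl x y, t)) (0, 1)) (at t)"
    by (rule has_real_derivative_along_curve[where g = "\<lambda>s. (cyl x y, s)", OF d cyl_curve_t])
  show "((\<lambda>s. H (cyl s y, t)) has_real_derivative inverse (cosh x) *
      (- (tanh x * cos y * P 1 x y t) + - (tanh x * sin y * P 2 x y t)
         + inverse (cosh x) * P 3 x y t)) (at x)"
    using has_real_derivative_along_curve[where g = "\<lambda>s. (cyl s y, t)", OF d cyl_curve_x]
    unfolding linear_add[OF l] linear_cmul[OF l] P_def[symmetric]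
    by (simp add: algebra_simps P_def)
  show "((\<lambda>s. H (cyl x s, t)) has_real_derivative inverse (cosh x) *
      (- (sin y * P 1 x y t) + cos y * P 2 x y t)) (at y)"
    using has_real_derivative_along_curve[where g = "\<lambda>s. (cyl x s, t)", OF d cyl_curve_y]
    unfolding linear_add[OF l] linear_cmul[OF l]
    by (simp add: algebra_simps P_def)
qed

lemma ax_Basis: "ax i \<in> Basis" "((0, 1) :: (real^3) \<times> real) \<in> Basis"
  by (auto simp: ax_def Basis_prod_def axis_in_Basis_iff)

lemma continuous_on_cyl: "continuous_on (S :: (real \<times> real \<times> real) set) (\<lambda>(x, y, t). (cyl x y, t))"
proof -
  have "continuous_on S (\<lambda>p. (inverse (cosh (fst p)) * cos (fst (snd p))) *\<^sub>R ax 1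
    + (inverse (cosh (fst p)) * sin (fst (snd p))) *\<^sub>R ax 2 + tanh (fst p) *\<^sub>R ax 3 + snd (snd p) *\<^sub>R (0, 1))"
    by (auto intro!: continuous_intros)
  then show ?thesis by (simp only: case_prod_unfold cyl_pair_eq)
qed

text \<open>The bound is uniform in x because the sphere, poles included, times [a, b] is compact,
  although the cylinder is not.\<close>

lemma C0_growth_ambient:
  assumes H: "continuous_on T H"
  shows "C0_growth 0 (\<lambda>x y t. H (cyl x y, t))"
proof (rule C0_growthI)
  have "continuous_on (UNIV \<times> UNIV \<times> {..<0}) (H \<circ> (\<lambda>(x, y, t). (cyl x y, t)))"
    by (rule continuous_on_compose[OF continuous_on_cyl continuous_on_subset[OF H]])
      (auto simp: cyl_in_T)
  then show "continuous_on (UNIV \<times> UNIV \<times> {..<0}) (\<lambda>(x, y, t). H (cyl x y, t))"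
    by (simp add: o_def case_prod_unfold)
  fix a b :: real assume b: "b < 0"
  have "compact (H ` (sphere 0 1 \<times> {a..b}))"
    using b T by (intro compact_continuous_image continuous_on_subset[OF H] compact_Times) auto
  then obtain M where "\<forall>z \<in> H ` (sphere 0 1 \<times> {a..b}). norm z \<le> M"
    using compact_imp_bounded bounded_iff by metis
  then have "\<bar>H (cyl x y, t)\<bar> \<le> M * cosh x powr 0" if "t \<in> {a..b}" for x y t
    using that cyl_in_sphere[of x y] by auto
  then show "\<exists>M. \<forall>(x::real) y::real. \<forall>t\<in>{a..b}. \<bar>H (cyl x y, t)\<bar> \<le> M * cosh x powr 0" by blast
qed

lemma Ck_growth_ambient: "(\<And>j. Ck_on j H T) \<Longrightarrow> Ck_growth 0 k (\<lambda>x y t. H (cyl x y, t))"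
proof (induction k arbitrary: H)
  case 0
  have "continuous_on T H" using 0[of 0] by simp
  then show ?case by (simp add: C0_growth_ambient)
next
  case (Suc k)
  have P: "Ck_growth 0 k (\<lambda>x y t. frechet_derivative H (at (cyl x y, t)) b)" if "b \<in> Basis" for b
  proof (rule Suc.IH)
    fix j show "Ck_on j (\<lambda>p. frechet_derivative H (at p) b) T"
      using Suc.prems[of "Suc j"] that by simp
  qed
  have m: "Ck_growth 0 k (\<lambda>x y t. f x y t * g x y t)" if "Ck_growth 0 k f" "Ck_growth 0 k g" for f g
    using Ck_growth_mult[OF that] by simp
  note sech = Ck_growth_mono[OF temperedD[OF tempered_sech], of 0, simplified]
  note r = Ck_growth_add Ck_growth_minus m sech P ax_Basis temperedD[OF tempered_tanh] temperedD[OF tempered_cos]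
    temperedD[OF tempered_sin]
  show ?case
    by (rule Ck_growth_SucI, rule ambient_derivs(1)[OF Suc.prems], assumption,
        rule ambient_derivs(2)[OF Suc.prems], assumption,
        rule ambient_derivs(3)[OF Suc.prems], assumption)
      (intro r C0_growth_ambient Suc.prems[of 0, simplified])+
qed

lemma tempered_ambient:
  assumes "\<And>j. Ck_on j H T"
  shows "tempered 0 (\<lambda>x y t. H (cyl x y, t))"
  using Ck_growth_ambient[OF assms] by (simp add: tempered_def)

lemma tempered_ambient_derivs:
  assumes H: "\<And>j. Ck_on j H T"
  shows "tempered (-1) (Dx (\<lambda>x y t. H (cyl x y, t)))" "tempered (-1) (Dy (\<lambda>x y t. H (cyl x y, t)))"
proof -
  have P: "tempered 0 (\<lambda>x y t. frechet_derivative H (at (cyl x y, t)) b)" if "b \<in> Basis" for b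
  proof (rule tempered_ambient)
    fix j show "Ck_on j (\<lambda>p. frechet_derivative H (at p) b) T"
      using H[of "Suc j"] that by simp
  qed
  have m: "tempered 0 (\<lambda>x y t. f x y t * g x y t)" if "tempered 0 f" "tempered 0 g" for f g
    using tempered_mult[OF that] by simp
  have s: "tempered (-1) (\<lambda>x y t. inverse (cosh x) * g x y t)" if "tempered 0 g" for g
    using tempered_mult[OF tempered_sech that] by simp
  note sech = tempered_mono[OF tempered_sech, of 0, simplified]
  note r = s tempered_add tempered_minus m sech P ax_Basis tempered_tanh tempered_cos tempered_sin
  show "tempered (-1) (Dx (\<lambda>x y t. H (cyl x y, t)))"
  proof (rule tempered_cong)
    fix x y t :: real assume t: "t < 0"
    show "inverse (cosh x) *
      (- (tanh x * cos y * frechet_derivative H (at (cyl x y, t)) (ax 1))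
        + - (tanh x * sin y * frechet_derivative H (at (cyl x y, t)) (ax 2))
         + inverse (cosh x) * frechet_derivative H (at (cyl x y, t)) (ax 3)) = Dx (\<lambda>x y t. H (cyl x y, t)) x y t"
      unfolding Dx_def by (rule DERIV_imp_deriv[OF ambient_derivs(1)[OF H t], symmetric])
  qed (intro r)
  show "tempered (-1) (Dy (\<lambda>x y t. H (cyl x y, t)))"
  proof (rule tempered_cong)
    fix x y t :: real assume t: "t < 0"
    show "inverse (cosh x) * (- (sin y * frechet_derivative H (at (cyl x y, t)) (ax 1))
        + cos y * frechet_derivative H (at (cyl x y, t)) (ax 2)) = Dy (\<lambda>x y t. H (cyl x y, t)) x y t"
      unfolding Dy_def by (rule DERIV_imp_deriv[OF ambient_derivs(2)[OF H t], symmetric])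
  qed (intro r)
qed

end

lemma tempered_commute:
  assumes f: "tempered n f" and t: "t < 0"
  shows "Dx (Dt f) x y t = Dt (Dx f) x y t" "Dy (Dt f) x y t = Dt (Dy f) x y t"
    "Dx (Dy f) x y t = Dy (Dx f) x y t"
proof -
  note d = tempered_D[OF f]
  note dx = tempered_D[OF d(1)] and dy = tempered_D[OF d(2)] and dt = tempered_D[OF d(3)]
  have c: "continuous_on S (\<lambda>p. h (p1 p) (p2 p) (p3 p))"
    if "tempered n h" "continuous_on S p1" "continuous_on S p2" "continuous_on S p3"
      "\<And>p. p \<in> S \<Longrightarrow> p3 p < 0" for h S and p1 p2 p3 :: "real \<times> real \<Rightarrow> real"
  proof -
    have "continuous_on S ((\<lambda>(x, y, t). h x y t) \<circ> (\<lambda>p. (p1 p, p2 p, p3 p)))"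
      by (rule continuous_on_compose)
        (auto intro!: continuous_intros continuous_on_subset[OF tempered_continuous[OF that(1)]] that)
    then show ?thesis by (simp add: o_def)
  qed
  show "Dx (Dt f) x y t = Dt (Dx f) x y t"
  proof (rule mixed_partials_eq[of "{..<0}" "\<lambda>x t. f x y t" "\<lambda>x t. Dx f x y t" "\<lambda>x t. Dt f x y t"
          "\<lambda>x t. Dt (Dx f) x y t" "\<lambda>x t. Dx (Dt f) x y t", symmetric])
    show "continuous_on (UNIV \<times> {..<0}) (\<lambda>(x, t). Dt (Dx f) x y t)"
      unfolding case_prod_unfold by (rule c[OF dx(3)]) (auto intro!: continuous_intros)
  qed (use t in \<open>simp_all add: d dx dt\<close>)
  show "Dy (Dt f) x y t = Dt (Dy f) x y t"
  proof (rule mixed_partials_eq[of "{..<0}" "\<lambda>y t. f x y t" "\<lambda>y t. Dy f x y t" "\<lambda>y t. Dt f x y t"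
          "\<lambda>y t. Dt (Dy f) x y t" "\<lambda>y t. Dy (Dt f) x y t", symmetric])
    show "continuous_on (UNIV \<times> {..<0}) (\<lambda>(y, t). Dt (Dy f) x y t)"
      unfolding case_prod_unfold by (rule c[OF dy(3)]) (auto intro!: continuous_intros)
  qed (use t in \<open>simp_all add: d dy dt\<close>)
  show "Dx (Dy f) x y t = Dy (Dx f) x y t"
  proof (rule mixed_partials_eq[of UNIV "\<lambda>x y. f x y t" "\<lambda>x y. Dx f x y t" "\<lambda>x y. Dy f x y t"
          "\<lambda>x y. Dy (Dx f) x y t" "\<lambda>x y. Dx (Dy f) x y t", symmetric])
    show "continuous_on (UNIV \<times> UNIV) (\<lambda>(x, y). Dy (Dx f) x y t)"
      unfolding case_prod_unfold by (rule c[OF dx(2)]) (use t in \<open>auto intro!: continuous_intros\<close>)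
  qed (use t in \<open>simp_all add: d dx dy\<close>)
qed

section \<open>The maximum principle\<close>

lemma tempered_exp:
  assumes f: "tempered 0 f"
  shows "tempered 0 (\<lambda>x y t. exp (f x y t))"
proof -
  have s0: "C0_growth 0 (\<lambda>x y t. exp (f x y t))"
  proof (rule C0_growthI)
    show "continuous_on (UNIV \<times> UNIV \<times> {..<0}) (\<lambda>(x, y, t). exp (f x y t))"
      using tempered_continuous[OF f] unfolding case_prod_unfold by (rule continuous_on_exp)
    fix a b :: real assume b: "b < 0"
    obtain M where M: "M > 0" "\<And>x y t. t \<in> {a..b} \<Longrightarrow> \<bar>f x y t\<bar> \<le> M * cosh x powr 0"
      by (rule tempered_bound[OF f b, of a]) blast
    have "\<bar>exp (f x y t)\<bar> \<le> exp M * cosh x powr 0" if "t \<in> {a..b}" for x y t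
      using M(2)[OF that, of x y] by simp
    then show "\<exists>M. \<forall>x y. \<forall>t\<in>{a..b}. \<bar>exp (f x y t)\<bar> \<le> M * cosh x powr 0" by blast
  qed
  have d: "((\<lambda>s. exp (g s)) has_real_derivative exp (g s) * g') (at s)"
    if "(g has_real_derivative g') (at s)" for g g' s
    using that by (auto intro!: derivative_eq_intros)
  have "Ck_growth 0 k (\<lambda>x y t. exp (f x y t))" for k
  proof (induction k)
    case 0
    then show ?case by (simp add: s0)
  next
    case (Suc k)
    have m: "Ck_growth 0 k (\<lambda>x y t. exp (f x y t) * g x y t)" if "tempered 0 g" for g
      using Ck_growth_mult[OF Suc temperedD[OF that]] by simp
    show ?case
      by (rule Ck_growth_SucI[OF _ _ _ m[OF tempered_D(1)[OF f]] m[OF tempered_D(2)[OF f]] m[OF tempered_D(3)[OF f]] s0])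
        (rule d, rule tempered_D(4-6)[OF f], assumption)+
  qed
  then show ?thesis by (simp add: tempered_def)
qed

lemma periodic_reduce:
  fixes f :: "real \<Rightarrow> 'a"
  assumes "\<And>y. f (y + 2 * pi) = f y"
  obtains y' where "y' \<in> {0..2 * pi}" "f y' = f y"
proof -
  interpret periodic_fun_simple f "2 * pi" by standard (rule assms)
  define k where "k = \<lfloor>y / (2 * pi)\<rfloor>"
  have "of_int k \<le> y / (2 * pi)" "y / (2 * pi) < of_int k + 1" unfolding k_def by linarith+
  then have "of_int k * (2 * pi) \<le> y" "y \<le> (of_int k + 1) * (2 * pi)"
    by (simp_all add: field_simps)
  then have "y - of_int k * (2 * pi) \<in> {0..2 * pi}" by (simp add: algebra_simps)
  moreover have "f (y - of_int k * (2 * pi)) = f y" by (rule minus_of_int)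
  ultimately show thesis by (rule that)
qed

lemma second_derivative_at_min:
  fixes f f' :: "real \<Rightarrow> real"
  assumes f: "\<And>x. (f has_real_derivative f' x) (at x)"
    and f': "(f' has_real_derivative D) (at x0)"
    and r: "r > 0" and min: "\<And>x. \<bar>x - x0\<bar> < r \<Longrightarrow> f x0 \<le> f x"
  shows "D \<ge> 0"
proof (rule ccontr)
  assume "\<not> D \<ge> 0"
  then have "D < 0" by simp
  have z: "f' x0 = 0"
    by (rule DERIV_local_min[OF f r]) (use min in \<open>auto simp: abs_minus_commute\<close>)
  obtain d where d: "d > 0" "\<And>h. h > 0 \<Longrightarrow> h < d \<Longrightarrow> f' (x0 + h) < f' x0"
    using DERIV_neg_dec_right[OF f' \<open>D < 0\<close>] by blast
  define h where "h = min d r / 2"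
  have h: "h > 0" "h < d" "h < r" using d r by (auto simp: h_def)
  obtain \<xi> where \<xi>: "x0 < \<xi>" "\<xi> < x0 + h" "f (x0 + h) - f x0 = (x0 + h - x0) * f' \<xi>"
    using MVT2[of x0 "x0 + h" f f'] h f by auto
  have "f' \<xi> < 0" using d(2)[of "\<xi> - x0"] \<xi> h z by auto
  then have "h * f' \<xi> < 0" using h by (simp add: mult_pos_neg)
  then have "f (x0 + h) < f x0" using \<xi> by simp
  then show False using min[of "x0 + h"] h by simp
qed

lemma ln_cosh_ge: "ln (cosh x) \<ge> \<bar>x\<bar> - ln 2" for x :: real
proof -
  have "exp \<bar>x\<bar> / 2 \<le> cosh \<bar>x\<bar>" by (simp add: cosh_field_def)
  then have "ln (exp \<bar>x\<bar> / 2) \<le> ln (cosh \<bar>x\<bar>)" by (subst ln_le_cancel_iff) auto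
  then show ?thesis by (simp add: ln_div)
qed

lemma cosh_powr_2: "cosh x powr 2 = (cosh x)\<^sup>2" for x :: real
  by simp

text \<open>The function \<open>(t - s) R + 1\<close> solves a linear equation and equals \<open>1\<close> at time \<open>s\<close>, so it stays
  nonnegative; letting \<open>s\<close> tend to \<open>-\<infinity>\<close> gives the claim.  The barrier \<open>ln (cosh x)\<close> keeps the
  minimum away from the poles, and \<open>V\<close> times its Laplacian is bounded.\<close>

lemma reaction_diffusion_nonneg:
  assumes R: "tempered 0 R" and per: "\<And>x y t. R x (y + 2 * pi) t = R x y t"
    and V: "tempered 2 V" and V0: "\<And>x y t. t < 0 \<Longrightarrow> V x y t \<ge> 0"
    and eq: "\<And>x y t. t < 0 \<Longrightarrow>
      Dt R x y t = (R x y t)\<^sup>2 + V x y t * (Dx (Dx R) x y t + Dy (Dy R) x y t)"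
    and T: "T < 0"
  shows "R x y T \<ge> 0"
proof -
  note dR = tempered_D[OF R]
  have main: "(T - s) * R x1 y1 T + 1 \<ge> 0" if sT: "s < T" for s x1 y1
  proof (rule ccontr)
    assume neg: "\<not> ?thesis"
    obtain M where M: "M > 0" "\<And>x y t. t \<in> {s..T} \<Longrightarrow> \<bar>R x y t\<bar> \<le> M * cosh x powr 0"
      by (rule tempered_bound[OF R T, of s]) blast
    have M': "\<bar>R x y t\<bar> \<le> M" if "t \<in> {s..T}" for x y t using M(2)[OF that, of x y] by simp
    obtain N0 where N0: "N0 > 0" "\<And>x y t. t \<in> {s..T} \<Longrightarrow> \<bar>V x y t\<bar> \<le> N0 * cosh x powr 2"
      by (rule tempered_bound[OF V T, of s]) blast
    \<comment> \<open>V times the Laplacian of ln (cosh x) is V / (cosh x)^2 \<le> N0. The extra 1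
      makes the barrier strict, which yields D > 0 below.\<close>
    define N where "N = N0 + 1"
    define B where "B x t = ln (cosh x) + 1 + N * (t - s)" for x t :: real
    \<comment> \<open>q satisfies q_t = R q + V times the Laplacian of q. As |R| \<le> M, the factor
      exp (- M (t - s)) changes the coefficient R into R - M \<le> 0, the sign that is wanted at a
      negative minimum.\<close>
    define E where "E t = exp (- M * (t - s))" for t
    define q where "q x y t = (t - s) * R x y t + 1" for x y t
    have B1: "B x t \<ge> 1" if "t \<ge> s" for x t
      using that N0(1) cosh_real_ge_1[of x] by (simp add: B_def N_def)
    have E0: "E t > 0" for t by (simp add: E_def)
    obtain y2 where y2: "y2 \<in> {0..2 * pi}" "R x1 y2 T = R x1 y1 T"
      by (rule periodic_reduce[of "\<lambda>y. R x1 y T", OF per])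
    have q1: "q x1 y2 T < 0" using neg y2 by (simp add: q_def)
    \<comment> \<open>Half of the value for which \<open>\<Phi>\<close> would vanish at (x1, y2, T),
      so that it is still negative there.\<close>
    define \<epsilon> where "\<epsilon> = - (q x1 y2 T * E T) / (2 * B x1 T)"
    have B1T: "B x1 T \<ge> 1" using B1 sT by simp
    have qE: "q x1 y2 T * E T < 0" using q1 E0[of T] by (simp add: mult_neg_pos)
    have \<epsilon>: "\<epsilon> > 0" using B1T qE by (simp add: \<epsilon>_def divide_neg_pos)
    have "\<epsilon> * B x1 T = - (q x1 y2 T * E T) / 2" using B1T by (simp add: \<epsilon>_def)
    then have neg1: "q x1 y2 T * E T + \<epsilon> * B x1 T < 0" using qE by linarith
    define \<Phi> where "\<Phi> x y t = q x y t * E t + \<epsilon> * B x t" for x y t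
    define K where "K = (T - s) * M"
    \<comment> \<open>For |x| \<ge> X the barrier outweighs the lower bound - K of q E, so the
      minimum over the compact box is attained at some |x| < X.\<close>
    define X where "X = max (\<bar>x1\<bar> + 1) (K / \<epsilon> + ln 2 + 1)"
    have qlow: "q x y t * E t \<ge> - K" if "t \<in> {s..T}" for x y t
    proof -
      have "(t - s) * R x y t \<ge> - ((t - s) * M)"
        using M'[OF that, of x y] mult_left_mono[of "- M" "R x y t" "t - s"] that by auto
      moreover have "(t - s) * M \<le> K" unfolding K_def using that M(1) by (intro mult_right_mono) auto
      ultimately have "q x y t \<ge> - K" by (simp add: q_def)
      moreover have "E t \<le> 1" "K \<ge> 0" using that M(1) sT by (auto simp: E_def K_def)
      ultimately show ?thesis
        using E0[of t] mult_right_mono[of "- K" "q x y t" "E t"] mult_left_mono[of "E t" 1 K]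
        by simp
    qed
    have out: "\<Phi> x y t > 0" if "\<bar>x\<bar> \<ge> X" "t \<in> {s..T}" for x y t
    proof -
      have "\<bar>x\<bar> - ln 2 \<ge> K / \<epsilon> + 1" using that by (simp add: X_def)
      then have "ln (cosh x) > K / \<epsilon>" using ln_cosh_ge[of x] by linarith
      moreover have "N * (t - s) \<ge> 0" using N0 that by (simp add: N_def)
      ultimately have "B x t > K / \<epsilon>" by (simp add: B_def)
      then have "\<epsilon> * B x t > K" using \<epsilon> by (simp add: field_simps)
      then show ?thesis using qlow[OF that(2), of x y] by (simp add: \<Phi>_def)
    qed
    define S where "S = {-X..X} \<times> {0..2 * pi} \<times> {s..T}"
    have sub: "S \<subseteq> UNIV \<times> UNIV \<times> {..<0}" using T by (auto simp: S_def)
    have x1: "x1 \<in> {-X..X}" by (auto simp: X_def)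
    have "compact S" unfolding S_def by (intro compact_Times compact_Icc)
    moreover have "(x1, y2, T) \<in> S" using y2 sT x1 by (auto simp: S_def)
    moreover have "continuous_on S (\<lambda>(x, y, t). \<Phi> x y t)"
    proof -
      have "continuous_on S (\<lambda>p. R (fst p) (fst (snd p)) (snd (snd p)))"
        using continuous_on_subset[OF tempered_continuous[OF R], of S] sub
        by (simp add: case_prod_unfold)
      then show ?thesis unfolding \<Phi>_def q_def E_def B_def case_prod_unfold
        by (auto intro!: continuous_intros)
    qed
    ultimately obtain p where p: "p \<in> S" "\<And>p'. p' \<in> S \<Longrightarrow> (\<lambda>(x, y, t). \<Phi> x y t) p \<le> (\<lambda>(x, y, t). \<Phi> x y t) p'"
      using continuous_attains_inf[of S "\<lambda>(x, y, t). \<Phi> x y t"] by (metis empty_iff)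
    obtain x0 y0 t0 where p0: "p = (x0, y0, t0)" by (cases p) auto
    have mem: "x0 \<in> {-X..X}" "y0 \<in> {0..2*pi}" "t0 \<in> {s..T}" using p(1) by (auto simp: S_def p0)
    have min: "\<Phi> x0 y0 t0 \<le> \<Phi> x y t" if "x \<in> {-X..X}" "y \<in> {0..2*pi}" "t \<in> {s..T}" for x y t
      using p(2)[of "(x, y, t)"] that by (auto simp: S_def p0)
    have neg0: "\<Phi> x0 y0 t0 < 0"
      using min[OF x1 y2(1), of T] sT neg1 by (simp add: \<Phi>_def)
    have t0: "t0 < 0" using mem T by auto
    have ts: "t0 > s"
    proof (rule ccontr)
      assume "\<not> t0 > s"
      then have "t0 = s" using mem by auto
      then have "\<Phi> x0 y0 t0 = 1 + \<epsilon> * B x0 s" by (simp add: \<Phi>_def q_def E_def)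
      moreover have "\<epsilon> * B x0 s \<ge> 0" using \<epsilon> B1[of s x0] by simp
      ultimately show False using neg0 by linarith
    qed
    have x0: "\<bar>x0\<bar> < X" using out[of x0 t0 y0] mem neg0 by force
    have perPhi: "\<Phi> x (y + 2 * pi) t = \<Phi> x y t" for x y t by (simp add: \<Phi>_def q_def per)
    have miny: "\<Phi> x0 y0 t0 \<le> \<Phi> x0 y t0" for y
    proof -
      obtain y' where "y' \<in> {0..2*pi}" "\<Phi> x0 y' t0 = \<Phi> x0 y t0"
        by (rule periodic_reduce[of "\<lambda>y. \<Phi> x0 y t0", OF perPhi])
      then show ?thesis using min[of x0 y' t0] mem by auto
    qed
    define \<tau> where "\<tau> = t0 - s"
    have \<tau>: "\<tau> > 0" using ts by (simp add: \<tau>_def)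
    have dxx: "E t0 * \<tau> * Dx (Dx R) x0 y0 t0 + \<epsilon> * (1 - (tanh x0)\<^sup>2) \<ge> 0"
    proof (rule second_derivative_at_min[where f = "\<lambda>x. \<Phi> x y0 t0"
          and f' = "\<lambda>x. E t0 * \<tau> * Dx R x y0 t0 + \<epsilon> * tanh x" and ?x0.0 = x0 and r = "X - \<bar>x0\<bar>"])
      show "((\<lambda>x. \<Phi> x y0 t0) has_real_derivative E t0 * \<tau> * Dx R x y0 t0 + \<epsilon> * tanh x) (at x)" for x
        unfolding \<Phi>_def q_def B_def \<tau>_def
        by (auto intro!: derivative_eq_intros dR(4) t0 simp: tanh_def)
      show "((\<lambda>x. E t0 * \<tau> * Dx R x y0 t0 + \<epsilon> * tanh x) has_real_derivative
          E t0 * \<tau> * Dx (Dx R) x0 y0 t0 + \<epsilon> * (1 - (tanh x0)\<^sup>2)) (at x0)"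
        by (auto intro!: derivative_eq_intros tempered_D(4)[OF dR(1)] t0)
      show "\<Phi> x0 y0 t0 \<le> \<Phi> x y0 t0" if "\<bar>x - x0\<bar> < X - \<bar>x0\<bar>" for x
        using that mem by (intro min) (auto simp: abs_if split: if_splits)
    qed (use x0 in auto)
    have dyy: "E t0 * \<tau> * Dy (Dy R) x0 y0 t0 \<ge> 0"
    proof (rule second_derivative_at_min[where f = "\<lambda>y. \<Phi> x0 y t0"
          and f' = "\<lambda>y. E t0 * \<tau> * Dy R x0 y t0" and ?x0.0 = y0 and r = 1])
      show "((\<lambda>y. \<Phi> x0 y t0) has_real_derivative E t0 * \<tau> * Dy R x0 y t0) (at y)" for y
        unfolding \<Phi>_def q_def B_def \<tau>_def
        by (auto intro!: derivative_eq_intros dR(5) t0)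
      show "((\<lambda>y. E t0 * \<tau> * Dy R x0 y t0) has_real_derivative
          E t0 * \<tau> * Dy (Dy R) x0 y0 t0) (at y0)"
        by (auto intro!: derivative_eq_intros tempered_D(5)[OF dR(2)] t0)
    qed (use miny in auto)
    define D where "D = (R x0 y0 t0 + \<tau> * Dt R x0 y0 t0) * E t0 - M * E t0 * q x0 y0 t0 + \<epsilon> * N"
    have dt: "((\<lambda>t. \<Phi> x0 y0 t) has_real_derivative D) (at t0)"
      unfolding \<Phi>_def q_def B_def E_def D_def \<tau>_def
      by (auto intro!: derivative_eq_intros dR(6) t0 simp: algebra_simps)
    \<comment> \<open>The minimum may sit at the final time T, so the comparison uses only times
      shortly before t0.\<close>
    have "D \<le> 0"
    proof (rule ccontr)
      assume "\<not> D \<le> 0"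
      then obtain d where d: "d > 0" "\<And>h. h > 0 \<Longrightarrow> h < d \<Longrightarrow> \<Phi> x0 y0 (t0 - h) < \<Phi> x0 y0 t0"
        using DERIV_pos_inc_left[OF dt] by auto
      define h where "h = min d (t0 - s) / 2"
      have h: "h > 0" "h < d" "h < t0 - s" using d ts by (auto simp: h_def)
      have "\<Phi> x0 y0 t0 \<le> \<Phi> x0 y0 (t0 - h)" using mem h by (intro min) auto
      then show False using d(2)[of h] h by simp
    qed
    moreover have "D > 0"
    proof -
      define Q where "Q = q x0 y0 t0"
      define r where "r = R x0 y0 t0"
      define v where "v = V x0 y0 t0"
      define e where "e = E t0"
      define L where "L = Dx (Dx R) x0 y0 t0 + Dy (Dy R) x0 y0 t0"
      define c where "c = 1 - (tanh x0)\<^sup>2"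
      have Q: "Q = \<tau> * r + 1" by (simp add: Q_def q_def \<tau>_def r_def)
      have "\<epsilon> * B x0 t0 \<ge> 0" using \<epsilon> B1[of t0 x0] mem by auto
      then have "Q * e < 0" using neg0 by (simp add: \<Phi>_def Q_def e_def)
      then have Q0: "Q < 0" using E0[of t0] by (simp add: e_def mult_less_0_iff)
      have "D = (r + \<tau> * (r\<^sup>2 + v * L)) * e - M * e * Q + \<epsilon> * N"
        unfolding D_def r_def v_def L_def Q_def e_def using eq[OF t0] by simp
      also have "\<dots> = e * ((r - M) * Q) + v * (e * \<tau> * L) + \<epsilon> * N"
        unfolding Q by (simp add: algebra_simps power2_eq_square)
      finally have D: "D = e * ((r - M) * Q) + v * (e * \<tau> * L) + \<epsilon> * N" .
      have "r - M \<le> 0" using M'[OF mem(3), of x0 y0] by (simp add: r_def)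
      then have "(r - M) * Q \<ge> 0" using Q0 by (simp add: mult_nonpos_nonpos)
      then have 1: "e * ((r - M) * Q) \<ge> 0" using E0[of t0] by (simp add: e_def)
      have "e * \<tau> * L \<ge> - (\<epsilon> * c)" using dxx dyy by (simp add: L_def c_def e_def distrib_left)
      then have 2: "v * (e * \<tau> * L) \<ge> v * - (\<epsilon> * c)"
        using V0[OF t0] by (intro mult_left_mono) (auto simp: v_def)
      have "v \<le> N0 * (cosh x0)\<^sup>2" using N0(2)[OF mem(3), of x0 y0] by (simp add: v_def cosh_powr_2)
      moreover have c: "c = 1 / (cosh x0)\<^sup>2"
        using sech_tanh_squares[of x0] by (simp add: c_def power_divide inverse_eq_divide eq_diff_eq[symmetric])
      ultimately have "v * c \<le> N0" by (simp add: c divide_le_eq)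
      then have "\<epsilon> * (v * c) \<le> \<epsilon> * N0" using \<epsilon> by (intro mult_left_mono) auto
      moreover have "v * - (\<epsilon> * c) = - (\<epsilon> * (v * c))" "\<epsilon> * N = \<epsilon> * N0 + \<epsilon>"
        by (simp_all add: N_def algebra_simps)
      ultimately show ?thesis using D 1 2 \<epsilon> by linarith
    qed
    ultimately show False by simp
  qed
  show ?thesis
  proof (rule ccontr)
    assume "\<not> ?thesis"
    then have neg: "R x y T < 0" by simp
    \<comment> \<open>Chosen so that (T - s) R = -2, against the lower bound -1 from
      \<open>main\<close>.\<close>
    define s where "s = T + 2 / R x y T"
    have "s < T" using neg by (simp add: s_def divide_pos_neg)
    then have "(T - s) * R x y T + 1 \<ge> 0" by (rule main)
    moreover have "(T - s) * R x y T = -2" using neg by (simp add: s_def)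
    ultimately show False by simp
  qed
qed

section \<open>Time integrals and integrals over boxes\<close>

lemma tempered_continuous_on_compose:
  assumes "tempered n f" "continuous_on S p1" "continuous_on S p2" "continuous_on S p3"
    and "\<And>p. p \<in> S \<Longrightarrow> p3 p < 0"
  shows "continuous_on S (\<lambda>p. f (p1 p) (p2 p) (p3 p))"
proof -
  have "continuous_on S ((\<lambda>(x, y, t). f x y t) \<circ> (\<lambda>p. (p1 p, p2 p, p3 p)))"
    by (rule continuous_on_compose)
      (auto intro!: continuous_intros continuous_on_subset[OF tempered_continuous[OF assms(1)]] assms)
  then show ?thesis by (simp add: o_def)
qed

lemma leibniz_open:
  fixes f fx :: "real \<Rightarrow> 'b::euclidean_space \<Rightarrow> real"
  assumes "\<And>x z. x \<in> U \<Longrightarrow> z \<in> cbox a b \<Longrightarrow> ((\<lambda>x. f x z) has_real_derivative fx x z) (at x)"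
    and "\<And>x. x \<in> U \<Longrightarrow> continuous_on (cbox a b) (f x)"
    and "continuous_on (U \<times> cbox a b) (\<lambda>(x, z). fx x z)"
    and "open U" "convex U" "x \<in> U"
  shows "((\<lambda>x. integral (cbox a b) (f x)) has_real_derivative integral (cbox a b) (fx x)) (at x)"
proof -
  have "((\<lambda>x. integral (cbox a b) (f x)) has_real_derivative integral (cbox a b) (fx x)) (at x within U)"
    by (rule leibniz_rule_field_derivative)
      (use assms in \<open>auto intro: DERIV_subset integrable_continuous\<close>)
  then show ?thesis using at_within_open[OF assms(6,4)] by simp
qed

lemma integral_Dx_box:
  fixes P P' :: "real \<Rightarrow> real \<Rightarrow> real"
  assumes "a \<le> b" and P: "\<And>x y. ((\<lambda>x. P x y) has_real_derivative P' x y) (at x)"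
    and cont: "continuous_on (cbox (a, c) (b, d)) (\<lambda>(x, y). P' x y)"
  shows "integral (cbox (a, c) (b, d)) (\<lambda>(x, y). P' x y) = integral {c..d} (\<lambda>y. P b y - P a y)"
proof -
  have "continuous_on (cbox (c, a) (d, b)) (\<lambda>(y, x). P' x y)"
    using swap_continuous[OF cont] by simp
  then have "integral (cbox (c, a) (d, b)) (\<lambda>(y, x). P' x y)
      = integral (cbox c d) (\<lambda>y. integral (cbox a b) (\<lambda>x. P' x y))"
    by (subst integral_prod_continuous) auto
  also have "\<dots> = integral {c..d} (\<lambda>y. P b y - P a y)"
  proof -
    have h: "((\<lambda>x. P' x y) has_integral P b y - P a y) {a..b}" for y
      using assms(1) P by (intro fundamental_theorem_of_calculus)
        (auto simp flip: has_real_derivative_iff_has_vector_derivative intro: DERIV_subset)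
    show ?thesis by (simp add: cbox_interval integral_unique[OF h])
  qed
  finally show ?thesis using integral_swap_2dim[OF cont] by simp
qed

lemma integral_Dy_box:
  fixes P P' :: "real \<Rightarrow> real \<Rightarrow> real"
  assumes "c \<le> d" and P: "\<And>x y. ((\<lambda>y. P x y) has_real_derivative P' x y) (at y)"
    and cont: "continuous_on (cbox (a, c) (b, d)) (\<lambda>(x, y). P' x y)"
  shows "integral (cbox (a, c) (b, d)) (\<lambda>(x, y). P' x y) = integral {a..b} (\<lambda>x. P x d - P x c)"
proof -
  have h: "((\<lambda>y. P' x y) has_integral P x d - P x c) {c..d}" for x
    using assms(1) P by (intro fundamental_theorem_of_calculus)
      (auto simp flip: has_real_derivative_iff_has_vector_derivative intro: DERIV_subset)
  show ?thesis
    by (subst integral_prod_continuous[OF cont]) (simp add: cbox_interval integral_unique[OF h])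
qed

definition tint :: "real \<Rightarrow> (real \<Rightarrow> real \<Rightarrow> real \<Rightarrow> real) \<Rightarrow> real \<Rightarrow> real \<Rightarrow> real \<Rightarrow> real" where
  "tint b f x y t = integral {b..t} (f x y)"

lemma tint_dt:
  assumes f: "tempered n f" and t: "b < t" "t < 0"
  shows "((\<lambda>t. tint b f x y t) has_real_derivative f x y t) (at t)"
proof -
  have "continuous_on {b..t/2} (\<lambda>t. f x y t)"
    by (rule tempered_continuous_on_compose[OF f]) (use t in \<open>auto intro!: continuous_intros\<close>)
  then have "((\<lambda>t. tint b f x y t) has_real_derivative f x y t) (at t within {b..t/2})"
    unfolding tint_def using t by (intro integral_has_real_derivative) auto
  then show ?thesis using t by (subst (asm) at_within_interior) auto
qed

lemma tint_dx:
  assumes f: "tempered n f" and t: "t < 0"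
  shows "((\<lambda>x. tint b f x y t) has_real_derivative tint b (Dx f) x y t) (at x)"
  unfolding tint_def cbox_interval[symmetric]
  by (rule leibniz_open[where U = UNIV])
    (use t in \<open>auto intro!: tempered_D(4)[OF f] tempered_continuous_on_compose[OF f]
      tempered_continuous_on_compose[OF tempered_D(1)[OF f]] continuous_intros simp: case_prod_unfold\<close>)

lemma tint_dy:
  assumes f: "tempered n f" and t: "t < 0"
  shows "((\<lambda>y. tint b f x y t) has_real_derivative tint b (Dy f) x y t) (at y)"
  unfolding tint_def cbox_interval[symmetric]
  by (rule leibniz_open[where U = UNIV])
    (use t in \<open>auto intro!: tempered_D(5)[OF f] tempered_continuous_on_compose[OF f]
      tempered_continuous_on_compose[OF tempered_D(2)[OF f]] continuous_intros simp: case_prod_unfold\<close>)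

text \<open>Rescaling the time integral to the unit interval makes the joint continuity a case of the
  continuity of parametric integrals.\<close>

lemma tint_continuous:
  assumes f: "tempered n f"
  shows "continuous_on (UNIV \<times> UNIV \<times> {b<..<0}) (\<lambda>(x, y, t). tint b f x y t)"
proof -
  have "tint b f x y t = integral (cbox 0 1) (\<lambda>r. (t - b) * f x y (b + r * (t - b)))"
    if t: "b < t" "t < 0" for x y t
  proof -
    have c: "continuous_on {b..t} (f x y)"
      by (rule tempered_continuous_on_compose[OF f]) (use t in \<open>auto intro!: continuous_intros\<close>)
    have le: "b + r * (t - b) \<le> t" if "r \<in> {0..1}" for r
    proof -
      have "r * (t - b) \<le> 1 * (t - b)" using that t by (intro mult_right_mono) auto
      then show ?thesis by simp
    qed
    have "((\<lambda>r. (t - b) *\<^sub>R f x y (b + r * (t - b))) has_integral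
        integral {b + 0 * (t - b)..b + 1 * (t - b)} (f x y)) {0..1}"
      by (rule has_integral_substitution[where c = b and d = t])
        (use t c le in \<open>auto intro!: derivative_eq_intros\<close>)
    from integral_unique[OF this] show ?thesis by (simp add: tint_def cbox_interval)
  qed
  moreover have "continuous_on (UNIV \<times> UNIV \<times> {b<..<0})
      (\<lambda>p. integral (cbox 0 1) (\<lambda>r. (snd (snd p) - b) * f (fst p) (fst (snd p)) (b + r * (snd (snd p) - b))))"
  proof (rule integral_continuous_on_param)
    have lt: "b + r * (t - b) < 0" if "b < t" "t < 0" "0 \<le> r" "r \<le> 1" for r t
    proof -
      have "b + r * (t - b) \<le> b + 1 * (t - b)"
        using that by (intro add_left_mono mult_right_mono) auto
      also have "\<dots> < 0" using that by simp
      finally show ?thesis .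
    qed
    show "continuous_on ((UNIV \<times> UNIV \<times> {b<..<0}) \<times> cbox 0 1)
      (\<lambda>(p, r). (snd (snd p) - b) * f (fst p) (fst (snd p)) (b + r * (snd (snd p) - b)))"
      unfolding case_prod_unfold
      by (intro continuous_intros tempered_continuous_on_compose[OF f]) (auto simp: lt)
  qed
  ultimately show ?thesis
    by (subst continuous_on_cong[OF refl]) (auto simp: case_prod_unfold)
qed

lemma tint_diff_bound:
  assumes f: "tempered n f" and b: "b \<le> s" "s \<le> t" "t < 0"
    and M: "\<And>\<tau>. \<tau> \<in> {s..t} \<Longrightarrow> \<bar>f x y \<tau>\<bar> \<le> M"
  shows "\<bar>tint b f x y t - tint b f x y s\<bar> \<le> (t - s) * M"
proof -
  have c: "continuous_on {b..t} (f x y)"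
    by (rule tempered_continuous_on_compose[OF f]) (use b in \<open>auto intro!: continuous_intros\<close>)
  have "integral {b..s} (f x y) + integral {s..t} (f x y) = integral {b..t} (f x y)"
    using b by (intro Henstock_Kurzweil_Integration.integral_combine integrable_continuous_interval c) auto
  then have "tint b f x y t - tint b f x y s = integral {s..t} (f x y)" by (simp add: tint_def)
  moreover have "norm (integral {s..t} (f x y)) \<le> M * (t - s)"
    by (rule integral_bound) (use b M in \<open>auto intro: continuous_on_subset[OF c]\<close>)
  ultimately show ?thesis by (simp add: mult.commute)
qed

text \<open>Cauchy-Schwarz against the constant 1, obtained from the nonnegative integral of (l |g|
  - m)^2, where m / l is the mean of |g|.\<close>

lemma integral_abs_power2_le:
  fixes g :: "real \<Rightarrow> real"
  assumes g: "continuous_on {0..l} g" and l: "l > 0"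
  shows "(integral {0..l} (\<lambda>y. \<bar>g y\<bar>))\<^sup>2 \<le> l * integral {0..l} (\<lambda>y. (g y)\<^sup>2)"
proof -
  define m where "m = integral {0..l} (\<lambda>y. \<bar>g y\<bar>)"
  have "0 \<le> integral {0..l} (\<lambda>y. (l * \<bar>g y\<bar> - m)\<^sup>2)"
    by (intro integral_nonneg integrable_continuous_interval continuous_intros g) auto
  also have "(\<lambda>y. (l * \<bar>g y\<bar> - m)\<^sup>2) = (\<lambda>y. l\<^sup>2 * (g y)\<^sup>2 - 2 * l * m * \<bar>g y\<bar> + m\<^sup>2)"
    by (auto simp: power2_eq_square algebra_simps abs_mult_self_eq)
  also have "integral {0..l} \<dots> = l\<^sup>2 * integral {0..l} (\<lambda>y. (g y)\<^sup>2) - 2 * l * m * m + l * m\<^sup>2"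
    unfolding m_def[symmetric] using l
    by (subst integral_add integral_diff, (intro integrable_continuous_interval continuous_intros g)+)+
      (simp add: m_def)
  finally have "0 \<le> l * (l * integral {0..l} (\<lambda>y. (g y)\<^sup>2) - m\<^sup>2)"
    by (simp add: power2_eq_square algebra_simps)
  then show ?thesis using l by (simp add: zero_le_mult_iff m_def)
qed

section \<open>Rigidity by a time-integrated test function\<close>

lemma tint_continuous_on_compose:
  assumes "tempered n f" "continuous_on S p1" "continuous_on S p2" "continuous_on S p3"
    and "\<And>p. p \<in> S \<Longrightarrow> b < p3 p \<and> p3 p < 0"
  shows "continuous_on S (\<lambda>p. tint b f (p1 p) (p2 p) (p3 p))"
proof -
  have "continuous_on S ((\<lambda>(x, y, t). tint b f x y t) \<circ> (\<lambda>p. (p1 p, p2 p, p3 p)))"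
    by (rule continuous_on_compose)
      (auto intro!: continuous_intros continuous_on_subset[OF tint_continuous[OF assms(1)]] assms(2-4)
        simp: assms(5))
  then show ?thesis by (simp add: o_def)
qed

text \<open>A Poincare inequality in the angle with a non-sharp constant. The increment from angle 0
  is an integral of f'; Cauchy-Schwarz contributes one factor 2 pi, and integrating the resulting
  bound over the circle contributes the other.\<close>

lemma integral_cylinder_power2_le:
  fixes f f' :: "real \<Rightarrow> real \<Rightarrow> real"
  assumes f: "\<And>x y. (f x has_real_derivative f' x y) (at y)"
    and c: "continuous_on UNIV (\<lambda>(x, y). f x y)" and c': "continuous_on UNIV (\<lambda>(x, y). f' x y)"
  shows "integral (cbox (a, 0) (b, 2 * pi)) (\<lambda>(x, y). (f x y - f x 0)\<^sup>2)
    \<le> 4 * pi\<^sup>2 * integral (cbox (a, 0) (b, 2 * pi)) (\<lambda>(x, y). (f' x y)\<^sup>2)"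
proof -
  have cc: "continuous_on S (\<lambda>p. f (p1 p) (p2 p))" "continuous_on S (\<lambda>p. f' (p1 p) (p2 p))"
    if "continuous_on S p1" "continuous_on S p2" for S :: "'c::topological_space set" and p1 p2
    using continuous_on_compose2[OF c, of S "\<lambda>p. (p1 p, p2 p)"]
      continuous_on_compose2[OF c', of S "\<lambda>p. (p1 p, p2 p)"] that
    by (auto intro: continuous_intros)
  define I where "I x = integral {0..2*pi} (\<lambda>y. (f' x y)\<^sup>2)" for x
  have p: "(f x y - f x 0)\<^sup>2 \<le> 2 * pi * I x" if y: "y \<in> {0..2*pi}" for x y
  proof -
    have h: "(f' x has_integral f x y - f x 0) {0..y}"
      using y f by (intro fundamental_theorem_of_calculus)
        (auto simp flip: has_real_derivative_iff_has_vector_derivative intro: DERIV_subset)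
    have "\<bar>f x y - f x 0\<bar> = norm (integral {0..y} (f' x))" using h by (simp add: integral_unique)
    also have "\<dots> \<le> integral {0..y} (\<lambda>y. \<bar>f' x y\<bar>)"
      by (rule integral_norm_bound_integral) (auto intro!: integrable_continuous_interval continuous_intros cc)
    also have "\<dots> \<le> integral {0..2*pi} (\<lambda>y. \<bar>f' x y\<bar>)"
      using y by (intro integral_subset_le) (auto intro!: integrable_continuous_interval continuous_intros cc)
    finally have "(f x y - f x 0)\<^sup>2 \<le> (integral {0..2*pi} (\<lambda>y. \<bar>f' x y\<bar>))\<^sup>2"
      by (metis abs_ge_zero power_mono power2_abs)
    also have "\<dots> \<le> 2 * pi * I x" unfolding I_def
      by (rule integral_abs_power2_le) (auto intro!: cc continuous_intros)
    finally show ?thesis .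
  qed
  have "integral (cbox (a, 0) (b, 2 * pi)) (\<lambda>(x, y). (f x y - f x 0)\<^sup>2)
      = integral (cbox a b) (\<lambda>x. integral (cbox 0 (2*pi)) (\<lambda>y. (f x y - f x 0)\<^sup>2))"
    by (subst integral_prod_continuous) (auto intro!: continuous_intros cc simp: case_prod_unfold)
  also have "\<dots> \<le> integral (cbox a b) (\<lambda>x. 2 * pi * (2 * pi * I x))"
  proof (rule integral_le)
    show "(\<lambda>x. integral (cbox 0 (2*pi)) (\<lambda>y. (f x y - f x 0)\<^sup>2)) integrable_on cbox a b"
      by (intro integrable_continuous integral_continuous_on_param)
        (auto intro!: continuous_intros cc simp: case_prod_unfold)
    show "(\<lambda>x. 2 * pi * (2 * pi * I x)) integrable_on cbox a b"
      unfolding I_def cbox_interval[symmetric]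
      by (intro integrable_continuous continuous_intros integral_continuous_on_param)
        (auto intro!: continuous_intros cc simp: case_prod_unfold)
    fix x
    have "integral {0..2*pi} (\<lambda>y. (f x y - f x 0)\<^sup>2) \<le> integral {0..2*pi} (\<lambda>y. 2 * pi * I x)"
      by (rule integral_le) (auto intro!: integrable_continuous_interval continuous_intros cc p)
    then show "integral (cbox 0 (2*pi)) (\<lambda>y. (f x y - f x 0)\<^sup>2) \<le> 2 * pi * (2 * pi * I x)"
      by (simp add: cbox_interval)
  qed
  also have "\<dots> = 4 * pi\<^sup>2 * integral (cbox a b) I" by (simp add: power2_eq_square)
  also have "integral (cbox a b) I = integral (cbox (a, 0) (b, 2 * pi)) (\<lambda>(x, y). (f' x y)\<^sup>2)"
    unfolding I_def cbox_interval[symmetric]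
    by (subst integral_prod_continuous) (auto intro!: continuous_intros cc simp: case_prod_unfold)
  finally show ?thesis .
qed

definition box_energy :: "(real \<Rightarrow> real \<Rightarrow> real \<Rightarrow> real) \<Rightarrow> real \<Rightarrow> real \<Rightarrow> real" where
  "box_energy f X t = integral (cbox (-X, 0) (X, 2 * pi)) (\<lambda>(x, y). (f x y t)\<^sup>2)"

text \<open>Oleinik's test function: with \<open>z = Dy U = w U\<close> and \<open>Y\<close> the time integral of \<open>w\<close> from \<open>s\<close> on, the
  Laplacian of \<open>Y\<close> is \<open>z(t) - z(s)\<close>.  Hence, up to boundary terms, the integral of \<open>z w\<close> is minus the
  time derivative of the functional \<open>J\<close> below, which is bounded below by completing the square.\<close>

lemma oleinik_estimate:
  assumes w: "tempered (-1) w" and U: "tempered 0 U"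
    and Uy: "\<And>x y t. t < 0 \<Longrightarrow> Dy U x y t = w x y t * U x y t"
    and eq: "\<And>x y t. t < 0 \<Longrightarrow> Dt (Dy U) x y t = Dx (Dx w) x y t + Dy (Dy w) x y t"
    and perU: "\<And>x y t. U x (y + 2 * pi) t = U x y t"
    and perw: "\<And>x y t. w x (y + 2 * pi) t = w x y t"
    and perwy: "\<And>x y t. Dy w x (y + 2 * pi) t = Dy w x y t"
    and Upos: "\<And>x y t. t < 0 \<Longrightarrow> U x y t > 0"
    and Ule: "\<And>x y t. t < 0 \<Longrightarrow> c0 * U x y t \<le> 1"
    and times: "s \<le> t1" "t1 \<le> t2" "t2 \<le> T" "T < 0" and X: "X > 0" and c0: "c0 > 0" and M: "M \<ge> 0"
    and wM: "\<And>x y t. t \<in> {s..T} \<Longrightarrow> \<bar>w x y t\<bar> \<le> M / cosh x"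
    and wxM: "\<And>x y t. t \<in> {s..T} \<Longrightarrow> \<bar>Dx w x y t\<bar> \<le> M"
    and \<kappa>: "\<And>t. t \<in> {t1..t2} \<Longrightarrow> \<kappa> \<le> box_energy (Dy U) X t"
  shows "c0 * \<kappa> * (t2 - t1) \<le> 2 * pi\<^sup>2 * box_energy (Dy U) X s + 4 * pi * M\<^sup>2 * (T - s)\<^sup>2 / cosh X"
proof -
  \<comment> \<open>Starting the time primitive one unit before s keeps s in the interior of its
    domain, so that Y is differentiable at s too.\<close>
  define b where "b = s - 1"
  define bx where "bx = cbox (-X, 0) (X, 2 * pi)"
  define z where "z = Dy U"
  note dw = tempered_D[OF w]
  note dwx = tempered_D[OF dw(1)] and dwy = tempered_D[OF dw(2)]
  note dU = tempered_D[OF U]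
  note dz = tempered_D[OF dU(2), folded z_def]
  have tz: "tempered 0 z" using dU by (simp add: z_def)
  define Y where "Y f x y t = tint b f x y t - tint b f x y s" for f x y t
  have sb: "b < s" "s < 0" using times by (auto simp: b_def)
  have Yt: "((\<lambda>t. Y f x y t) has_real_derivative f x y t) (at t)"
    if "tempered n f" "t \<in> {b<..<0}" for f n x y t
    unfolding Y_def using that by (auto intro!: derivative_eq_intros tint_dt)
  have Yx: "((\<lambda>x. Y f x y t) has_real_derivative Y (Dx f) x y t) (at x)"
    if "tempered n f" "t < 0" for f n x y t
    unfolding Y_def using that sb by (intro DERIV_diff tint_dx) auto
  have Yy: "((\<lambda>y. Y f x y t) has_real_derivative Y (Dy f) x y t) (at y)"
    if "tempered n f" "t < 0" for f n x y t
    unfolding Y_def using that sb by (intro DERIV_diff tint_dy) auto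
  have Yc: "continuous_on S (\<lambda>p. Y f (p1 p) (p2 p) (p3 p))"
    if "tempered n f" "continuous_on S p1" "continuous_on S p2" "continuous_on S p3"
      "\<And>p. p \<in> S \<Longrightarrow> b < p3 p \<and> p3 p < 0" for S :: "'c::topological_space set" and p1 p2 p3 f n
    unfolding Y_def using that sb
    by (intro continuous_on_diff tint_continuous_on_compose[OF that(1)] continuous_on_const) auto
  have Ys: "Y f x y s = 0" for f x y by (simp add: Y_def)
  note tc = tempered_continuous_on_compose
  \<comment> \<open>The equation z_t = Laplacian of w, integrated in time: the difference of the two
    sides has zero time derivative and vanishes at t = s.\<close>
  have lap: "Y (Dx (Dx w)) x y t + Y (Dy (Dy w)) x y t = z x y t - z x y s" if t: "t \<in> {s..T}" for x y t
  proof -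
    have "\<exists>k. \<forall>t\<in>{b<..<0}. Y (Dx (Dx w)) x y t + Y (Dy (Dy w)) x y t - z x y t = k"
    proof (rule has_field_derivative_zero_constant)
      fix t assume t: "t \<in> {b<..<0}"
      have "((\<lambda>t. Y (Dx (Dx w)) x y t + Y (Dy (Dy w)) x y t - z x y t) has_real_derivative
         Dx (Dx w) x y t + Dy (Dy w) x y t - Dt z x y t) (at t)"
        using t by (intro derivative_intros Yt[OF dwx(1)] Yt[OF dwy(2)] dz(6)) auto
      moreover have "Dx (Dx w) x y t + Dy (Dy w) x y t - Dt z x y t = 0" using eq[of t x y] t by (simp add: z_def)
      ultimately show "((\<lambda>t. Y (Dx (Dx w)) x y t + Y (Dy (Dy w)) x y t - z x y t) has_real_derivative 0)
          (at t within {b<..<0})"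
        by (metis has_field_derivative_at_within)
    qed simp
    then obtain k where k: "\<forall>t\<in>{b<..<0}. Y (Dx (Dx w)) x y t + Y (Dy (Dy w)) x y t - z x y t = k" ..
    have "s \<in> {b<..<0}" "t \<in> {b<..<0}" using t sb times by auto
    from bspec[OF k this(1)] bspec[OF k this(2)] show ?thesis by (simp add: Ys)
  qed
  define J where "J t = integral bx (\<lambda>(x, y). ((Y (Dx w) x y t)\<^sup>2 + (Y (Dy w) x y t)\<^sup>2) / 2 - z x y s * Y w x y t)" for t
  define J' where "J' t = integral bx (\<lambda>(x, y). Y (Dx w) x y t * Dx w x y t + Y (Dy w) x y t * Dy w x y t
     - z x y s * w x y t)" for t
  have J: "(J has_real_derivative J' t) (at t)" if "t \<in> {b<..<0}" for t
    unfolding J_def J'_def bx_def case_prod_unfold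
  proof (rule leibniz_open[where U = "{b<..<0}"])
    fix t and p :: "real \<times> real" assume t: "t \<in> {b<..<0}"
    show "((\<lambda>t. ((Y (Dx w) (fst p) (snd p) t)\<^sup>2 + (Y (Dy w) (fst p) (snd p) t)\<^sup>2) / 2
        - z (fst p) (snd p) s * Y w (fst p) (snd p) t) has_real_derivative
      Y (Dx w) (fst p) (snd p) t * Dx w (fst p) (snd p) t + Y (Dy w) (fst p) (snd p) t * Dy w (fst p) (snd p) t
        - z (fst p) (snd p) s * w (fst p) (snd p) t) (at t)"
      by (auto intro!: derivative_eq_intros Yt[OF dw(1) t] Yt[OF dw(2) t] Yt[OF w t])
  next
    fix t assume t: "t \<in> {b<..<0}"
    show "continuous_on (cbox (- X, 0) (X, 2 * pi)) (\<lambda>p. ((Y (Dx w) (fst p) (snd p) t)\<^sup>2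
        + (Y (Dy w) (fst p) (snd p) t)\<^sup>2) / 2 - z (fst p) (snd p) s * Y w (fst p) (snd p) t)"
      by (intro continuous_intros Yc[OF dw(1)] Yc[OF dw(2)] Yc[OF w] tc[OF tz]) (use t sb in auto)
  next
    show "continuous_on ({b<..<0} \<times> cbox (- X, 0) (X, 2 * pi)) (\<lambda>(t, p).
      Y (Dx w) (fst p) (snd p) t * Dx w (fst p) (snd p) t + Y (Dy w) (fst p) (snd p) t * Dy w (fst p) (snd p) t
        - z (fst p) (snd p) s * w (fst p) (snd p) t)"
      unfolding case_prod_unfold
      by (intro continuous_intros Yc[OF dw(1)] Yc[OF dw(2)] tc[OF w] tc[OF tz] tc[OF dw(1)] tc[OF dw(2)])
        (use sb in auto)
  qed (use that in auto)
  have J0: "J s = 0" by (simp add: J_def Ys case_prod_unfold)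
  \<comment> \<open>The boundary term of the integration by parts in x: two ends, angular length 2
    pi, |Y (Dx w)| \<le> (T - s) M and |w| \<le> M / cosh X.\<close>
  define \<beta> where "\<beta> = 4 * pi * M\<^sup>2 * (T - s) / cosh X"
  have int: "(\<lambda>p. g p) integrable_on bx" if "continuous_on bx g" for g :: "real \<times> real \<Rightarrow> real"
    using that unfolding bx_def by (rule integrable_continuous)
  have J'le: "J' t \<le> \<beta> - c0 * box_energy z X t" if t: "t \<in> {s..T}" for t
  proof -
    have tt: "b < t" "t < 0" using t times by (auto simp: b_def)
    define P where "P = (\<lambda>x y. Y (Dx w) x y t * w x y t)"
    define P' where "P' = (\<lambda>x y. Y (Dx (Dx w)) x y t * w x y t + Dx w x y t * Y (Dx w) x y t)"
    define Q where "Q = (\<lambda>x y. Y (Dy w) x y t * w x y t)"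
    define Q' where "Q' = (\<lambda>x y. Y (Dy (Dy w)) x y t * w x y t + Dy w x y t * Y (Dy w) x y t)"
    have cP: "continuous_on bx (\<lambda>(x, y). P' x y)" and cQ: "continuous_on bx (\<lambda>(x, y). Q' x y)"
      and cz: "continuous_on bx (\<lambda>(x, y). z x y t * w x y t)"
        "continuous_on bx (\<lambda>(x, y). (z x y t)\<^sup>2)"
      unfolding P'_def Q'_def case_prod_unfold
      by (intro continuous_intros Yc[OF dw(1)] Yc[OF dw(2)] Yc[OF dwx(1)] Yc[OF dwy(2)]
        tc[OF w] tc[OF tz] tc[OF dw(1)] tc[OF dw(2)]; use tt in auto)+
    \<comment> \<open>Substituting z(t) minus the Laplacian of Y for z(s) turns the integrand into
      the divergence of w times the gradient of Y, minus z w.\<close>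
    have "J' t = integral bx (\<lambda>p. (\<lambda>(x, y). P' x y) p + (\<lambda>(x, y). Q' x y) p - (\<lambda>(x, y). z x y t * w x y t) p)"
      unfolding J'_def
    proof (rule arg_cong[where f = "integral bx"], rule ext, clarify)
      fix x y
      have "z x y s = z x y t - (Y (Dx (Dx w)) x y t + Y (Dy (Dy w)) x y t)" using lap[OF t, of x y] by simp
      then show "Y (Dx w) x y t * Dx w x y t + Y (Dy w) x y t * Dy w x y t - z x y s * w x y t
          = P' x y + Q' x y - z x y t * w x y t"
        unfolding P'_def Q'_def by (simp only:) (simp add: algebra_simps)
    qed
    also have "\<dots> = integral bx (\<lambda>(x, y). P' x y) + integral bx (\<lambda>(x, y). Q' x y)
        - integral bx (\<lambda>(x, y). z x y t * w x y t)"
      by (simp only: integral_add integral_diff integrable_add int[OF cP] int[OF cQ] int[OF cz(1)])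
    also have "integral bx (\<lambda>(x, y). Q' x y) = integral {-X..X} (\<lambda>x. Q x (2 * pi) - Q x 0)"
      unfolding bx_def
    proof (rule integral_Dy_box)
      show "((\<lambda>y. Q x y) has_real_derivative Q' x y) (at y)" for x y
        unfolding Q_def Q'_def using tt by (intro DERIV_mult Yy[OF dw(2)] dw(5)) auto
    qed (use cQ in \<open>auto simp: bx_def\<close>)
    also have "(\<lambda>x. Q x (2 * pi) - Q x 0) = (\<lambda>x. 0)"
    proof -
      have "w x (2 * pi) t = w x 0 t" "Dy w x (2 * pi) = Dy w x 0" for x
        using perw[of x 0 t] perwy[of x 0] by (simp_all add: fun_eq_iff)
      then show ?thesis by (simp add: Q_def Y_def tint_def)
    qed
    also have "integral bx (\<lambda>(x, y). P' x y) = integral {0..2 * pi} (\<lambda>y. P X y - P (-X) y)"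
      unfolding bx_def
    proof (rule integral_Dx_box)
      show "((\<lambda>x. P x y) has_real_derivative P' x y) (at x)" for x y
        unfolding P_def P'_def using tt by (intro DERIV_mult Yx[OF dw(1)] dw(4)) auto
    qed (use cP X in \<open>auto simp: bx_def\<close>)
    finally have J'eq: "J' t = integral {0..2 * pi} (\<lambda>y. P X y - P (-X) y)
        - integral bx (\<lambda>(x, y). z x y t * w x y t)" by simp
    have Pb: "\<bar>P x y\<bar> \<le> (T - s) * M * (M / cosh x)" for x y
    proof -
      have "\<bar>Y (Dx w) x y t\<bar> \<le> (t - s) * M" unfolding Y_def
        by (rule tint_diff_bound[OF dw(1)]) (use t times wxM in \<open>auto simp: b_def\<close>)
      also have "\<dots> \<le> (T - s) * M" using t M by (intro mult_right_mono) auto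
      finally show ?thesis unfolding P_def abs_mult using wM[OF t, of x y] t times M
        by (intro mult_mono) auto
    qed
    have "norm (integral {0..2 * pi} (\<lambda>y. P X y - P (-X) y)) \<le> (2 * ((T - s) * M * (M / cosh X))) * (2 * pi - 0)"
    proof (rule integral_bound)
      show "continuous_on {0..2 * pi} (\<lambda>y. P X y - P (- X) y)" unfolding P_def
        by (intro continuous_intros Yc[OF dw(1)] tc[OF w]) (use tt in auto)
      show "norm (P X y - P (- X) y) \<le> 2 * ((T - s) * M * (M / cosh X))" for y
        using Pb[of X y] Pb[of "-X" y] by simp
    qed simp
    also have "\<dots> = \<beta>" by (simp add: \<beta>_def power2_eq_square)
    finally have 1: "integral {0..2 * pi} (\<lambda>y. P X y - P (-X) y) \<le> \<beta>" by simp
    have "c0 * box_energy z X t = integral bx (\<lambda>p. c0 * (\<lambda>(x, y). (z x y t)\<^sup>2) p)"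
      by (simp add: box_energy_def bx_def)
    also have "\<dots> \<le> integral bx (\<lambda>(x, y). z x y t * w x y t)"
    proof (rule integral_le[OF int int[OF cz(1)]])
      show "continuous_on bx (\<lambda>p. c0 * (\<lambda>(x, y). (z x y t)\<^sup>2) p)"
        using cz(2) by (rule continuous_on_mult_left)
      fix p :: "real \<times> real"
      obtain x y where p: "p = (x, y)" by (cases p)
      have zz: "z x y t = w x y t * U x y t" using Uy[OF tt(2)] by (simp add: z_def)
      \<comment> \<open>With z = w U, the inequality c0 z^2 \<le> z w is c0 U \<le> 1 multiplied by
        w^2 U.\<close>
      have "(c0 * U x y t) * ((w x y t)\<^sup>2 * U x y t) \<le> 1 * ((w x y t)\<^sup>2 * U x y t)"
        using Ule[OF tt(2)] Upos[OF tt(2), of x y] by (intro mult_right_mono) auto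
      then show "c0 * (\<lambda>(x, y). (z x y t)\<^sup>2) p \<le> (\<lambda>(x, y). z x y t * w x y t) p"
        by (simp add: p zz power2_eq_square algebra_simps)
    qed
    finally have 2: "c0 * box_energy z X t \<le> integral bx (\<lambda>(x, y). z x y t * w x y t)" .
    from J'eq 1 2 show ?thesis by linarith
  qed
  have Epos: "box_energy z X t \<ge> 0" if "t < 0" for t
    unfolding box_energy_def by (intro integral_nonneg integrable_continuous)
      (auto intro!: continuous_intros tc[OF tz] that simp: case_prod_unfold)
  have step: "J t' - J t \<le> (t' - t) * (\<beta> - c0 * k)"
    if tt: "t \<in> {s..T}" "t' \<in> {s..T}" "t \<le> t'" and k: "\<And>r. r \<in> {t..t'} \<Longrightarrow> k \<le> box_energy z X r" for t t' k
  proof (cases "t = t'")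
    case False
    with tt have lt: "t < t'" by simp
    have "\<exists>r. t < r \<and> r < t' \<and> J t' - J t = (t' - t) * J' r"
      by (rule MVT2[OF lt]) (use tt times in \<open>auto intro!: J simp: b_def\<close>)
    then obtain r where r: "t < r" "r < t'" "J t' - J t = (t' - t) * J' r" by blast
    have "J' r \<le> \<beta> - c0 * box_energy z X r" by (rule J'le) (use r tt in auto)
    also have "\<dots> \<le> \<beta> - c0 * k" using k[of r] r c0 by simp
    finally show ?thesis using r lt by simp
  qed simp
  \<comment> \<open>The energy is bounded below by 0 on [s, t1] and on [t2, T], and by
    \<open>\<kappa>\<close> on [t1, t2].\<close>
  have "J T - J s \<le> (T - s) * \<beta> - c0 * \<kappa> * (t2 - t1)"
  proof -
    have "J t1 - J s \<le> (t1 - s) * (\<beta> - c0 * 0)" by (rule step) (use times Epos in auto)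
    moreover have "J t2 - J t1 \<le> (t2 - t1) * (\<beta> - c0 * \<kappa>)"
      by (rule step) (use times \<kappa> in \<open>auto simp: z_def\<close>)
    moreover have "J T - J t2 \<le> (T - t2) * (\<beta> - c0 * 0)" by (rule step) (use times Epos in auto)
    ultimately show ?thesis by (simp add: algebra_simps)
  qed
  moreover have "J T \<ge> - (2 * pi\<^sup>2 * box_energy z X s)"
  proof -
    \<comment> \<open>A periodic primitive of z(s) in the angle. Integration by parts replaces -
      z(s) Y by d times the angular derivative of Y, and completing the square costs only d^2 / 2,
      which the Poincare inequality controls by the energy at time s.\<close>
    define d where "d x y = U x y s - U x 0 s" for x y
    have T: "b < T" "T < 0" using times by (auto simp: b_def)
    define P where "P = (\<lambda>x y. d x y * Y w x y T)"
    define P' where "P' = (\<lambda>x y. z x y s * Y w x y T + Y (Dy w) x y T * d x y)"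
    have cd: "continuous_on bx (\<lambda>p. d (fst p) (snd p))" unfolding d_def
      by (intro continuous_intros tc[OF U]) (use sb in auto)
    have cP: "continuous_on bx (\<lambda>(x, y). P' x y)" unfolding P'_def case_prod_unfold
      by (intro continuous_intros cd Yc[OF w] Yc[OF dw(2)] tc[OF tz]) (use T sb in auto)
    have cJ: "continuous_on bx (\<lambda>(x, y). ((Y (Dx w) x y T)\<^sup>2 + (Y (Dy w) x y T)\<^sup>2) / 2 - z x y s * Y w x y T)"
      unfolding case_prod_unfold
      by (intro continuous_intros Yc[OF dw(1)] Yc[OF dw(2)] Yc[OF w] tc[OF tz]) (use T sb in auto)
    have "integral bx (\<lambda>(x, y). P' x y) = integral {-X..X} (\<lambda>x. P x (2 * pi) - P x 0)"
      unfolding bx_def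
    proof (rule integral_Dy_box)
      show "((\<lambda>y. P x y) has_real_derivative P' x y) (at y)" for x y
        unfolding P_def P'_def d_def z_def using T sb
        by (auto intro!: derivative_eq_intros Yy[OF w] dU(5))
    qed (use cP in \<open>auto simp: bx_def\<close>)
    also have "\<dots> = 0" using perU[of _ 0 s] by (simp add: P_def d_def)
    finally have P0: "integral bx (\<lambda>(x, y). P' x y) = 0" .
    have "J T = J T + integral bx (\<lambda>(x, y). P' x y)" by (simp add: P0)
    also have "\<dots> = integral bx (\<lambda>p. (\<lambda>(x, y). ((Y (Dx w) x y T)\<^sup>2 + (Y (Dy w) x y T)\<^sup>2) / 2
        - z x y s * Y w x y T) p + (\<lambda>(x, y). P' x y) p)"
      unfolding J_def by (rule integral_add[symmetric, OF int[OF cJ] int[OF cP]])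
    also have "\<dots> \<ge> integral bx (\<lambda>(x, y). - ((d x y)\<^sup>2 / 2))"
    proof (rule integral_le[OF int int])
      show "continuous_on bx (\<lambda>(x, y). - ((d x y)\<^sup>2 / 2))" unfolding case_prod_unfold
        by (intro continuous_intros cd) auto
      show "continuous_on bx (\<lambda>p. (\<lambda>(x, y). ((Y (Dx w) x y T)\<^sup>2 + (Y (Dy w) x y T)\<^sup>2) / 2
        - z x y s * Y w x y T) p + (\<lambda>(x, y). P' x y) p)"
        by (rule continuous_on_add[OF cJ cP])
      fix p :: "real \<times> real"
      obtain x y where p: "p = (x, y)" by (cases p)
      have "(Y (Dy w) x y T + d x y)\<^sup>2 / 2 + (Y (Dx w) x y T)\<^sup>2 / 2 \<ge> 0" by simp
      then show "(\<lambda>(x, y). - ((d x y)\<^sup>2 / 2)) p \<le> (\<lambda>(x, y). ((Y (Dx w) x y T)\<^sup>2 + (Y (Dy w) x y T)\<^sup>2) / 2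
        - z x y s * Y w x y T) p + (\<lambda>(x, y). P' x y) p"
        by (simp add: p P'_def power2_sum algebra_simps add_divide_distrib)
    qed
    also have "integral bx (\<lambda>(x, y). - ((d x y)\<^sup>2 / 2)) = - (1/2) * integral bx (\<lambda>(x, y). (d x y)\<^sup>2)"
      by (subst integral_mult_right[symmetric]) (simp add: case_prod_unfold)
    also have "\<dots> \<ge> - (1/2) * (4 * pi\<^sup>2 * box_energy z X s)"
    proof -
      have "integral bx (\<lambda>(x, y). (d x y)\<^sup>2) \<le> 4 * pi\<^sup>2 * box_energy z X s"
        unfolding d_def bx_def box_energy_def z_def
        by (rule integral_cylinder_power2_le[where f = "\<lambda>x y. U x y s"])
          (use sb in \<open>auto intro!: dU(5) tc[OF U] tc[OF dU(2)] continuous_intros simp: case_prod_unfold\<close>)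
      then show ?thesis by (rule mult_left_mono_neg) simp
    qed
    finally show ?thesis by (simp add: mult_ac)
  qed
  moreover have "(T - s) * \<beta> = 4 * pi * M\<^sup>2 * (T - s)\<^sup>2 / cosh X" by (simp add: \<beta>_def power2_eq_square)
  ultimately show ?thesis using J0 unfolding z_def by linarith
qed

text \<open>Comparison with 1 / (1 + x^2), whose integral over any interval stays below pi. A bound
  uniform in X is all that is used, so no improper integral is formed.\<close>

lemma integral_cosh_powr_bound:
  fixes \<gamma> :: real
  assumes "\<gamma> > 0"
  obtains C where "C > 0" "\<And>X. X \<ge> 0 \<Longrightarrow> integral {-X..X} (\<lambda>x. cosh x powr - \<gamma>) \<le> C"
proof -
  \<comment> \<open>Makes m (1 + x^2) \<le> 1 + (\<gamma> x)^2 / 2, two of the three terms of the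
    quadratic Taylor polynomial of exp (\<gamma> |x|).\<close>
  define m where "m = min 1 (\<gamma>\<^sup>2 / 2)"
  have m: "m > 0" using assms by (simp add: m_def)
  have ptw: "cosh x powr - \<gamma> \<le> (2 powr \<gamma> / m) * (1 / (1 + x\<^sup>2))" for x :: real
  proof -
    have "1 + \<gamma> * \<bar>x\<bar> + (\<gamma> * \<bar>x\<bar>)\<^sup>2 / 2 \<le> exp (\<gamma> * \<bar>x\<bar>)"
      using exp_lower_Taylor_quadratic[of "\<gamma> * \<bar>x\<bar>"] assms by simp
    moreover have "m * (1 + x\<^sup>2) \<le> 1 + (\<gamma> * \<bar>x\<bar>)\<^sup>2 / 2"
    proof -
      have "m * 1 \<le> 1" "m * x\<^sup>2 \<le> (\<gamma>\<^sup>2 / 2) * x\<^sup>2" by (simp add: m_def, intro mult_right_mono, auto simp: m_def)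
      then show ?thesis by (simp add: distrib_left power_mult_distrib)
    qed
    moreover have "\<gamma> * \<bar>x\<bar> \<ge> 0" using assms by simp
    ultimately have "m * (1 + x\<^sup>2) \<le> exp (\<gamma> * \<bar>x\<bar>)" by linarith
    also have "exp (\<gamma> * \<bar>x\<bar>) = (exp \<bar>x\<bar>) powr \<gamma>" by (simp add: exp_powr_real mult.commute)
    also have "\<dots> \<le> (2 * cosh x) powr \<gamma>"
    proof (rule powr_mono2)
      have "exp \<bar>x\<bar> \<le> 2 * cosh \<bar>x\<bar>" by (simp add: cosh_field_def)
      then show "exp \<bar>x\<bar> \<le> 2 * cosh x" by simp
    qed (use assms in auto)
    also have "\<dots> = 2 powr \<gamma> * cosh x powr \<gamma>" by (simp add: powr_mult)
    finally have 1: "m * (1 + x\<^sup>2) \<le> 2 powr \<gamma> * cosh x powr \<gamma>" .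
    have S: "m * (1 + x\<^sup>2) > 0" using m by (intro mult_pos_pos add_pos_nonneg) auto
    have "inverse (cosh x powr \<gamma>) * (m * (1 + x\<^sup>2)) \<le> inverse (cosh x powr \<gamma>) * (2 powr \<gamma> * cosh x powr \<gamma>)"
      using 1 by (rule mult_left_mono) simp
    also have "\<dots> = 2 powr \<gamma>" by simp
    finally have "inverse (cosh x powr \<gamma>) \<le> 2 powr \<gamma> / (m * (1 + x\<^sup>2))"
      using S by (simp only: pos_le_divide_eq)
    then show ?thesis by (simp add: powr_minus)
  qed
  define C where "C = (2 powr \<gamma> / m) * pi"
  show thesis
  proof (rule that)
    show "C > 0" using m by (simp add: C_def)
    fix X :: real assume X: "X \<ge> 0"
    have h: "((\<lambda>x. 1 / (1 + x\<^sup>2)) has_integral arctan X - arctan (-X)) {-X..X}"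
      using X by (intro fundamental_theorem_of_calculus)
        (auto simp flip: has_real_derivative_iff_has_vector_derivative
          intro!: derivative_eq_intros simp: inverse_eq_divide)
    have "integral {-X..X} (\<lambda>x. cosh x powr - \<gamma>) \<le> integral {-X..X} (\<lambda>x. (2 powr \<gamma> / m) * (1 / (1 + x\<^sup>2)))"
    proof (rule integral_le)
      show "(\<lambda>x. cosh x powr - \<gamma>) integrable_on {-X..X}"
        by (intro integrable_continuous_interval continuous_intros) (auto simp: less_imp_neq[THEN not_sym])
      show "(\<lambda>x. (2 powr \<gamma> / m) * (1 / (1 + x\<^sup>2))) integrable_on {-X..X}"
        using h by (intro integrable_on_mult_right) blast
    qed (rule ptw)
    also have "\<dots> = (2 powr \<gamma> / m) * (arctan X - arctan (-X))"
      by (simp only: integral_mult_right integral_unique[OF h])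
    also have "\<dots> \<le> C"
      unfolding C_def using m arctan_bounded[of X] by (intro mult_left_mono) (auto simp: arctan_minus)
    finally show "integral {-X..X} (\<lambda>x. cosh x powr - \<gamma>) \<le> C" .
  qed
qed

lemma cosh_eventually_large: obtains X where "X \<ge> X0" "X > 0" "cosh X \<ge> (B::real)"
proof -
  have "eventually (\<lambda>X. cosh X \<ge> B \<and> X \<ge> max X0 1) at_top"
    using cosh_real_at_top eventually_ge_at_top[of "max X0 1"]
    by (auto simp: filterlim_at_top intro: eventually_conj)
  then obtain X where "cosh X \<ge> B" "X \<ge> max X0 1" by (auto simp: eventually_at_top_linorder)
  then show thesis by (intro that[of X]) auto
qed

lemma box_energy_mono:
  assumes f: "tempered n f" "t < 0" and X: "X0 \<le> X"
  shows "box_energy f X0 t \<le> box_energy f X t"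
proof -
  have i: "(\<lambda>(x, y). (f x y t)\<^sup>2) integrable_on cbox a b" for a b :: "real \<times> real"
    unfolding case_prod_unfold
    by (intro integrable_continuous continuous_intros tempered_continuous_on_compose[OF f(1)])
      (use f in auto)
  have sub: "cbox (-X0, 0::real) (X0, 2 * pi) \<subseteq> cbox (-X, 0) (X, 2 * pi)"
    using X by (auto simp: cbox_Pair_eq)
  show ?thesis unfolding box_energy_def
    by (rule integral_subset_le[OF sub i i]) auto
qed

lemma box_energy_continuous:
  assumes f: "tempered n f"
  shows "continuous_on {..<0} (box_energy f X)"
proof -
  have "continuous_on {..<0} (\<lambda>t. integral (cbox (-X, 0) (X, 2 * pi)) (\<lambda>p. (f (fst p) (snd p) t)\<^sup>2))"
  proof (rule integral_continuous_on_param)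
    show "continuous_on ({..<0} \<times> cbox (- X, 0) (X, 2 * pi)) (\<lambda>(t, p). (f (fst p) (snd p) t)\<^sup>2)"
      unfolding case_prod_unfold
      by (intro continuous_intros tempered_continuous_on_compose[OF f]) auto
  qed
  then show ?thesis by (simp add: box_energy_def[abs_def] case_prod_unfold)
qed

lemma box_energy_pos:
  assumes f: "tempered n f" "t < 0" and X: "X > 0" "\<bar>x\<bar> \<le> X" "y \<in> {0..2 * pi}" and nz: "f x y t \<noteq> 0"
  shows "box_energy f X t > 0"
proof -
  have c: "continuous_on S (\<lambda>p. (f (fst p) (snd p) t)\<^sup>2)" for S
    by (intro continuous_intros tempered_continuous_on_compose[OF f(1)]) (use f in auto)
  have i: "(\<lambda>p. (f (fst p) (snd p) t)\<^sup>2) integrable_on cbox (-X, 0) (X, 2 * pi)"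
    by (rule integrable_continuous[OF c])
  have ge: "box_energy f X t \<ge> 0"
    unfolding box_energy_def case_prod_unfold by (rule integral_nonneg[OF i]) auto
  have "box_energy f X t \<noteq> 0"
  proof
    assume "box_energy f X t = 0"
    then have "((\<lambda>p. (f (fst p) (snd p) t)\<^sup>2) has_integral 0) (cbox (-X, 0) (X, 2 * pi))"
      using i by (simp add: box_energy_def case_prod_unfold has_integral_integral)
    moreover have "box (-X, 0) (X, 2 * pi) \<noteq> {}"
      using X(1) by (auto simp: box_ne_empty Basis_prod_def)
    moreover have "(x, y) \<in> cbox (-X, 0) (X, 2 * pi)" using X by (auto simp: cbox_Pair_eq)
    ultimately have "(f (fst (x, y)) (snd (x, y)) t)\<^sup>2 = 0"
      by (intro has_integral_0_cbox_imp_0[OF c]) auto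
    then show False using nz by simp
  qed
  with ge show ?thesis by simp
qed

text \<open>The estimate is applied twice. If w does not vanish at T0, the energy is at least
  \<open>\<kappa>\<close> on an interval ending at T0, and this forces it to be at least
  \<open>e1\<close> at every s in [s1, s0]. Now [s1, s0] itself serves as the interval of large
  energy: its length times c0 e1 is controlled by the energy at s1, which the decay assumption
  bounds however early s1 is.\<close>

lemma oleinik_rigidity:
  assumes w: "tempered (-1) w" and U: "tempered 0 U"
    and Uy: "\<And>x y t. t < 0 \<Longrightarrow> Dy U x y t = w x y t * U x y t"
    and eq: "\<And>x y t. t < 0 \<Longrightarrow> Dt (Dy U) x y t = Dx (Dx w) x y t + Dy (Dy w) x y t"
    and perU: "\<And>x y t. U x (y + 2 * pi) t = U x y t"
    and perw: "\<And>x y t. w x (y + 2 * pi) t = w x y t"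
    and perwy: "\<And>x y t. Dy w x (y + 2 * pi) t = Dy w x y t"
    and Upos: "\<And>x y t. t < 0 \<Longrightarrow> U x y t > 0"
    and Ule: "\<And>x y t. t < 0 \<Longrightarrow> c0 * U x y t \<le> 1" and c0: "c0 > 0"
    and decay: "\<And>x y t. t \<le> t0 \<Longrightarrow> (Dy U x y t)\<^sup>2 \<le> K * cosh x powr - \<gamma>" and \<gamma>: "\<gamma> > 0" and t0: "t0 < 0"
    and T0: "T0 < 0"
  shows "w x0 y0 T0 = 0"
proof (rule ccontr)
  assume nz: "w x0 y0 T0 \<noteq> 0"
  define z where "z = Dy U"
  have tz: "tempered 0 z" using tempered_D[OF U] by (simp add: z_def)
  obtain y1 where y1: "y1 \<in> {0..2 * pi}" "w x0 y1 T0 = w x0 y0 T0"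
    by (rule periodic_reduce[of "\<lambda>y. w x0 y T0", OF perw])
  have z1: "z x0 y1 T0 \<noteq> 0" using nz y1 Uy[OF T0, of x0 y1] Upos[OF T0, of x0 y1] by (simp add: z_def)
  define X0 where "X0 = \<bar>x0\<bar> + 1"
  define E where "E = box_energy z"
  define \<kappa> where "\<kappa> = E X0 T0 / 2"
  have E0: "E X0 T0 > 0" unfolding E_def by (rule box_energy_pos[OF tz T0 _ _ y1(1) z1]) (auto simp: X0_def)
  have "isCont (E X0) T0"
    using box_energy_continuous[OF tz, of X0] T0 unfolding E_def
    by (simp add: continuous_on_eq_continuous_at)
  then have "eventually (\<lambda>t. E X0 t > \<kappa>) (at T0)"
    using E0 by (intro order_tendstoD(1)) (auto simp: isCont_def \<kappa>_def)
  then obtain d where d: "d > 0" "\<And>t. t \<noteq> T0 \<Longrightarrow> dist t T0 < d \<Longrightarrow> E X0 t > \<kappa>"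
    by (auto simp: eventually_at)
  define \<delta> where "\<delta> = d / 2"
  have \<delta>: "\<delta> > 0" using d by (simp add: \<delta>_def)
  have E\<kappa>: "E X t \<ge> \<kappa>" if "t \<in> {T0 - \<delta>..T0}" "X \<ge> X0" for X t
  proof -
    have "E X0 t \<ge> \<kappa>"
      using that d E0 by (cases "t = T0") (auto simp: \<kappa>_def \<delta>_def dist_real_def intro!: less_imp_le)
    also have "E X0 t \<le> E X t" unfolding E_def using that T0 by (intro box_energy_mono[OF tz]) auto
    finally show ?thesis .
  qed
  have \<kappa>0: "\<kappa> > 0" using E0 by (simp add: \<kappa>_def)
  \<comment> \<open>Half of c0 \<kappa> \<delta> is reserved for the boundary term; the other half
    divided by 2 pi^2 is the bound for the energy at time s.\<close>
  define e1 where "e1 = c0 * \<kappa> * \<delta> / (4 * pi\<^sup>2)"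
  have e1: "e1 > 0" using c0 \<kappa>0 \<delta> by (simp add: e1_def)
  obtain C\<gamma> where C\<gamma>: "C\<gamma> > 0" "\<And>X. X \<ge> 0 \<Longrightarrow> integral {-X..X} (\<lambda>x. cosh x powr - \<gamma>) \<le> C\<gamma>"
    by (rule integral_cosh_powr_bound[OF \<gamma>]) blast
  define C1 where "C1 = 2 * pi * (\<bar>K\<bar> * C\<gamma>)"
  have EC1: "E X s \<le> C1" if s: "s \<le> t0" and X: "X > 0" for X s
  proof -
    have cc: "continuous_on S (\<lambda>p. \<bar>K\<bar> * cosh (fst p) powr - \<gamma>)" for S :: "(real \<times> real) set"
      by (intro continuous_intros) (auto simp: less_imp_neq[THEN not_sym])
    have "E X s \<le> integral (cbox (-X, 0) (X, 2 * pi)) (\<lambda>p. \<bar>K\<bar> * cosh (fst p) powr - \<gamma>)"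
      unfolding E_def box_energy_def case_prod_unfold
    proof (rule integral_le)
      show "(\<lambda>p. (z (fst p) (snd p) s)\<^sup>2) integrable_on cbox (- X, 0) (X, 2 * pi)"
        by (intro integrable_continuous continuous_intros tempered_continuous_on_compose[OF tz])
          (use s t0 in auto)
      show "(\<lambda>p. \<bar>K\<bar> * cosh (fst p) powr - \<gamma>) integrable_on cbox (- X, 0) (X, 2 * pi)"
        by (rule integrable_continuous[OF cc])
      fix p :: "real \<times> real"
      have "(z (fst p) (snd p) s)\<^sup>2 \<le> K * cosh (fst p) powr - \<gamma>" using decay[OF s] by (simp add: z_def)
      also have "\<dots> \<le> \<bar>K\<bar> * cosh (fst p) powr - \<gamma>" by (intro mult_right_mono) auto
      finally show "(z (fst p) (snd p) s)\<^sup>2 \<le> \<bar>K\<bar> * cosh (fst p) powr - \<gamma>" .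
    qed
    also have "\<dots> = integral {-X..X} (\<lambda>x. 2 * pi * (\<bar>K\<bar> * cosh x powr - \<gamma>))"
      by (subst integral_prod_continuous[OF cc]) (simp add: cbox_interval)
    also have "\<dots> = 2 * pi * (\<bar>K\<bar> * integral {-X..X} (\<lambda>x. cosh x powr - \<gamma>))" by simp
    also have "\<dots> \<le> C1" unfolding C1_def using C\<gamma>(2)[of X] X by (intro mult_left_mono) auto
    finally show ?thesis .
  qed
  define s0 where "s0 = min (T0 - \<delta>) t0"
  \<comment> \<open>The final 1 makes c0 e1 l exceed the upper bound derived at the end by c0
    e1.\<close>
  define l where "l = (2 * pi\<^sup>2 * C1 + c0 * \<kappa> * \<delta> / 2) / (c0 * e1) + 1"
  define s1 where "s1 = s0 - \<bar>l\<bar>"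
  have s1: "s1 \<le> s0" "s0 - s1 \<ge> l" by (auto simp: s1_def)
  have s0: "s0 \<le> T0 - \<delta>" "s0 \<le> t0" by (auto simp: s0_def)
  obtain M1 where M1: "M1 > 0" "\<And>x y t. t \<in> {s1..T0} \<Longrightarrow> \<bar>w x y t\<bar> \<le> M1 * cosh x powr -1"
    by (rule tempered_bound[OF w T0, of s1]) blast
  obtain M2 where M2: "M2 > 0" "\<And>x y t. t \<in> {s1..T0} \<Longrightarrow> \<bar>Dx w x y t\<bar> \<le> M2 * cosh x powr 0"
    by (rule tempered_bound[OF tempered_mono[OF tempered_D(1)[OF w], of 0] T0, of s1]) auto
  define M where "M = max M1 M2"
  have M: "M \<ge> 0" using M1 by (simp add: M_def)
  have wM: "\<bar>w x y t\<bar> \<le> M / cosh x" if "t \<in> {s1..T0}" for x y t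
  proof -
    have "\<bar>w x y t\<bar> \<le> M1 * inverse (cosh x)" using M1(2)[OF that, of x y] unfolding cosh_powr_m1 .
    also have "\<dots> \<le> M * inverse (cosh x)" by (intro mult_right_mono) (auto simp: M_def)
    finally show ?thesis by (simp add: divide_inverse)
  qed
  have wxM: "\<bar>Dx w x y t\<bar> \<le> M" if "t \<in> {s1..T0}" for x y t
    using M2(2)[OF that, of x y] by (simp add: M_def)
  define \<beta> where "\<beta> = 4 * pi * M\<^sup>2 * (T0 - s1)\<^sup>2"
  \<comment> \<open>The cutoff comes last: \<open>\<beta>\<close> depends on the slab [s1, T0]
    through M as well as through its length, and the boundary term has to fall below half of c0
    \<kappa> \<delta>.\<close>
  obtain X where X: "X \<ge> X0" "X > 0" "cosh X \<ge> \<beta> / (c0 * \<kappa> * \<delta> / 2)" by (rule cosh_eventually_large)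
  have \<beta>X: "\<beta> / cosh X \<le> c0 * \<kappa> * \<delta> / 2"
    using X(3) c0 \<kappa>0 \<delta> by (simp add: field_simps)
  have \<beta>s: "4 * pi * M\<^sup>2 * (T0 - s)\<^sup>2 / cosh X \<le> c0 * \<kappa> * \<delta> / 2" if "s \<in> {s1..T0}" for s
  proof -
    have "4 * pi * M\<^sup>2 * (T0 - s)\<^sup>2 / cosh X \<le> \<beta> / cosh X"
      unfolding \<beta>_def using that by (intro divide_right_mono mult_left_mono power_mono) auto
    with \<beta>X show ?thesis by linarith
  qed
  note est = oleinik_estimate[OF w U Uy eq perU perw perwy Upos Ule, folded z_def, folded E_def]
  have Ee1: "e1 \<le> E X s" if s: "s \<in> {s1..s0}" for s
  proof -
    have "c0 * \<kappa> * (T0 - (T0 - \<delta>)) \<le> 2 * pi\<^sup>2 * E X s + 4 * pi * M\<^sup>2 * (T0 - s)\<^sup>2 / cosh X"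
      by (rule est) (use s s0 \<delta> T0 X c0 M wM wxM E\<kappa> Ule in auto)
    then have "c0 * \<kappa> * \<delta> / 2 \<le> 2 * pi\<^sup>2 * E X s" using \<beta>s[of s] s s0 \<delta> by simp
    then show ?thesis by (simp add: e1_def field_simps)
  qed
  have "c0 * e1 * (s0 - s1) \<le> 2 * pi\<^sup>2 * E X s1 + 4 * pi * M\<^sup>2 * (T0 - s1)\<^sup>2 / cosh X"
    by (rule est) (use s1 s0 \<delta> T0 X c0 M wM wxM Ee1 Ule in auto)
  also have "\<dots> \<le> 2 * pi\<^sup>2 * C1 + c0 * \<kappa> * \<delta> / 2"
    using EC1[of s1 X] \<beta>s[of s1] s1 s0 \<delta> X by (intro add_mono mult_left_mono) auto
  finally have "c0 * e1 * (s0 - s1) \<le> 2 * pi\<^sup>2 * C1 + c0 * \<kappa> * \<delta> / 2" .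
  moreover have "c0 * e1 * (s0 - s1) \<ge> c0 * e1 * l" using s1 c0 e1 by (intro mult_left_mono) auto
  moreover have "c0 * e1 * l = 2 * pi\<^sup>2 * C1 + c0 * \<kappa> * \<delta> / 2 + c0 * e1"
    using c0 e1 by (simp add: l_def field_simps)
  moreover have "c0 * e1 > 0" using c0 e1 by simp
  ultimately show False by linarith
qed

section \<open>Rigidity of the rotationally symmetric pressure equation\<close>

lemma powr_cosh_square: "(m * (cosh x)\<^sup>2) powr k = m powr k * cosh x powr (2 * k)" if "m > 0" for m x k :: real
proof -
  have "(cosh x)\<^sup>2 = cosh x powr 2" by simp
  then show ?thesis using that by (simp only: powr_mult powr_powr)
qed

lemma abs_mult_mono: "\<bar>a\<bar> \<le> A \<Longrightarrow> \<bar>b\<bar> \<le> B \<Longrightarrow> \<bar>a * b\<bar> \<le> A * B" for a b A B :: real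
  unfolding abs_mult by (rule mult_mono) (auto intro: order_trans[OF abs_ge_zero])

text \<open>For \<open>k\<close> with \<open>k\<^sup>2 + k \<le> 4\<close> the integral of \<open>V\<^sup>k G\<^sup>2\<close> is nonincreasing, up to boundary
  terms of order \<open>V\<^sup>k\<^sup>+\<^sup>1 G Dx G\<close>.  As \<open>G\<close> may grow like \<open>cosh x\<close>, these only vanish for \<open>k < -2\<close>; this
  explains the exponent \<open>-5/2\<close>.\<close>

lemma pressure_rigidity:
  fixes V G :: "real \<Rightarrow> real \<Rightarrow> real \<Rightarrow> real"
  assumes V: "tempered 2 V" and G: "tempered 1 G"
    and Gt: "\<And>x t. t < 0 \<Longrightarrow> Dt G x 0 t
        = V x 0 t * Dx (Dx G) x 0 t + Dx V x 0 t * Dx G x 0 t - 2 * Dx (Dx V) x 0 t * G x 0 t"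
    and Vt: "\<And>x t. t < 0 \<Longrightarrow> Dt V x 0 t = V x 0 t * Dx (Dx V) x 0 t - (Dx V x 0 t)\<^sup>2"
    and curv: "\<And>x t. t < 0 \<Longrightarrow> (Dx V x 0 t)\<^sup>2 \<le> V x 0 t * Dx (Dx V) x 0 t"
    and Vlow: "\<And>a b. b < 0 \<Longrightarrow> \<exists>m>0. \<forall>x. \<forall>t\<in>{a..b}. m * (cosh x)\<^sup>2 \<le> V x 0 t"
    and c0: "c0 > 0" "\<And>x t. t < 0 \<Longrightarrow> c0 \<le> V x 0 t"
    and Vup: "\<And>x t. t \<le> t0 \<Longrightarrow> V x 0 t \<le> N * (cosh x)\<^sup>2"
    and decay: "\<And>x t. t \<le> t0 \<Longrightarrow> \<bar>G x 0 t\<bar> \<le> K * cosh x powr - \<alpha>" and \<alpha>: "\<alpha> > 0"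
    and t0: "t0 < 0" and T: "T < 0"
  shows "G x 0 T = 0"
proof -
  note dV = tempered_D[OF V] and dG = tempered_D[OF G]
  note dV1 = tempered_D[OF dV(1)] and dG1 = tempered_D[OF dG(1)]
  note tc = tempered_continuous_on_compose
  have Vpos: "V x 0 t > 0" if "t < 0" for x t using c0(1) c0(2)[OF that, of x] by linarith
  \<comment> \<open>For negative k the condition k^2 + k \<le> 4 means k \<ge> (-1 - sqrt 17) / 2,
    about -2.56. Together with k < -2 this leaves a narrow window, and -5/2 lies in it.\<close>
  define p where "p x t = V x 0 t powr (-5/2)" for x t
  have p0: "p x t > 0" if "t < 0" for x t using Vpos[OF that] by (simp add: p_def less_imp_neq[THEN not_sym])
  have pc: "continuous_on S (\<lambda>q. p (q1 q) (q2 q))"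
    if "continuous_on S q1" "continuous_on S q2" "\<And>q. q \<in> S \<Longrightarrow> q2 q < 0" for S :: "'c::t2_space set" and q1 q2
    unfolding p_def using that Vpos
    by (intro continuous_intros tc[OF V]) (auto simp: less_imp_neq[THEN not_sym])
  define e where "e x t = p x t * (G x 0 t)\<^sup>2" for x t
  define e' where "e' x t = (-5/2) * p x t / V x 0 t * Dt V x 0 t * (G x 0 t)\<^sup>2 + 2 * p x t * G x 0 t * Dt G x 0 t" for x t
  define D where "D x t = p x t * V x 0 t * (Dx G x 0 t)\<^sup>2" for x t
  \<comment> \<open>A flux whose derivative absorbs the term with Dx (Dx G) and all products G Dx G,
    so that only - 2 D and multiples of G^2 remain.\<close>
  define F where "F x t = 2 * p x t * V x 0 t * G x 0 t * Dx G x 0 t + 5/2 * p x t * Dx V x 0 t * (G x 0 t)\<^sup>2" for x t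
  define F' where "F' x t = 2 * ((-5/2) * p x t * Dx V x 0 t * G x 0 t * Dx G x 0 t
      + p x t * Dx V x 0 t * G x 0 t * Dx G x 0 t + p x t * V x 0 t * (Dx G x 0 t)\<^sup>2
      + p x t * V x 0 t * G x 0 t * Dx (Dx G) x 0 t)
      + 5/2 * ((-5/2) * p x t / V x 0 t * (Dx V x 0 t)\<^sup>2 * (G x 0 t)\<^sup>2
      + p x t * Dx (Dx V) x 0 t * (G x 0 t)\<^sup>2 + 2 * p x t * Dx V x 0 t * G x 0 t * Dx G x 0 t)" for x t
  have pd: "((\<lambda>s. f s powr (-5/2)) has_real_derivative (-5/2) * (f s powr (-5/2)) / f s * f') (at s)"
    if "(f has_real_derivative f') (at s)" "f s > 0" for f f' s
  proof -
    have "f s powr (-5/2 - 1) = f s powr (-5/2) / f s" using that(2) by (simp only: powr_diff powr_one)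
    then show ?thesis
      using DERIV_chain2[OF has_real_derivative_powr[OF that(2), of "-5/2"] that(1)]
      by (simp only: times_divide_eq_right)
  qed
  have px: "((\<lambda>x. p x t) has_real_derivative (-5/2) * p x t / V x 0 t * Dx V x 0 t) (at x)" if "t < 0" for x t
    unfolding p_def by (rule pd[OF dV(4)[OF that] Vpos[OF that]])
  have pt: "((\<lambda>t. p x t) has_real_derivative (-5/2) * p x t / V x 0 t * Dt V x 0 t) (at t)" if "t < 0" for x t
    unfolding p_def by (rule pd[OF dV(6)[OF that] Vpos[OF that]])
  have et: "((\<lambda>t. e x t) has_real_derivative e' x t) (at t)" if "t < 0" for x t
    unfolding e_def e'_def by (rule derivative_eq_intros pt dG(6) that refl | simp)+
  have Fx: "((\<lambda>x. F x t) has_real_derivative F' x t) (at x)" if t: "t < 0" for x t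
    unfolding F_def F'_def using Vpos[OF t, of x]
    by (auto intro!: derivative_eq_intros px dG(4) dG1(4) dV(4) dV1(4) t simp: field_simps power2_eq_square)
  have key: "e' x t \<le> F' x t - 2 * D x t" if t: "t < 0" for x t
  proof -
    define v v1 v2 g g1 g2 q where "v = V x 0 t" and "v1 = Dx V x 0 t" and "v2 = Dx (Dx V) x 0 t"
      and "g = G x 0 t" and "g1 = Dx G x 0 t" and "g2 = Dx (Dx G) x 0 t" and "q = p x t"
    have v: "v > 0" and q: "q > 0" using Vpos[OF t] p0[OF t] by (simp_all add: v_def q_def)
    have c: "v1\<^sup>2 \<le> v * v2" using curv[OF t, of x] by (simp add: v_def v1_def v2_def)
    \<comment> \<open>For a general power k the bracket is (k^2 - k) v1^2 + (2 k - 4) v v2. By v1^2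
      \<le> v v2 it is at most (k^2 + k - 4) v v2, here with coefficient -1/4.\<close>
    have "e' x t - (F' x t - 2 * D x t) = q / v * g\<^sup>2 * (35/4 * v1\<^sup>2 - 9 * (v * v2))"
      unfolding e'_def F'_def D_def Vt[OF t] Gt[OF t] v_def[symmetric] v1_def[symmetric] v2_def[symmetric]
        g_def[symmetric] g1_def[symmetric] g2_def[symmetric] q_def[symmetric]
      using v by (simp add: field_simps power2_eq_square)
    also have "\<dots> \<le> 0"
    proof (rule mult_nonneg_nonpos)
      show "0 \<le> q / v * g\<^sup>2" using v q by simp
      have "v1\<^sup>2 \<ge> 0" by simp
      then show "35/4 * v1\<^sup>2 - 9 * (v * v2) \<le> 0" using c by linarith
    qed
    finally show ?thesis by simp
  qed
  have ec: "continuous_on S (\<lambda>q. e (q1 q) (q2 q))" "continuous_on S (\<lambda>q. D (q1 q) (q2 q))"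
      "continuous_on S (\<lambda>q. e' (q1 q) (q2 q))" "continuous_on S (\<lambda>q. F' (q1 q) (q2 q))"
    if "continuous_on S q1" "continuous_on S q2" "\<And>q. q \<in> S \<Longrightarrow> q2 q < 0" for S :: "'c::t2_space set" and q1 q2
    unfolding e_def D_def e'_def F'_def
    by (intro continuous_intros pc tc[OF V] tc[OF G] tc[OF dG(1)] tc[OF dG(3)] tc[OF dV(1)] tc[OF dV(3)]
      tc[OF dV1(1)] tc[OF dG1(1)] that; use that Vpos in \<open>auto simp: less_imp_neq[THEN not_sym]\<close>)+
  have ei: "(\<lambda>x. e x t) integrable_on {a..b}" "(\<lambda>x. D x t) integrable_on {a..b}"
      "(\<lambda>x. e' x t) integrable_on {a..b}" "(\<lambda>x. F' x t) integrable_on {a..b}" if "t < 0" for a b t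
    by (intro integrable_continuous_interval ec continuous_intros that)+
  define E where "E X t = integral {-X..X} (\<lambda>x. e x t)" for X t
  define I where "I X t = integral {-X..X} (\<lambda>x. D x t)" for X t
  have e0: "e x t \<ge> 0" "D x t \<ge> 0" if "t < 0" for x t
    using p0[OF that, of x] Vpos[OF that, of x] by (auto simp: e_def D_def)
  have E0: "E X t \<ge> 0" "I X t \<ge> 0" if "t < 0" for X t
    unfolding E_def I_def using that by (auto intro!: integral_nonneg ei e0)
  have mono: "E X t \<le> E X' t" "I X t \<le> I X' t" if "t < 0" "X \<le> X'" for X X' t
    unfolding E_def I_def using that by (auto intro!: integral_subset_le ei e0)
  have Et: "(E X has_real_derivative integral {-X..X} (\<lambda>x. e' x t)) (at t)" if t: "t < 0" for X t
    unfolding E_def[abs_def] cbox_interval[symmetric]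
  proof (rule leibniz_open[where U = "{..<0}"])
    show "continuous_on ({..<0} \<times> cbox (- X) X) (\<lambda>(t, x). e' x t)"
      unfolding case_prod_unfold by (intro ec continuous_intros) auto
    show "continuous_on (cbox (- X) X) (\<lambda>x. e x t)" if "t \<in> {..<0}" for t
      by (intro ec continuous_intros) (use that in auto)
  qed (use t et in auto)
  have Fb: "\<exists>B>0. \<forall>X. \<forall>t\<in>{s..T'}. \<bar>F X t\<bar> \<le> B / cosh X" if T': "T' < 0" for s T'
  proof -
    obtain m where m: "m > 0" "\<forall>x. \<forall>t\<in>{s..T'}. m * (cosh x)\<^sup>2 \<le> V x 0 t" using Vlow[OF T'] by blast
    obtain M where M: "M > 0" "\<And>x y t. t \<in> {s..T'} \<Longrightarrow> \<bar>G x y t\<bar> \<le> M * cosh x powr 1"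
      by (rule tempered_bound[OF G T', of s]) blast
    obtain M1 where M1: "M1 > 0" "\<And>x y t. t \<in> {s..T'} \<Longrightarrow> \<bar>Dx G x y t\<bar> \<le> M1 * cosh x powr 1"
      by (rule tempered_bound[OF dG(1) T', of s]) blast
    obtain M2 where M2: "M2 > 0" "\<And>x y t. t \<in> {s..T'} \<Longrightarrow> \<bar>Dx V x y t\<bar> \<le> M2 * cosh x powr 2"
      by (rule tempered_bound[OF dV(1) T', of s]) blast
    \<comment> \<open>With c = cosh X, both p V and p |Dx V| are of order c^(-3), while G and Dx G
      are at most of order c. Hence both terms of F are of order 1 / c.\<close>
    define B where "B = 2 * (m powr (-3/2) * M * M1) + 5/2 * (m powr (-5/2) * M2 * M * M)"
    have B: "B > 0" unfolding B_def using m M(1) M1(1) M2(1) by (intro add_pos_pos mult_pos_pos) auto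
    have "\<bar>F X t\<bar> \<le> B / cosh X" if t: "t \<in> {s..T'}" for X t
    proof -
      have tn: "t < 0" using t T' by auto
      define c where "c = cosh X"
      have c: "c > 0" by (simp add: c_def)
      have mV: "m * c\<^sup>2 \<le> V X 0 t" "m * c\<^sup>2 > 0" using m t by (auto simp: c_def)
      have 1: "p X t * V X 0 t \<le> m powr (-3/2) * c powr -3"
      proof -
        have "p X t * V X 0 t = V X 0 t powr (-3/2)"
          using Vpos[OF tn, of X] powr_add[of "V X 0 t" "-5/2" 1] by (simp add: p_def)
        also have "\<dots> \<le> (m * c\<^sup>2) powr (-3/2)" using mV by (intro powr_mono2') auto
        also have "\<dots> = m powr (-3/2) * c powr -3" unfolding c_def by (subst powr_cosh_square[OF m(1)]) simp
        finally show ?thesis .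
      qed
      have 2: "p X t \<le> m powr (-5/2) * c powr -5"
      proof -
        have "p X t \<le> (m * c\<^sup>2) powr (-5/2)" unfolding p_def using mV by (intro powr_mono2') auto
        also have "\<dots> = m powr (-5/2) * c powr -5" unfolding c_def by (subst powr_cosh_square[OF m(1)]) simp
        finally show ?thesis .
      qed
      have g: "\<bar>G X 0 t\<bar> \<le> M * c" "\<bar>Dx G X 0 t\<bar> \<le> M1 * c" "\<bar>Dx V X 0 t\<bar> \<le> M2 * c\<^sup>2"
        using M(2)[OF t, of X 0] M1(2)[OF t, of X 0] M2(2)[OF t, of X 0] by (simp_all add: c_def)
      have pw: "c powr -3 = 1 / c ^ 3" "c powr -5 = 1 / c ^ 5"
        using powr_minus_divide[of c 3] powr_minus_divide[of c 5] c by simp_all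
      have "\<bar>p X t * V X 0 t * G X 0 t * Dx G X 0 t\<bar> \<le> (m powr (-3/2) * c powr -3) * (M * c) * (M1 * c)"
        by (rule abs_mult_mono[OF abs_mult_mono[OF _ g(1)] g(2)])
          (use 1 p0[OF tn, of X] Vpos[OF tn, of X] in simp)
      also have "\<dots> = m powr (-3/2) * M * M1 / c" unfolding pw using c by (simp add: field_simps power3_eq_cube)
      finally have a: "\<bar>p X t * V X 0 t * G X 0 t * Dx G X 0 t\<bar> \<le> m powr (-3/2) * M * M1 / c" .
      have "\<bar>p X t * Dx V X 0 t * G X 0 t * G X 0 t\<bar> \<le> (m powr (-5/2) * c powr -5) * (M2 * c\<^sup>2) * (M * c) * (M * c)"
        by (rule abs_mult_mono[OF abs_mult_mono[OF abs_mult_mono[OF _ g(3)] g(1)] g(1)])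
          (use 2 p0[OF tn, of X] in simp)
      also have "\<dots> = m powr (-5/2) * M2 * M * M / c"
        unfolding pw using c by (simp add: field_simps power2_eq_square eval_nat_numeral)
      finally have b: "\<bar>p X t * Dx V X 0 t * G X 0 t * G X 0 t\<bar> \<le> m powr (-5/2) * M2 * M * M / c" .
      have "F X t = 2 * (p X t * V X 0 t * G X 0 t * Dx G X 0 t) + 5/2 * (p X t * Dx V X 0 t * G X 0 t * G X 0 t)"
        by (simp add: F_def power2_eq_square)
      moreover have "B / c = 2 * (m powr (-3/2) * M * M1 / c) + 5/2 * (m powr (-5/2) * M2 * M * M / c)"
        by (simp add: B_def add_divide_distrib)
      moreover have "\<bar>2 * r1 + 5/2 * r2\<bar> \<le> 2 * R1 + 5/2 * R2" if "\<bar>r1\<bar> \<le> R1" "\<bar>r2\<bar> \<le> R2" for r1 r2 R1 R2 :: real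
        using that by linarith
      ultimately show ?thesis using a b unfolding c_def by presburger
    qed
    with B show ?thesis by blast
  qed
  have step: "E X T' \<le> E X s + (T' - s) * (2 * B / cosh X - 2 * \<eta>)"
    if T': "s < T'" "T' < 0" and B: "\<forall>X. \<forall>t\<in>{s..T'}. \<bar>F X t\<bar> \<le> B / cosh X"
      and X: "X > 0" and \<eta>: "\<forall>t\<in>{s..T'}. \<eta> \<le> I X t" for X s T' B \<eta>
  proof -
    have "\<exists>r. s < r \<and> r < T' \<and> E X T' - E X s = (T' - s) * integral {-X..X} (\<lambda>x. e' x r)"
      by (rule MVT2[OF T'(1)]) (use T' in \<open>auto intro!: Et\<close>)
    then obtain r where r: "s < r" "r < T'" "E X T' - E X s = (T' - s) * integral {-X..X} (\<lambda>x. e' x r)" by blast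
    have rn: "r < 0" using r T' by simp
    have "integral {-X..X} (\<lambda>x. e' x r) \<le> integral {-X..X} (\<lambda>x. F' x r - 2 * D x r)"
      by (intro integral_le integrable_diff integrable_on_mult_right ei rn key)
    also have "\<dots> = integral {-X..X} (\<lambda>x. F' x r) - 2 * I X r"
      unfolding I_def by (subst integral_diff) (auto intro!: ei rn integrable_on_mult_right)
    also have "integral {-X..X} (\<lambda>x. F' x r) = F X r - F (-X) r"
      by (rule integral_unique, rule fundamental_theorem_of_calculus)
        (use X rn in \<open>auto simp flip: has_real_derivative_iff_has_vector_derivative intro: DERIV_subset Fx\<close>)
    finally have "integral {-X..X} (\<lambda>x. e' x r) \<le> F X r - F (-X) r - 2 * I X r" .
    moreover have "\<bar>F X r\<bar> \<le> B / cosh X" "\<bar>F (-X) r\<bar> \<le> B / cosh X"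
      using B[rule_format, of r X] B[rule_format, of r "-X"] r by auto
    moreover have "\<eta> \<le> I X r" using \<eta> r by auto
    ultimately have "integral {-X..X} (\<lambda>x. e' x r) \<le> 2 * B / cosh X - 2 * \<eta>" by simp
    then have "(T' - s) * integral {-X..X} (\<lambda>x. e' x r) \<le> (T' - s) * (2 * B / cosh X - 2 * \<eta>)"
      using T' by (intro mult_left_mono) auto
    with r(3) show ?thesis by linarith
  qed
  obtain C\<alpha> where C\<alpha>: "C\<alpha> > 0" "\<And>X. X \<ge> 0 \<Longrightarrow> integral {-X..X} (\<lambda>x. cosh x powr - \<alpha>) \<le> C\<alpha>"
    by (rule integral_cosh_powr_bound[OF \<alpha>]) blast
  define P where "P = c0 powr (-5/2)"
  have P: "P > 0" using c0 by (simp add: P_def)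
  have pP: "p x t \<le> P" if "t < 0" for x t
    unfolding p_def P_def using c0 c0(2)[OF that, of x] by (intro powr_mono2') auto
  have K0: "K \<ge> 0" using decay[of t0 0] by (simp add: order_trans[OF abs_ge_zero])
  \<comment> \<open>Only one of the two factors of G is spent on integrability at the poles; the
    other one supplies the small factor \<open>\<eta>\<close>.\<close>
  have Esup: "E X s \<le> P * (\<eta> * K * C\<alpha>)"
    if s: "s \<le> t0" and X: "X \<ge> 0" and \<eta>: "\<eta> \<ge> 0" "\<And>x. \<bar>G x 0 s\<bar> \<le> \<eta>" for X s \<eta>
  proof -
    have sn: "s < 0" using s t0 by simp
    have "E X s \<le> integral {-X..X} (\<lambda>x. P * (\<eta> * K) * cosh x powr - \<alpha>)" unfolding E_def
    proof (rule integral_le[OF ei(1)[OF sn]])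
      show "(\<lambda>x. P * (\<eta> * K) * cosh x powr - \<alpha>) integrable_on {- X..X}"
        by (intro integrable_continuous_interval continuous_intros) (auto simp: less_imp_neq[THEN not_sym])
      fix x
      have "\<bar>G x 0 s\<bar> * \<bar>G x 0 s\<bar> \<le> \<eta> * (K * cosh x powr - \<alpha>)"
        using \<eta> decay[OF s, of x] by (intro mult_mono) auto
      then have "(G x 0 s)\<^sup>2 \<le> \<eta> * (K * cosh x powr - \<alpha>)" by (simp add: power2_eq_square)
      then have "e x s \<le> P * (\<eta> * (K * cosh x powr - \<alpha>))"
        unfolding e_def using pP[OF sn, of x] p0[OF sn, of x] P by (intro mult_mono) auto
      then show "e x s \<le> P * (\<eta> * K) * cosh x powr - \<alpha>" by (simp add: mult_ac)
    qed
    also have "\<dots> = P * (\<eta> * K) * integral {-X..X} (\<lambda>x. cosh x powr - \<alpha>)" by simp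
    also have "\<dots> \<le> P * (\<eta> * K) * C\<alpha>" using C\<alpha>(2)[OF X] P \<eta>(1) K0 by (intro mult_left_mono) auto
    finally show ?thesis by (simp add: mult_ac)
  qed
  have cosh_powr_le_1: "cosh x powr - \<alpha> \<le> 1" for x :: real
    using cosh_real_ge_1[of x] \<alpha> powr_mono[of "-\<alpha>" 0 "cosh x"] by simp
  have Gb: "\<bar>G x 0 s\<bar> \<le> K" if "s \<le> t0" for x s
    using decay[OF that, of x] mult_left_mono[OF cosh_powr_le_1[of x] K0] by simp
  define C1 where "C1 = P * (K * K * C\<alpha>)"
  have E_C1: "E X s \<le> C1" if "s \<le> t0" "X \<ge> 0" for X s
    unfolding C1_def by (rule Esup) (use that Gb K0 in auto)
  have small_I: "\<exists>s\<le>t0. s < T \<and> I X0 s < \<eta>" if \<eta>: "\<eta> > 0" and X0: "X0 > 0" for X0 \<eta>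
  proof (rule ccontr)
    assume "\<not> ?thesis"
    then have lo: "\<eta> \<le> I X0 t" if "t \<le> t0" "t < T" for t using that by force
    define T1 where "T1 = min t0 (T - 1)"
    have T1: "T1 \<le> t0" "T1 < T" "T1 < 0" using t0 T by (auto simp: T1_def)
    \<comment> \<open>Over a time longer than |C1| / \<eta>, a decrease at rate at least \<eta> uses
      up the initial bound \<open>C1\<close> and would make the energy at T1 negative.\<close>
    define s where "s = T1 - (\<bar>C1\<bar> / \<eta> + 1)"
    have "0 < \<bar>C1\<bar> / \<eta> + 1" using \<eta> by (intro add_nonneg_pos) auto
    then have s: "s < T1" unfolding s_def by linarith
    obtain B where B: "B > 0" "\<forall>X. \<forall>t\<in>{s..T1}. \<bar>F X t\<bar> \<le> B / cosh X" using Fb[OF T1(3)] by blast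
    obtain X where X: "X \<ge> X0" "X > 0" "cosh X \<ge> 2 * B / \<eta>" by (rule cosh_eventually_large)
    have "2 * B / cosh X \<le> \<eta>" using X(3) \<eta> by (simp add: field_simps)
    have "E X T1 \<le> E X s + (T1 - s) * (2 * B / cosh X - 2 * \<eta>)"
    proof (rule step[OF s T1(3) B(2) X(2)], rule ballI)
      fix t assume t: "t \<in> {s..T1}"
      have "\<eta> \<le> I X0 t" by (rule lo) (use t T1 in auto)
      also have "\<dots> \<le> I X t" by (rule mono) (use t T1 X in auto)
      finally show "\<eta> \<le> I X t" .
    qed
    also have "\<dots> \<le> C1 + (T1 - s) * (- \<eta>)"
      using E_C1[of s X] s T1 X \<open>2 * B / cosh X \<le> \<eta>\<close> by (intro add_mono mult_left_mono) auto
    also have "(T1 - s) * (- \<eta>) = - \<bar>C1\<bar> - \<eta>" using \<eta> by (simp add: s_def field_simps)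
    finally have "E X T1 < 0" using \<eta> by linarith
    then show False using E0(1)[OF T1(3), of X] by simp
  qed
  have small_G: "\<exists>s\<le>t0. s < T \<and> (\<forall>x. \<bar>G x 0 s\<bar> \<le> \<eta>)" if \<eta>: "\<eta> > 0" for \<eta>
  proof -
    \<comment> \<open>Beyond X0 the assumed decay already gives |G| \<le> \<eta> / 2. The summand 1
      keeps the base of the power positive when K = 0.\<close>
    obtain X0 where X0: "X0 \<ge> 1" "X0 > 0" "cosh X0 \<ge> (2 * K / \<eta> + 1) powr (1 / \<alpha>)" by (rule cosh_eventually_large)
    have KX: "K * cosh x powr - \<alpha> \<le> \<eta> / 2" if "\<bar>x\<bar> \<ge> X0" for x
    proof -
      have "cosh X0 \<le> cosh \<bar>x\<bar>" using that X0 by (subst cosh_real_nonneg_le_iff) auto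
      then have "(2 * K / \<eta> + 1) powr (1 / \<alpha>) \<le> cosh x" using X0 by simp
      then have "((2 * K / \<eta> + 1) powr (1 / \<alpha>)) powr \<alpha> \<le> cosh x powr \<alpha>"
        using \<alpha> by (intro powr_mono2) auto
      moreover have "2 * K / \<eta> + 1 > 0" using K0 \<eta> by (intro add_nonneg_pos) auto
      ultimately have "2 * K / \<eta> \<le> cosh x powr \<alpha>" using \<alpha> by (simp add: powr_powr)
      then show ?thesis using \<eta> by (simp add: powr_minus field_simps)
    qed
    \<comment> \<open>A lower bound on [-X0, X0] for the weight p V = V^(-3/2) in D. It is the same
      for all t \<le> t0, as it must be known before the time s is chosen.\<close>
    define \<rho> where "\<rho> = (\<bar>N\<bar> * (cosh X0)\<^sup>2 + 1) powr (-3/2)"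
    have \<rho>: "\<rho> > 0" unfolding \<rho>_def by (simp add: add_nonneg_eq_0_iff)
    \<comment> \<open>The parameter in 2 \<delta> |Dx G| \<le> (Dx G)^2 + \<delta>^2. Integrated
      over [-X0, X0], the constant part contributes \<delta> X0 = \<eta> / 4 and the dissipation
      another \<eta> / 4.\<close>
    define \<delta> where "\<delta> = \<eta> / (4 * X0)"
    have \<delta>: "\<delta> > 0" using \<eta> X0 by (simp add: \<delta>_def)
    obtain s where s: "s \<le> t0" "s < T" "I X0 s < \<eta> * \<delta> * \<rho> / 2"
      using small_I[of "\<eta> * \<delta> * \<rho> / 2" X0] \<eta> \<delta> \<rho> X0 by auto
    have sn: "s < 0" using s t0 by simp
    have gi: "(\<lambda>x. \<bar>Dx G x 0 s\<bar>) integrable_on {a..b}" for a b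
      by (intro integrable_continuous_interval continuous_intros tc[OF dG(1)]) (use sn in auto)
    have gI: "integral {-X0..X0} (\<lambda>x. \<bar>Dx G x 0 s\<bar>) \<le> \<eta> / 2"
    proof -
      have "integral {-X0..X0} (\<lambda>x. \<bar>Dx G x 0 s\<bar>)
          \<le> integral {-X0..X0} (\<lambda>x. \<delta> / 2 + D x s * (1 / (2 * \<delta> * \<rho>)))"
      proof (rule integral_le[OF gi])
        show "(\<lambda>x. \<delta> / 2 + D x s * (1 / (2 * \<delta> * \<rho>))) integrable_on {- X0..X0}"
          by (intro integrable_add integrable_on_mult_left ei(2)[OF sn]) auto
        fix x assume x: "x \<in> {-X0..X0}"
        have "p x s * V x 0 s \<ge> \<rho>"
        proof -
          have "cosh \<bar>x\<bar> \<le> cosh X0" using x by (subst cosh_real_nonneg_le_iff) auto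
          then have "cosh x \<le> cosh X0" by simp
          have "V x 0 s \<le> N * (cosh x)\<^sup>2" by (rule Vup[OF s(1)])
          also have "\<dots> \<le> \<bar>N\<bar> * (cosh X0)\<^sup>2"
            using \<open>cosh x \<le> cosh X0\<close> by (intro mult_mono power_mono) auto
          also have "\<dots> \<le> \<bar>N\<bar> * (cosh X0)\<^sup>2 + 1" by simp
          finally have "\<rho> \<le> V x 0 s powr (-3/2)" unfolding \<rho>_def
            using Vpos[OF sn, of x] by (intro powr_mono2') auto
          also have "\<dots> = p x s * V x 0 s"
            using Vpos[OF sn, of x] powr_add[of "V x 0 s" "-5/2" 1] by (simp add: p_def)
          finally show ?thesis .
        qed
        then have "\<rho> * (Dx G x 0 s)\<^sup>2 \<le> D x s" unfolding D_def by (rule mult_right_mono) simp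
        then have 1: "(Dx G x 0 s)\<^sup>2 \<le> D x s / \<rho>" using \<rho> by (simp add: field_simps)
        have "0 \<le> (\<bar>Dx G x 0 s\<bar> - \<delta>)\<^sup>2" by simp
        then have "2 * \<delta> * \<bar>Dx G x 0 s\<bar> \<le> (Dx G x 0 s)\<^sup>2 + \<delta>\<^sup>2"
          by (simp add: power2_diff mult_ac)
        then have "2 * \<delta> * \<bar>Dx G x 0 s\<bar> \<le> D x s / \<rho> + \<delta>\<^sup>2" using 1 by simp
        then have "\<bar>Dx G x 0 s\<bar> \<le> (D x s / \<rho> + \<delta>\<^sup>2) / (2 * \<delta>)"
          using \<delta> by (simp add: pos_le_divide_eq mult_ac)
        also have "\<dots> = \<delta> / 2 + D x s * (1 / (2 * \<delta> * \<rho>))" using \<delta> \<rho>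
          by (simp add: field_simps power2_eq_square)
        finally show "\<bar>Dx G x 0 s\<bar> \<le> \<delta> / 2 + D x s * (1 / (2 * \<delta> * \<rho>))" .
      qed
      also have "\<dots> = \<delta> * X0 + I X0 s * (1 / (2 * \<delta> * \<rho>))"
      proof -
        have "integral {-X0..X0} (\<lambda>x. \<delta> / 2) = \<delta> * X0" using X0 by simp
        moreover have "integral {-X0..X0} (\<lambda>x. D x s * (1 / (2 * \<delta> * \<rho>))) = I X0 s * (1 / (2 * \<delta> * \<rho>))"
          unfolding I_def by (rule integral_mult_left)
        moreover have "integral {-X0..X0} (\<lambda>x. \<delta> / 2 + D x s * (1 / (2 * \<delta> * \<rho>)))
          = integral {-X0..X0} (\<lambda>x. \<delta> / 2) + integral {-X0..X0} (\<lambda>x. D x s * (1 / (2 * \<delta> * \<rho>)))"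
          by (rule integral_add[OF integrable_const_ivl integrable_on_mult_left[OF ei(2)[OF sn]]])
        ultimately show ?thesis by (simp only:)
      qed
      also have "\<dots> \<le> \<delta> * X0 + (\<eta> * \<delta> * \<rho> / 2) * (1 / (2 * \<delta> * \<rho>))"
        using s(3) \<delta> \<rho> by (intro add_left_mono mult_right_mono) auto
      also have "\<dots> = \<eta> / 2" using \<delta> \<rho> X0 by (simp add: \<delta>_def)
      finally show ?thesis .
    qed
    have "\<bar>G x 0 s\<bar> \<le> \<eta>" for x
    proof (cases "\<bar>x\<bar> \<ge> X0")
      case True
      then show ?thesis using decay[OF s(1), of x] KX[OF True] \<eta> by linarith
    next
      case False
      then have x: "x \<in> {-X0..X0}" by auto
      have "((\<lambda>x. Dx G x 0 s) has_integral G X0 0 s - G x 0 s) {x..X0}"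
        using x sn dG(4)[OF sn] by (intro fundamental_theorem_of_calculus)
          (auto simp flip: has_real_derivative_iff_has_vector_derivative intro: DERIV_subset)
      then have "\<bar>G X0 0 s - G x 0 s\<bar> = norm (integral {x..X0} (\<lambda>x. Dx G x 0 s))"
        by (simp add: integral_unique)
      also have "\<dots> \<le> integral {x..X0} (\<lambda>x. \<bar>Dx G x 0 s\<bar>)"
        by (rule integral_norm_bound_integral[OF _ gi])
          (auto intro!: integrable_continuous_interval continuous_intros tc[OF dG(1)] sn)
      also have "\<dots> \<le> integral {-X0..X0} (\<lambda>x. \<bar>Dx G x 0 s\<bar>)"
        using x by (intro integral_subset_le gi) auto
      also note gI
      finally have "\<bar>G X0 0 s - G x 0 s\<bar> \<le> \<eta> / 2" .
      moreover have "\<bar>G X0 0 s\<bar> \<le> \<eta> / 2" using decay[OF s(1), of X0] KX[of X0] X0 by simp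
      ultimately show ?thesis by linarith
    qed
    with s show ?thesis by blast
  qed
  define X1 where "X1 = \<bar>x\<bar> + 1"
  have X1: "X1 > 0" by (simp add: X1_def)
  \<comment> \<open>Between a time s at which G is uniformly small and T the energy can grow only
    through the boundary terms, which a large X keeps below \<epsilon>.\<close>
  have "E X1 T \<le> \<epsilon> * (P * (K * C\<alpha>) + 1)" if \<epsilon>: "\<epsilon> > 0" for \<epsilon>
  proof -
    obtain s where s: "s \<le> t0" "s < T" "\<And>x. \<bar>G x 0 s\<bar> \<le> \<epsilon>" using small_G[OF \<epsilon>] by blast
    obtain B where B: "B > 0" "\<forall>X. \<forall>t\<in>{s..T}. \<bar>F X t\<bar> \<le> B / cosh X" using Fb[OF T] by blast
    obtain X where X: "X \<ge> X1" "X > 0" "cosh X \<ge> (T - s) * (2 * B) / \<epsilon>" by (rule cosh_eventually_large)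
    have "E X1 T \<le> E X T" by (rule mono(1)[OF T X(1)])
    also have "\<dots> \<le> E X s + (T - s) * (2 * B / cosh X - 2 * 0)"
      by (rule step[OF s(2) T B(2) X(2)]) (use T E0 in auto)
    also have "\<dots> \<le> P * (\<epsilon> * K * C\<alpha>) + \<epsilon>"
      using Esup[OF s(1) _ _ s(3), of X] X \<epsilon> by (intro add_mono) (auto simp: field_simps)
    finally show ?thesis by (simp add: algebra_simps)
  qed
  then have "E X1 T \<le> 0 + \<epsilon>" if "\<epsilon> > 0" for \<epsilon>
  proof -
    define Q where "Q = P * (K * C\<alpha>) + 1"
    have Q: "Q > 0" unfolding Q_def using P K0 C\<alpha>(1) by (intro add_nonneg_pos) auto
    from \<open>\<And>\<epsilon>. \<epsilon> > 0 \<Longrightarrow> E X1 T \<le> \<epsilon> * (P * (K * C\<alpha>) + 1)\<close>[of "\<epsilon> / Q"] Q that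
    show ?thesis by (simp add: Q_def[symmetric])
  qed
  then have "E X1 T \<le> 0" by (rule field_le_epsilon)
  then have "E X1 T = 0" using E0(1)[OF T, of X1] by simp
  then have "((\<lambda>x. e x T) has_integral 0) (cbox (-X1) X1)"
    using ei(1)[OF T, of "-X1" X1] by (simp add: E_def cbox_interval has_integral_integral)
  then have "e x T = 0"
    by (intro has_integral_0_cbox_imp_0[of "-X1" X1 "\<lambda>x. e x T"])
      (use T X1 in \<open>auto intro!: ec continuous_intros e0 simp: X1_def\<close>)
  then show ?thesis using p0[OF T, of x] by (simp add: e_def)
qed

section \<open>Decay at the poles and latitude coordinates\<close>

text \<open>f plus (c / \<alpha>) exp (- \<alpha> x) is nonincreasing and f minus it is
  nondecreasing for x \<ge> x0, which integrates the bound without integrating f'.\<close>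

lemma exp_decay_oscillation:
  fixes f f' :: "real \<Rightarrow> real"
  assumes f: "\<And>x. (f has_real_derivative f' x) (at x)"
    and b: "\<And>x. x \<ge> x0 \<Longrightarrow> \<bar>f' x\<bar> \<le> c * exp (- \<alpha> * x)" and \<alpha>: "\<alpha> > 0" and c: "c \<ge> 0"
    and xy: "x \<ge> x0" "y \<ge> x0"
  shows "\<bar>f x - f y\<bar> \<le> c / \<alpha> * exp (- \<alpha> * x0)"
proof -
  have main: "\<bar>f x - f y\<bar> \<le> c / \<alpha> * exp (- \<alpha> * x0)" if "x0 \<le> x" "x \<le> y" for x y
  proof -
    have d: "((\<lambda>x. c / \<alpha> * exp (- \<alpha> * x)) has_real_derivative - (c * exp (- \<alpha> * s))) (at s)" for s
      using \<alpha> by (auto intro!: derivative_eq_intros)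
    have "f y + c / \<alpha> * exp (- \<alpha> * y) \<le> f x + c / \<alpha> * exp (- \<alpha> * x)"
    proof (rule DERIV_nonpos_imp_nonincreasing[OF that(2)])
      fix s assume "x \<le> s" "s \<le> y"
      then show "\<exists>k. ((\<lambda>x. f x + c / \<alpha> * exp (- \<alpha> * x)) has_real_derivative k) (at s) \<and> k \<le> 0"
        using b[of s] that(1)
        by (intro exI[of _ "f' s + - (c * exp (- \<alpha> * s))"] conjI DERIV_add f d) (auto simp: abs_le_iff)
    qed
    moreover have "f x - c / \<alpha> * exp (- \<alpha> * x) \<le> f y - c / \<alpha> * exp (- \<alpha> * y)"
    proof (rule DERIV_nonneg_imp_nondecreasing[OF that(2)])
      fix s assume "x \<le> s" "s \<le> y"
      then show "\<exists>k. ((\<lambda>x. f x - c / \<alpha> * exp (- \<alpha> * x)) has_real_derivative k) (at s) \<and> k \<ge> 0"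
        using b[of s] that(1)
        by (intro exI[of _ "f' s - - (c * exp (- \<alpha> * s))"] conjI DERIV_diff f d) (auto simp: abs_le_iff)
    qed
    moreover have "c / \<alpha> * exp (- \<alpha> * y) \<ge> 0" using c \<alpha> by simp
    moreover have "c / \<alpha> * exp (- \<alpha> * x) \<le> c / \<alpha> * exp (- \<alpha> * x0)"
      using c \<alpha> that by (intro mult_left_mono) auto
    ultimately show ?thesis by (simp only: abs_le_iff) linarith
  qed
  show ?thesis
    using main[of x y] main[of y x] xy by (cases "x \<le> y") (auto simp: abs_minus_commute)
qed

lemma cosh_powr_le_exp:
  fixes x \<alpha> :: real
  assumes "\<alpha> \<ge> 0"
  shows "cosh x powr - \<alpha> \<le> 2 powr \<alpha> * exp (- \<alpha> * x)"
proof -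
  have "exp x / 2 \<le> cosh x" by (simp add: cosh_field_def)
  then have "cosh x powr - \<alpha> \<le> (exp x / 2) powr - \<alpha>" using assms by (intro powr_mono2') auto
  also have "\<dots> = 2 powr \<alpha> * exp (- \<alpha> * x)"
    by (simp add: powr_divide powr_minus exp_powr_real exp_minus field_simps)
  finally show ?thesis .
qed

lemma exp_le_cosh_powr:
  fixes x \<alpha> :: real
  assumes "\<alpha> \<ge> 0" "x \<ge> 0"
  shows "exp (- \<alpha> * x) \<le> cosh x powr - \<alpha>"
proof -
  have "cosh x \<le> exp x" using assms by (simp add: cosh_field_def)
  then have "exp x powr - \<alpha> \<le> cosh x powr - \<alpha>" using assms by (intro powr_mono2') auto
  then show ?thesis by (simp add: exp_powr_real mult.commute)
qed

text \<open>\<open>lat\<close> is the Gudermannian function; \<open>merc\<close>, its inverse on the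
  open interval of latitudes, is the Mercator ordinate.\<close>

definition lat :: "real \<Rightarrow> real" where "lat x = arcsin (tanh x)"
definition merc :: "real \<Rightarrow> real" where "merc \<psi> = artanh (sin \<psi>)"

lemma lat_minus: "lat (- x) = - lat x"
  using abs_tanh_le_1[of x] by (simp add: lat_def arcsin_minus abs_le_iff)

lemma DERIV_lat: "(lat has_real_derivative inverse (cosh x)) (at x)"
proof -
  have "1 - (tanh x)\<^sup>2 = (inverse (cosh x))\<^sup>2" using sech_tanh_squares[of x] by simp
  then have s: "sqrt (1 - (tanh x)\<^sup>2) = inverse (cosh x)" by simp
  have t: "1 + - (tanh x * tanh x) = (inverse (cosh x))\<^sup>2"
    using sech_tanh_squares[of x] by (simp add: power2_eq_square)
  have "((\<lambda>x. arcsin (tanh x)) has_real_derivative inverse (sqrt (1 - (tanh x)\<^sup>2)) * (1 + - (tanh x * tanh x))) (at x)"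
    using tanh_real_bounds[of x] by (intro DERIV_chain2[OF DERIV_arcsin DERIV_tanh]) auto
  then show ?thesis unfolding s t lat_def[abs_def] by (simp add: power2_eq_square field_simps)
qed

lemma lat_oscillation: "x \<ge> x0 \<Longrightarrow> y \<ge> x0 \<Longrightarrow> \<bar>lat x - lat y\<bar> \<le> 2 * exp (- x0)"
proof -
  have "\<bar>inverse (cosh x)\<bar> \<le> 2 * exp (- 1 * x)" for x :: real
    using cosh_powr_le_exp[of 1 x] by (simp add: cosh_powr_m1 inverse_eq_divide)
  then show "x \<ge> x0 \<Longrightarrow> y \<ge> x0 \<Longrightarrow> ?thesis"
    using exp_decay_oscillation[of lat "\<lambda>x. inverse (cosh x)" x0 2 1 x y] DERIV_lat by simp
qed

text \<open>The Hoelder bounds make \<open>A\<close> converge at the pole; the limit must vanish, since otherwise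
  \<open>B\<close> would grow linearly, while \<open>A - tanh x * B\<close> is bounded.\<close>

lemma polar_decay:
  fixes A B q' :: "real \<Rightarrow> real"
  assumes B: "\<And>x. (B has_real_derivative A x) (at x)"
    and q: "\<And>x. ((\<lambda>x. A x - tanh x * B x) has_real_derivative q' x) (at x)"
    and q': "\<And>x. \<bar>q' x\<bar> \<le> C * cosh x powr - \<alpha>"
    and L: "\<And>x y. \<bar>(A x - 2 * tanh x * B x) - (A y - 2 * tanh y * B y)\<bar> \<le> C * \<bar>lat x - lat y\<bar> powr \<alpha>"
    and C: "C > 0" and \<alpha>: "\<alpha> > 0"
  shows "\<bar>A x\<bar> \<le> C * 2 powr \<alpha> * (2 / \<alpha> + 1) * cosh x powr - \<alpha>"
proof -
  have half: "\<bar>A x1\<bar> \<le> C * 2 powr \<alpha> * (2 / \<alpha> + 1) * exp (- \<alpha> * x1)"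
    if B: "\<And>x. (B has_real_derivative A x) (at x)"
    and q: "\<And>x. ((\<lambda>x. A x - tanh x * B x) has_real_derivative q' x) (at x)"
    and q': "\<And>x. \<bar>q' x\<bar> \<le> C * cosh x powr - \<alpha>"
    and L: "\<And>x y. \<bar>(A x - 2 * tanh x * B x) - (A y - 2 * tanh y * B y)\<bar> \<le> C * \<bar>lat x - lat y\<bar> powr \<alpha>"
    and x1: "x1 \<ge> 0" for A B q' x1
  proof (rule ccontr)
    define K1 where "K1 = C * 2 powr \<alpha> * (2 / \<alpha> + 1)"
    define Q where "Q x = A x - tanh x * B x" for x
    assume "\<not> \<bar>A x1\<bar> \<le> C * 2 powr \<alpha> * (2 / \<alpha> + 1) * exp (- \<alpha> * x1)"
    then have gt: "\<bar>A x1\<bar> > K1 * exp (- \<alpha> * x1)" by (simp add: K1_def)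
    have K1: "K1 > 0" using C \<alpha> by (simp add: K1_def add_pos_pos)
    have Qosc: "\<bar>Q x - Q y\<bar> \<le> C * 2 powr \<alpha> / \<alpha> * exp (- \<alpha> * x0)" if "x \<ge> x0" "y \<ge> x0" for x y x0
      unfolding Q_def
    proof (rule exp_decay_oscillation[OF q])
      fix x
      have "C * cosh x powr - \<alpha> \<le> C * (2 powr \<alpha> * exp (- \<alpha> * x))"
        using C \<alpha> by (intro mult_left_mono cosh_powr_le_exp) auto
      then show "\<bar>q' x\<bar> \<le> C * 2 powr \<alpha> * exp (- \<alpha> * x)" using q'[of x] by simp
    qed (use that C \<alpha> in auto)
    have Aosc: "\<bar>A x - A y\<bar> \<le> K1 * exp (- \<alpha> * x0)" if "x \<ge> x0" "y \<ge> x0" for x y x0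
    proof -
      define l where "l x = A x - 2 * tanh x * B x" for x
      have "\<bar>lat x - lat y\<bar> powr \<alpha> \<le> (2 * exp (- x0)) powr \<alpha>"
        using lat_oscillation[OF that] \<alpha> by (intro powr_mono2) auto
      also have "\<dots> = 2 powr \<alpha> * exp (- \<alpha> * x0)" by (simp add: powr_mult exp_powr_real mult.commute)
      finally have "C * \<bar>lat x - lat y\<bar> powr \<alpha> \<le> C * (2 powr \<alpha> * exp (- \<alpha> * x0))"
        using C by (intro mult_left_mono) auto
      then have 1: "\<bar>l x - l y\<bar> \<le> C * (2 powr \<alpha> * exp (- \<alpha> * x0))"
        using L[of x y] unfolding l_def by linarith
      \<comment> \<open>A is the combination of the two quantities of controlled oscillation from
        which B drops out.\<close>
      have "A x = 2 * Q x - l x" "A y = 2 * Q y - l y" by (simp_all add: Q_def l_def)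
      then have "A x - A y = 2 * (Q x - Q y) - (l x - l y)" by (simp add: algebra_simps)
      then have "\<bar>A x - A y\<bar> \<le> 2 * \<bar>Q x - Q y\<bar> + \<bar>l x - l y\<bar>"
      proof -
        have "\<bar>2 * c - d\<bar> \<le> 2 * \<bar>c\<bar> + \<bar>d\<bar>" for c d :: real by (simp add: abs_if)
        then show ?thesis using \<open>A x - A y = 2 * (Q x - Q y) - (l x - l y)\<close> by (simp only:)
      qed
      also have "\<dots> \<le> 2 * (C * 2 powr \<alpha> / \<alpha> * exp (- \<alpha> * x0)) + C * (2 powr \<alpha> * exp (- \<alpha> * x0))"
        using 1 Qosc[OF that] by (intro add_mono mult_left_mono) auto
      also have "\<dots> = K1 * exp (- \<alpha> * x0)" by (simp add: K1_def algebra_simps)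
      finally show ?thesis .
    qed
    \<comment> \<open>The excess of |A x1| over the possible oscillation of A beyond x1. From x1 on,
      A therefore keeps its sign and stays at least \<delta> in modulus.\<close>
    define \<delta> where "\<delta> = \<bar>A x1\<bar> - K1 * exp (- \<alpha> * x1)"
    have \<delta>: "\<delta> > 0" using gt by (simp add: \<delta>_def)
    define sg where "sg = sgn (A x1)"
    have "K1 * exp (- \<alpha> * x1) > 0" using K1 by simp
    then have "A x1 \<noteq> 0" using gt by auto
    then have sg: "\<bar>sg\<bar> = 1" by (auto simp: sg_def sgn_if)
    have sgA: "sg * A x1 = \<bar>A x1\<bar>" by (simp add: sg_def sgn_if)
    have sA: "sg * A y \<ge> \<delta>" if "y \<ge> x1" for y
    proof -
      have "\<bar>A y - A x1\<bar> \<le> K1 * exp (- \<alpha> * x1)" by (rule Aosc) (use that in auto)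
      moreover have "\<bar>sg * A y - sg * A x1\<bar> = \<bar>A y - A x1\<bar>"
        using sg by (simp add: right_diff_distrib[symmetric] abs_mult)
      ultimately show ?thesis using sgA by (simp add: \<delta>_def)
    qed
    have grow: "sg * B y \<ge> sg * B x1 + \<delta> * (y - x1)" if "y \<ge> x1" for y
    proof -
      have "sg * B x1 - \<delta> * x1 \<le> sg * B y - \<delta> * y"
      proof (rule DERIV_nonneg_imp_nondecreasing[OF that])
        fix s assume s: "x1 \<le> s" "s \<le> y"
        have "((\<lambda>s. sg * B s - \<delta> * s) has_real_derivative sg * A s - \<delta>) (at s)"
          by (auto intro!: derivative_eq_intros B)
        then show "\<exists>k. ((\<lambda>s. sg * B s - \<delta> * s) has_real_derivative k) (at s) \<and> 0 \<le> k"
          using sA[OF s(1)] by force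
      qed
      then show ?thesis by (simp add: algebra_simps)
    qed
    \<comment> \<open>A bound for B on y \<ge> 1, read off from tanh y B y = A y - Q y and tanh y
      \<ge> tanh 1.\<close>
    define W where "W = (\<bar>A 1\<bar> + K1 + \<bar>Q 1\<bar> + C * 2 powr \<alpha> / \<alpha>) / tanh 1"
    have t1: "tanh (1::real) > 0" by simp
    have Bb: "\<bar>B y\<bar> \<le> W" if "y \<ge> 1" for y
    proof -
      have e1: "exp (- \<alpha> * 1) \<le> 1" using \<alpha> by simp
      have "\<bar>A y - A 1\<bar> \<le> K1 * exp (- \<alpha> * 1)" by (rule Aosc) (use that in auto)
      also have "\<dots> \<le> K1 * 1" using K1 e1 by (intro mult_left_mono) auto
      finally have a: "\<bar>A y - A 1\<bar> \<le> K1" by simp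
      have "\<bar>Q y - Q 1\<bar> \<le> C * 2 powr \<alpha> / \<alpha> * exp (- \<alpha> * 1)" by (rule Qosc) (use that in auto)
      also have "\<dots> \<le> C * 2 powr \<alpha> / \<alpha> * 1" using C \<alpha> e1 by (intro mult_left_mono) auto
      finally have b: "\<bar>Q y - Q 1\<bar> \<le> C * 2 powr \<alpha> / \<alpha>" by simp
      have "tanh 1 * \<bar>B y\<bar> \<le> \<bar>tanh y * B y\<bar>"
        using that t1 by (simp add: abs_mult mult_right_mono)
      also have "tanh y * B y = A y - Q y" by (simp add: Q_def)
      also have "\<bar>A y - Q y\<bar> \<le> \<bar>A 1\<bar> + K1 + \<bar>Q 1\<bar> + C * 2 powr \<alpha> / \<alpha>" using a b by linarith
      finally show ?thesis using t1 by (simp add: W_def pos_le_divide_eq mult.commute)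
    qed
    define y where "y = max 1 x1 + (\<bar>W\<bar> + \<bar>B x1\<bar> + 1) / \<delta>"
    have y: "y \<ge> 1" "y \<ge> x1" "y - x1 \<ge> (\<bar>W\<bar> + \<bar>B x1\<bar> + 1) / \<delta>"
      using \<delta> by (auto simp: y_def add_increasing2)
    have "\<delta> * (y - x1) \<ge> \<bar>W\<bar> + \<bar>B x1\<bar> + 1" using y(3) \<delta> by (simp add: pos_divide_le_eq mult.commute)
    moreover have "\<bar>sg * B y\<bar> \<le> W" "\<bar>sg * B x1\<bar> = \<bar>B x1\<bar>" using Bb[OF y(1)] sg by (simp_all add: abs_mult)
    ultimately show False using grow[OF y(2)] by linarith
  qed
  define K1 where "K1 = C * 2 powr \<alpha> * (2 / \<alpha> + 1)"
  have K1: "K1 \<ge> 0" using C \<alpha> by (simp add: K1_def)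
  have "\<bar>A x\<bar> \<le> K1 * exp (- \<alpha> * \<bar>x\<bar>)"
  proof (cases "x \<ge> 0")
    case True
    then show ?thesis using half[OF B q q' L True] by (simp add: K1_def)
  next
    case False
    have r: "((\<lambda>x. f (- x)) has_real_derivative - f') (at x)" if "(f has_real_derivative f') (at (- x))" for f f' and x :: real
      using DERIV_mirror[of f f' x] that by simp
    \<comment> \<open>Reflection at the equator: replacing A x by A (- x) and B x by - B (- x)
      preserves all hypotheses, so one pole is reduced to the other.\<close>
    have "\<bar>A (- (- x))\<bar> \<le> C * 2 powr \<alpha> * (2 / \<alpha> + 1) * exp (- \<alpha> * - x)"
    proof (rule half[where A = "\<lambda>x. A (- x)" and B = "\<lambda>x. - B (- x)" and q' = "\<lambda>x. - q' (- x)"])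
      show "((\<lambda>x. - B (- x)) has_real_derivative A (- x)) (at x)" for x
        using DERIV_minus[OF r[OF B]] by simp
      show "((\<lambda>x. A (- x) - tanh x * - B (- x)) has_real_derivative - q' (- x)) (at x)" for x
        using r[OF q] by simp
      show "\<bar>- q' (- x)\<bar> \<le> C * cosh x powr - \<alpha>" for x using q'[of "- x"] by simp
      show "\<bar>A (- x) - 2 * tanh x * - B (- x) - (A (- y) - 2 * tanh y * - B (- y))\<bar>
           \<le> C * \<bar>lat x - lat y\<bar> powr \<alpha>" for x y
        using L[of "- x" "- y"] by (simp add: lat_minus abs_minus_commute)
    qed (use False in auto)
    then show ?thesis using False by (simp add: K1_def)
  qed
  also have "\<dots> \<le> K1 * cosh \<bar>x\<bar> powr - \<alpha>" using K1 \<alpha> by (intro mult_left_mono exp_le_cosh_powr) auto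
  finally show ?thesis by (simp add: K1_def)
qed

text \<open>The factorization D (D - 2) (D + 2) of the operator yields three first integrals: f2 - 4
  f, (f2 + 2 f1) exp (- 2 x) and (f2 - 2 f1) exp (2 x).\<close>

lemma third_order_ode:
  fixes f f1 f2 :: "real \<Rightarrow> real"
  assumes f: "\<And>x. (f has_real_derivative f1 x) (at x)" "\<And>x. (f1 has_real_derivative f2 x) (at x)"
    "\<And>x. (f2 has_real_derivative 4 * f1 x) (at x)"
  shows "f x = (f 0 - f2 0 / 4) + f2 0 / 4 * cosh (2 * x) + f1 0 / 2 * sinh (2 * x)"
proof -
  have const: "g x = g 0" if "\<And>x. (g has_real_derivative 0) (at x)" for g :: "real \<Rightarrow> real" and x
    using DERIV_isconst_all[of g x 0] that by simp
  have 1: "f2 x - 4 * f x = f2 0 - 4 * f 0"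
    by (rule const[of "\<lambda>x. f2 x - 4 * f x"]) (auto intro!: derivative_eq_intros f)
  have 2: "(f2 x + 2 * f1 x) * exp (- 2 * x) = f2 0 + 2 * f1 0"
  proof -
    have "((\<lambda>x. (f2 x + 2 * f1 x) * exp (- 2 * x)) has_real_derivative 0) (at x)" for x
      by (auto intro!: derivative_eq_intros f simp: algebra_simps)
    from const[OF this] show ?thesis by simp
  qed
  have 3: "(f2 x - 2 * f1 x) * exp (2 * x) = f2 0 - 2 * f1 0"
  proof -
    have "((\<lambda>x. (f2 x - 2 * f1 x) * exp (2 * x)) has_real_derivative 0) (at x)" for x
      by (auto intro!: derivative_eq_intros f simp: algebra_simps)
    from const[OF this] show ?thesis by simp
  qed
  have "f2 x + 2 * f1 x = (f2 x + 2 * f1 x) * exp (- 2 * x) * exp (2 * x)"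
    by (simp add: mult_exp_exp mult.assoc)
  then have 4: "f2 x + 2 * f1 x = (f2 0 + 2 * f1 0) * exp (2 * x)" unfolding 2 .
  have "f2 x - 2 * f1 x = (f2 x - 2 * f1 x) * exp (2 * x) * exp (- 2 * x)"
    by (simp add: mult_exp_exp mult.assoc)
  then have 5: "f2 x - 2 * f1 x = (f2 0 - 2 * f1 0) * exp (- 2 * x)" unfolding 3 .
  have "f2 x = f2 0 * cosh (2 * x) + 2 * f1 0 * sinh (2 * x)"
    using 4 5 unfolding cosh_field_def sinh_field_def by (simp add: field_simps)
  then show ?thesis using 1 by (simp add: field_simps)
qed

section \<open>Derivatives in latitude in terms of the cylindrical coordinate\<close>

lemma merc_facts:
  assumes "\<bar>\<psi>\<bar> < pi / 2"
  shows "tanh (merc \<psi>) = sin \<psi>" "inverse (cosh (merc \<psi>)) = cos \<psi>" "cos \<psi> > 0"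
    "tan \<psi> = sinh (merc \<psi>)" "(merc has_real_derivative cosh (merc \<psi>)) (at \<psi>)" "lat (merc \<psi>) = \<psi>"
proof -
  show c: "cos \<psi> > 0" using assms by (intro cos_gt_zero_pi) auto
  have "(sin \<psi>)\<^sup>2 < 1" using c sin_cos_squared_add[of \<psi>] by (smt (verit) zero_less_power)
  then have s: "\<bar>sin \<psi>\<bar> < 1" by (simp add: abs_square_less_1)
  show t: "tanh (merc \<psi>) = sin \<psi>"
  proof -
    define r where "r = (1 + sin \<psi>) / (1 - sin \<psi>)"
    have r: "r > 0" using s by (simp add: r_def abs_less_iff)
    have "merc \<psi> = ln (sqrt r)" using r by (simp add: merc_def artanh_def r_def ln_sqrt)
    then have "tanh (merc \<psi>) = (r - 1) / (r + 1)" using r by (simp add: tanh_ln_real)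
    moreover have "r - 1 = 2 * sin \<psi> / (1 - sin \<psi>)" "r + 1 = 2 / (1 - sin \<psi>)"
      using s by (auto simp: r_def field_simps)
    ultimately show ?thesis using s by simp
  qed
  have "(inverse (cosh (merc \<psi>)))\<^sup>2 = (cos \<psi>)\<^sup>2"
    using sech_tanh_squares[of "merc \<psi>"] sin_cos_squared_add[of \<psi>] unfolding t by linarith
  then show i: "inverse (cosh (merc \<psi>)) = cos \<psi>" using c by (simp add: power2_eq_iff_nonneg)
  then have ci: "cosh (merc \<psi>) = 1 / cos \<psi>" by (metis inverse_eq_divide inverse_inverse_eq)
  have "sinh (merc \<psi>) = tanh (merc \<psi>) * cosh (merc \<psi>)" by (simp add: tanh_def)
  then show "tan \<psi> = sinh (merc \<psi>)" by (simp add: t ci tan_def)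
  have "(merc has_real_derivative (1 / (1 - (sin \<psi>)\<^sup>2)) * cos \<psi>) (at \<psi>)"
    unfolding merc_def[abs_def] using s
    by (intro DERIV_chain2[OF artanh_real_has_field_derivative DERIV_sin]) auto
  moreover have "1 - (sin \<psi>)\<^sup>2 = (cos \<psi>)\<^sup>2" by (simp add: cos_squared_eq)
  ultimately show "(merc has_real_derivative cosh (merc \<psi>)) (at \<psi>)"
    using c by (simp add: ci power2_eq_square)
  show "lat (merc \<psi>) = \<psi>" unfolding lat_def t using assms by (intro arcsin_sin) auto
qed

lemma lat_facts: "\<bar>lat x\<bar> < pi / 2" "merc (lat x) = x" "cos (lat x) = inverse (cosh x)" "sin (lat x) = tanh x"
proof -
  have "- 1 < tanh x" "tanh x < 1" using tanh_real_bounds[of x] by auto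
  then show l: "\<bar>lat x\<bar> < pi / 2" "sin (lat x) = tanh x"
    using arcsin_lt_bounded[of "tanh x"] by (auto simp: lat_def)
  then show m: "merc (lat x) = x" by (simp add: merc_def artanh_tanh_real)
  show "cos (lat x) = inverse (cosh x)" using merc_facts(2)[OF l(1)] m by simp
qed

lemma sph_eq_cyl: "\<bar>\<psi>\<bar> < pi / 2 \<Longrightarrow> sph \<psi> \<theta> = cyl (merc \<psi>) \<theta>"
  by (simp add: sph_def cyl_def merc_facts)

lemma deriv_chart:
  assumes h: "\<And>\<psi>. \<bar>\<psi>\<bar> < pi / 2 \<Longrightarrow> h \<psi> = f (merc \<psi>)"
    and f: "\<And>x. (f has_real_derivative f' x) (at x)"
    and \<psi>: "\<bar>\<psi>\<bar> < pi / 2"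
  shows "deriv h \<psi> = cosh (merc \<psi>) * f' (merc \<psi>)"
proof (rule DERIV_imp_deriv)
  have "((\<lambda>\<psi>. f (merc \<psi>)) has_real_derivative f' (merc \<psi>) * cosh (merc \<psi>)) (at \<psi>)"
    by (rule DERIV_chain2[OF f merc_facts(5)[OF \<psi>]])
  then show "(h has_real_derivative cosh (merc \<psi>) * f' (merc \<psi>)) (at \<psi>)"
    by (rule has_field_derivative_transform_within_open[where S = "{- pi / 2<..<pi / 2}", THEN back_subst[of "\<lambda>d. (h has_real_derivative d) (at \<psi>)"]])
      (use \<psi> h in \<open>auto simp: abs_less_iff mult.commute\<close>)
qed

lemma deriv2_chart:
  assumes h: "\<And>\<psi>. \<bar>\<psi>\<bar> < pi / 2 \<Longrightarrow> h \<psi> = f (merc \<psi>)"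
    and f: "\<And>x. (f has_real_derivative f' x) (at x)" and f': "\<And>x. (f' has_real_derivative f'' x) (at x)"
    and \<psi>: "\<bar>\<psi>\<bar> < pi / 2"
  shows "(deriv ^^ 2) h \<psi> = cosh (merc \<psi>) * (sinh (merc \<psi>) * f' (merc \<psi>) + cosh (merc \<psi>) * f'' (merc \<psi>))"
proof -
  have "deriv (deriv h) \<psi> = cosh (merc \<psi>) * (sinh (merc \<psi>) * f' (merc \<psi>) + cosh (merc \<psi>) * f'' (merc \<psi>))"
    by (rule deriv_chart[where f = "\<lambda>x. cosh x * f' x"
          and f' = "\<lambda>x. sinh x * f' x + cosh x * f'' x", OF deriv_chart[where f = f and f' = f']])
      (use \<psi> in \<open>auto intro!: derivative_eq_intros h f f'\<close>)
  then show ?thesis by (simp add: numeral_2_eq_2)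
qed

lemma deriv3_chart:
  assumes h: "\<And>\<psi>. \<bar>\<psi>\<bar> < pi / 2 \<Longrightarrow> h \<psi> = f (merc \<psi>)"
    and f: "\<And>x. (f has_real_derivative f' x) (at x)" and f': "\<And>x. (f' has_real_derivative f'' x) (at x)"
    and q: "\<And>x. ((\<lambda>x. cosh x * (sinh x * f' x + cosh x * f'' x)) has_real_derivative q' x) (at x)"
    and \<psi>: "\<bar>\<psi>\<bar> < pi / 2"
  shows "(deriv ^^ 3) h \<psi> = cosh (merc \<psi>) * q' (merc \<psi>)"
proof -
  have "deriv ((deriv ^^ 2) h) \<psi> = cosh (merc \<psi>) * q' (merc \<psi>)"
    by (rule deriv_chart[where f = "\<lambda>x. cosh x * (sinh x * f' x + cosh x * f'' x)" and f' = q',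
          OF deriv2_chart[where f = f and f' = f' and f'' = f'']])
      (use \<psi> in \<open>auto intro!: h f f' q\<close>)
  then show ?thesis by (simp add: numeral_3_eq_3 numeral_2_eq_2)
qed

text \<open>In dimension two a conformal change of metric only rescales the Laplacian. Concretely,
  d/d\<psi> = cosh x d/dx and tan \<psi> = sinh x make the first-order terms cancel.\<close>

lemma laplacian_chart:
  assumes f: "tempered n f" and t: "t < 0"
    and g: "\<And>\<psi> \<theta>. \<bar>\<psi>\<bar> < pi / 2 \<Longrightarrow> g \<psi> \<theta> = f (merc \<psi>) \<theta> t"
    and \<psi>: "\<bar>\<psi>\<bar> < pi / 2"
  shows "laplacian_S2 g \<psi> \<theta> = (cosh (merc \<psi>))\<^sup>2 * (Dx (Dx f) (merc \<psi>) \<theta> t + Dy (Dy f) (merc \<psi>) \<theta> t)"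
proof -
  note d = tempered_D[OF f]
  note dx = tempered_D[OF d(1)] and dy = tempered_D[OF d(2)]
  have 1: "deriv (\<lambda>y. g y \<theta>) \<psi> = cosh (merc \<psi>) * Dx f (merc \<psi>) \<theta> t"
    by (rule deriv_chart[OF _ d(4)[OF t] \<psi>]) (rule g)
  have 2: "(deriv ^^ 2) (\<lambda>y. g y \<theta>) \<psi> = cosh (merc \<psi>) * (sinh (merc \<psi>) * Dx f (merc \<psi>) \<theta> t
      + cosh (merc \<psi>) * Dx (Dx f) (merc \<psi>) \<theta> t)"
    by (rule deriv2_chart[OF _ d(4)[OF t] dx(4)[OF t] \<psi>]) (rule g)
  have "deriv (g \<psi>) = (\<lambda>y. Dy f (merc \<psi>) y t)"
    using g[OF \<psi>] by (auto simp: Dy_def fun_eq_iff intro!: arg_cong2[where f = deriv])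
  then have 3: "(deriv ^^ 2) (\<lambda>y. g \<psi> y) \<theta> = Dy (Dy f) (merc \<psi>) \<theta> t"
    by (simp add: numeral_2_eq_2 Dy_def)
  have "(1 / cos \<psi>)\<^sup>2 = (cosh (merc \<psi>))\<^sup>2"
    using merc_facts(2)[OF \<psi>] by (metis inverse_eq_divide inverse_inverse_eq)
  then show ?thesis unfolding laplacian_S2_def 1 2 3 merc_facts(4)[OF \<psi>]
    by (simp add: algebra_simps power2_eq_square)
qed

section \<open>The flow in cylindrical coordinates\<close>

lemma Dx_cong: "(\<And>s. f s y t = g s y t) \<Longrightarrow> Dx f x y t = Dx g x y t"
  by (simp add: Dx_def)
lemma Dy_cong: "(\<And>s. f x s t = g x s t) \<Longrightarrow> Dy f x y t = Dy g x y t"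
  by (simp add: Dy_def)
lemma Dt_cong:
  assumes "\<And>s. s < 0 \<Longrightarrow> f x y s = g x y s" "t < 0"
  shows "Dt f x y t = Dt g x y t"
  unfolding Dt_def
proof (rule deriv_cong_ev)
  show "\<forall>\<^sub>F s in nhds t. f x y s = g x y s"
    using eventually_nhds_in_open[of "{..<0}" t] assms by (auto elim!: eventually_mono)
qed simp

lemma tempered_commute2:
  assumes f: "tempered n f" and t: "t < 0"
  shows "Dt (Dx (Dx f)) x y t = Dx (Dx (Dt f)) x y t" "Dt (Dy (Dy f)) x y t = Dy (Dy (Dt f)) x y t"
    "Dy (Dx (Dx f)) x y t = Dx (Dx (Dy f)) x y t"
proof -
  note d = tempered_D[OF f]
  have "Dt (Dx (Dx f)) x y t = Dx (Dt (Dx f)) x y t" by (rule tempered_commute(1)[OF d(1) t, symmetric])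
  also have "\<dots> = Dx (Dx (Dt f)) x y t" by (rule Dx_cong) (rule tempered_commute(1)[OF f t, symmetric])
  finally show "Dt (Dx (Dx f)) x y t = Dx (Dx (Dt f)) x y t" .
  have "Dt (Dy (Dy f)) x y t = Dy (Dt (Dy f)) x y t" by (rule tempered_commute(2)[OF d(2) t, symmetric])
  also have "\<dots> = Dy (Dy (Dt f)) x y t" by (rule Dy_cong) (rule tempered_commute(2)[OF f t, symmetric])
  finally show "Dt (Dy (Dy f)) x y t = Dy (Dy (Dt f)) x y t" .
  have "Dy (Dx (Dx f)) x y t = Dx (Dy (Dx f)) x y t" by (rule tempered_commute(3)[OF d(1) t, symmetric])
  also have "\<dots> = Dx (Dx (Dy f)) x y t" by (rule Dx_cong) (rule tempered_commute(3)[OF f t, symmetric])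
  finally show "Dy (Dx (Dx f)) x y t = Dx (Dx (Dy f)) x y t" .
qed

lemma periodic_D:
  assumes "\<And>x y t. f x (y + p) t = f x y t"
  shows "Dx f x (y + p) t = Dx f x y t" "Dy f x (y + p) t = Dy f x y t" "Dt f x (y + p) t = Dt f x y t"
proof -
  show "Dx f x (y + p) t = Dx f x y t" "Dt f x (y + p) t = Dt f x y t"
    using assms by (simp_all add: Dx_def Dt_def)
  have "Dy f x (y + p) t = deriv (\<lambda>s. f x (s + p) t) y"
    unfolding Dy_def deriv_def DERIV_shift ..
  then show "Dy f x (y + p) t = Dy f x y t" by (simp add: assms Dy_def)
qed

lemma D_minus:
  assumes f: "tempered n f" and t: "t < 0"
  shows "Dx (\<lambda>x y t. - f x y t) x y t = - Dx f x y t" "Dy (\<lambda>x y t. - f x y t) x y t = - Dy f x y t"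
    "Dt (\<lambda>x y t. - f x y t) x y t = - Dt f x y t"
  unfolding Dx_def[of "\<lambda>x y t. - f x y t"] Dy_def[of "\<lambda>x y t. - f x y t"] Dt_def[of "\<lambda>x y t. - f x y t"]
  by (rule DERIV_imp_deriv DERIV_minus tempered_D[OF f] t)+

lemma D2_minus:
  assumes f: "tempered n f" and t: "t < 0"
  shows "Dx (Dx (\<lambda>x y t. - f x y t)) x y t = - Dx (Dx f) x y t"
    "Dy (Dy (\<lambda>x y t. - f x y t)) x y t = - Dy (Dy f) x y t"
proof -
  have "Dx (Dx (\<lambda>x y t. - f x y t)) x y t = Dx (\<lambda>x y t. - Dx f x y t) x y t"
    by (rule Dx_cong) (rule D_minus[OF f t])
  then show "Dx (Dx (\<lambda>x y t. - f x y t)) x y t = - Dx (Dx f) x y t"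
    unfolding D_minus[OF tempered_D(1)[OF f] t] .
  have "Dy (Dy (\<lambda>x y t. - f x y t)) x y t = Dy (\<lambda>x y t. - Dy f x y t) x y t"
    by (rule Dy_cong) (rule D_minus[OF f t])
  then show "Dy (Dy (\<lambda>x y t. - f x y t)) x y t = - Dy (Dy f) x y t"
    unfolding D_minus[OF tempered_D(2)[OF f] t] .
qed

text \<open>Two constants of motion, d / b and a^2 - b^2 + d^2, the second being c^2 by the backward
  limit, reduce the system to a' = 4 (a^2 - c^2). The Moebius transform y = (a - c) / (a + c) makes
  this linear: y' = 8 c y.\<close>

lemma rosenau_ode:
  fixes a b d :: "real \<Rightarrow> real"
  assumes a: "\<And>t. t < 0 \<Longrightarrow> (a has_real_derivative 4 * ((b t)\<^sup>2 - (d t)\<^sup>2)) (at t)"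
    and b: "\<And>t. t < 0 \<Longrightarrow> (b has_real_derivative 4 * a t * b t) (at t)"
    and d: "\<And>t. t < 0 \<Longrightarrow> (d has_real_derivative 4 * a t * d t) (at t)"
    and bd: "\<And>t. t < 0 \<Longrightarrow> \<bar>d t\<bar> < b t"
    and lim: "(a \<longlongrightarrow> c) at_bot" "(b \<longlongrightarrow> 0) at_bot" "(d \<longlongrightarrow> 0) at_bot" and c: "c > 0"
  obtains \<kappa> y0 where "\<bar>\<kappa>\<bar> < 1" "0 < y0" "y0 \<le> 1"
    "\<And>t. t < 0 \<Longrightarrow> d t = \<kappa> * b t" "\<And>t. t < 0 \<Longrightarrow> (b t)\<^sup>2 - (d t)\<^sup>2 = (a t)\<^sup>2 - c\<^sup>2"
    "\<And>t. t < 0 \<Longrightarrow> a t = c * (1 + y0 * exp (8 * c * t)) / (1 - y0 * exp (8 * c * t))"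
proof -
  have const: "\<exists>k. \<forall>t\<in>{..<0::real}. g t = k" if "\<And>t. t < 0 \<Longrightarrow> (g has_real_derivative 0) (at t)" for g
    by (rule has_field_derivative_zero_constant) (auto intro!: has_field_derivative_at_within that)
  have b0: "b t > 0" if "t < 0" for t using bd[OF that] by linarith
  have "\<exists>k. \<forall>t\<in>{..<0}. d t / b t = k"
  proof (rule const)
    fix t :: real assume t: "t < 0"
    show "((\<lambda>t. d t / b t) has_real_derivative 0) (at t)"
      using DERIV_divide[OF d[OF t] b[OF t]] b0[OF t] by (simp add: mult_ac)
  qed
  then obtain \<kappa> where \<kappa>: "\<forall>t\<in>{..<0}. d t / b t = \<kappa>" ..
  have d\<kappa>: "d t = \<kappa> * b t" if "t < 0" for t using bspec[OF \<kappa>, of t] b0[OF that] that by (simp add: field_simps)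
  have \<kappa>1: "\<bar>\<kappa>\<bar> < 1"
  proof -
    have "\<bar>\<kappa>\<bar> * b (-1) < 1 * b (-1)" using bd[of "-1"] b0[of "-1"] by (simp add: d\<kappa> abs_mult)
    then show ?thesis using b0[of "-1"] by (simp only: mult_less_cancel_right) auto
  qed
  have "\<exists>k. \<forall>t\<in>{..<0}. (a t)\<^sup>2 - (b t)\<^sup>2 + (d t)\<^sup>2 = k"
  proof (rule const)
    fix t :: real assume t: "t < 0"
    show "((\<lambda>t. (a t)\<^sup>2 - (b t)\<^sup>2 + (d t)\<^sup>2) has_real_derivative 0) (at t)"
      by (auto intro!: derivative_eq_intros a[OF t] b[OF t] d[OF t] simp: power2_eq_square algebra_simps)
  qed
  then obtain k where k: "\<forall>t\<in>{..<0}. (a t)\<^sup>2 - (b t)\<^sup>2 + (d t)\<^sup>2 = k" ..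
  have "((\<lambda>t. (a t)\<^sup>2 - (b t)\<^sup>2 + (d t)\<^sup>2) \<longlongrightarrow> c\<^sup>2 - 0\<^sup>2 + 0\<^sup>2) at_bot"
    by (intro tendsto_intros lim)
  moreover have "((\<lambda>t. (a t)\<^sup>2 - (b t)\<^sup>2 + (d t)\<^sup>2) \<longlongrightarrow> k) at_bot"
  proof (rule tendsto_eventually)
    show "\<forall>\<^sub>F t in at_bot. (a t)\<^sup>2 - (b t)\<^sup>2 + (d t)\<^sup>2 = k"
      using eventually_gt_at_bot[of "0::real"] k
      by (auto simp: eventually_at_bot_dense)
  qed
  ultimately have "k = c\<^sup>2" using tendsto_unique[OF trivial_limit_at_bot_linorder] by fastforce
  then have cons: "(b t)\<^sup>2 - (d t)\<^sup>2 = (a t)\<^sup>2 - c\<^sup>2" if "t < 0" for t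
    using bspec[OF k, of t] that by simp
  have bd2: "(b t)\<^sup>2 - (d t)\<^sup>2 > 0" if "t < 0" for t
    using power_strict_mono[OF bd[OF that], of 2] by simp
  \<comment> \<open>a increases because |d| < b, so it lies above its backward limit c; equality
    would force b^2 = d^2.\<close>
  have ac: "a t > c" if t: "t < 0" for t
  proof -
    have "c \<le> a t"
    proof (rule tendsto_upperbound[OF lim(1)])
      have "a s \<le> a t" if "s \<le> t" for s
      proof (rule DERIV_nonneg_imp_nondecreasing[OF that])
        fix r assume "s \<le> r" "r \<le> t"
        then show "\<exists>y. (a has_real_derivative y) (at r) \<and> 0 \<le> y"
          using a[of r] bd2[of r] t by (intro exI[of _ "4 * ((b r)\<^sup>2 - (d r)\<^sup>2)"]) auto
      qed
      then show "\<forall>\<^sub>F s in at_bot. a s \<le> a t" by (auto simp: eventually_at_bot_linorder)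
    qed simp
    moreover have "a t \<noteq> c" using cons[OF t] bd2[OF t] by auto
    ultimately show ?thesis by simp
  qed
  define y where "y t = (a t - c) / (a t + c)" for t
  have "\<exists>k. \<forall>t\<in>{..<0}. y t * exp (- 8 * c * t) = k"
  proof (rule const)
    fix t :: real assume t: "t < 0"
    have p: "a t + c > 0" using ac[OF t] c by simp
    have a': "(a has_real_derivative 4 * ((a t)\<^sup>2 - c\<^sup>2)) (at t)" using a[OF t] cons[OF t] by simp
    have "((\<lambda>t. (a t - c) / (a t + c)) has_real_derivative 8 * c * y t) (at t)"
    proof -
      have "((\<lambda>t. (a t - c) / (a t + c)) has_real_derivative
        (4 * ((a t)\<^sup>2 - c\<^sup>2) * (a t + c) - (a t - c) * (4 * ((a t)\<^sup>2 - c\<^sup>2))) / ((a t + c) * (a t + c))) (at t)"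
        by (rule DERIV_divide) (use p in \<open>auto intro!: derivative_eq_intros a'\<close>)
      moreover have "(4 * ((a t)\<^sup>2 - c\<^sup>2) * (a t + c) - (a t - c) * (4 * ((a t)\<^sup>2 - c\<^sup>2))) / ((a t + c) * (a t + c))
          = 8 * c * y t"
      proof -
        have "4 * ((a t)\<^sup>2 - c\<^sup>2) * (a t + c) - (a t - c) * (4 * ((a t)\<^sup>2 - c\<^sup>2)) = 8 * c * (a t - c) * (a t + c)"
          by (simp add: power2_eq_square algebra_simps)
        then show ?thesis using p by (simp add: y_def)
      qed
      ultimately show ?thesis by simp
    qed
    then have "(y has_real_derivative 8 * c * y t) (at t)" by (simp add: y_def[abs_def])
    then show "((\<lambda>t. y t * exp (- 8 * c * t)) has_real_derivative 0) (at t)"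
      by (auto intro!: derivative_eq_intros)
  qed
  then obtain y0 where y0: "\<forall>t\<in>{..<0}. y t * exp (- 8 * c * t) = y0" ..
  have yy: "y t = y0 * exp (8 * c * t)" if "t < 0" for t
  proof -
    have "exp (- 8 * c * t) * exp (8 * c * t) = 1" by (simp add: exp_minus)
    then have "y t = y t * exp (- 8 * c * t) * exp (8 * c * t)" by (simp only: mult.assoc mult_1_right)
    also have "y t * exp (- 8 * c * t) = y0" using y0 that by blast
    finally show ?thesis .
  qed
  have y1: "0 < y t" "y t < 1" if "t < 0" for t
    using ac[OF that] c by (simp_all add: y_def)
  have y0p: "y0 > 0" using y1(1)[of "-1"] yy[of "-1"] by (simp add: zero_less_mult_iff)
  have y01: "y0 \<le> 1"
  proof (rule ccontr)
    assume gt: "\<not> y0 \<le> 1"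
    \<comment> \<open>If y0 > 1 this is a negative time at which y would equal 1, although y < 1 for
      all t < 0.\<close>
    define t where "t = - ln y0 / (8 * c)"
    have t: "t < 0" using gt c by (simp add: t_def divide_neg_pos)
    have "8 * c * t = - ln y0" using c by (simp add: t_def)
    then have "y t = 1" using yy[OF t] y0p by (simp add: exp_minus)
    then show False using y1(2)[OF t] by simp
  qed
  show thesis
  proof (rule that[OF \<kappa>1 y0p y01 d\<kappa> cons])
    fix t :: real assume t: "t < 0"
    have "a t = c * (1 + y t) / (1 - y t)"
    proof -
      have p: "a t + c > 0" using ac[OF t] c by simp
      have "1 + y t = 2 * a t / (a t + c)" "1 - y t = 2 * c / (a t + c)"
        using p by (auto simp: y_def field_simps)
      then show ?thesis using p c by simp
    qed
    then show "a t = c * (1 + y0 * exp (8 * c * t)) / (1 - y0 * exp (8 * c * t))"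
      by (simp add: yy[OF t])
  qed
qed

text \<open>In the coordinate \<open>x\<close> with \<open>tanh x = sin \<psi>\<close>, the metric is \<open>(dx\<^sup>2 + dy\<^sup>2) / V\<close> with
  \<open>V = (cosh x)\<^sup>2 exp l\<close>, and \<open>Dt l\<close> is its scalar curvature.\<close>

locale cylinder_flow =
  fixes l :: "real \<Rightarrow> real \<Rightarrow> real \<Rightarrow> real" and C0 :: real
  assumes tl: "tempered 0 l" and tlx: "tempered (-1) (Dx l)" and tly: "tempered (-1) (Dy l)"
    and per: "\<And>x y t. l x (y + 2 * pi) t = l x y t"
    and pde: "\<And>x y t. t < 0 \<Longrightarrow>
      Dt l x y t = exp (l x y t) * ((cosh x)\<^sup>2 * (Dx (Dx l) x y t + Dy (Dy l) x y t) + 2)"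
    and C0: "C0 > 0"
    and lim: "\<And>x y. ((\<lambda>t. exp (l x y t)) \<longlongrightarrow> C0 / (cosh x)\<^sup>2) at_bot"
begin

definition v where "v x y t = exp (l x y t)"
definition V where "V x y t = (cosh x)\<^sup>2 * v x y t"

lemmas dl = tempered_D[OF tl]
lemmas dlx = tempered_D[OF dl(1)]
lemmas dly = tempered_D[OF dl(2)]
lemmas dlt = tempered_D[OF dl(3)]

lemma tempered_v: "tempered 0 v"
  unfolding v_def[abs_def] by (rule tempered_exp[OF tl])

lemma tempered_cosh_square: "tempered 2 (\<lambda>x y t. (cosh x)\<^sup>2)"
  using tempered_mult[OF tempered_cosh tempered_cosh] by (simp add: power2_eq_square)

lemma tempered_V: "tempered 2 V"
  unfolding V_def[abs_def] using tempered_mult[OF tempered_cosh_square tempered_v] by simp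

lemma v_pos: "v x y t > 0" by (simp add: v_def)
lemma V_pos: "V x y t > 0" using v_pos by (simp add: V_def)

text \<open>V times the flat Laplacian is the Laplacian of the evolving metric and
  \<open>Dt l\<close> is its scalar curvature R, so this is the law R_t = Laplacian of R + R^2 for
  surfaces under Ricci flow. It arises from \<open>pde\<close> by differentiation in time; the
  derivative of the factor exp l produces the square.\<close>

lemma scalar_evolution:
  assumes t: "t < 0"
  shows "Dt (Dt l) x y t = (Dt l x y t)\<^sup>2 + V x y t * (Dx (Dx (Dt l)) x y t + Dy (Dy (Dt l)) x y t)"
proof -
  have "((\<lambda>t. exp (l x y t) * ((cosh x)\<^sup>2 * (Dx (Dx l) x y t + Dy (Dy l) x y t) + 2)) has_real_derivative
      exp (l x y t) * Dt l x y t * ((cosh x)\<^sup>2 * (Dx (Dx l) x y t + Dy (Dy l) x y t) + 2)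
      + ((cosh x)\<^sup>2 * (Dt (Dx (Dx l)) x y t + Dt (Dy (Dy l)) x y t)) * exp (l x y t)) (at t)"
    by (auto intro!: derivative_eq_intros dl(6)[OF t] tempered_D(6)[OF dlx(1) t] tempered_D(6)[OF dly(2) t])
  then have "(Dt l x y has_real_derivative
      exp (l x y t) * Dt l x y t * ((cosh x)\<^sup>2 * (Dx (Dx l) x y t + Dy (Dy l) x y t) + 2)
      + ((cosh x)\<^sup>2 * (Dt (Dx (Dx l)) x y t + Dt (Dy (Dy l)) x y t)) * exp (l x y t)) (at t)"
    by (rule has_field_derivative_transform_within_open[of _ _ _ "{..<0}"]) (use t pde in auto)
  then have "Dt (Dt l) x y t = exp (l x y t) * Dt l x y t * ((cosh x)\<^sup>2 * (Dx (Dx l) x y t + Dy (Dy l) x y t) + 2)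
      + ((cosh x)\<^sup>2 * (Dt (Dx (Dx l)) x y t + Dt (Dy (Dy l)) x y t)) * exp (l x y t)"
    using DERIV_unique dlt(6)[OF t] by blast
  also have "\<dots> = Dt l x y t * Dt l x y t + V x y t * (Dt (Dx (Dx l)) x y t + Dt (Dy (Dy l)) x y t)"
    using pde[OF t, of x y] by (simp add: V_def v_def mult_ac)
  finally show ?thesis unfolding tempered_commute2(1,2)[OF tl t] by (simp add: power2_eq_square)
qed

lemma Dt_l_nonneg: "t < 0 \<Longrightarrow> Dt l x y t \<ge> 0"
  by (rule reaction_diffusion_nonneg[OF dl(3) _ tempered_V _ scalar_evolution])
    (auto intro!: periodic_D per less_imp_le V_pos)

lemma v_mono: "s \<le> t \<Longrightarrow> t < 0 \<Longrightarrow> v x y s \<le> v x y t"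
proof -
  assume st: "s \<le> t" "t < 0"
  have "l x y s \<le> l x y t"
  proof (rule DERIV_nonneg_imp_nondecreasing[OF st(1)])
    fix r assume "s \<le> r" "r \<le> t"
    then have "r < 0" using st by simp
    then show "\<exists>k. (l x y has_real_derivative k) (at r) \<and> 0 \<le> k"
      using dl(6)[of r] Dt_l_nonneg[of r] by blast
  qed
  then show ?thesis by (simp add: v_def)
qed

lemma V_ge: assumes t: "t < 0" shows "C0 \<le> V x y t"
proof -
  have "C0 / (cosh x)\<^sup>2 \<le> v x y t"
    by (rule tendsto_upperbound[OF lim[of x y, folded v_def]])
      (auto simp: eventually_at_bot_linorder intro!: exI[of _ t] v_mono t)
  then show ?thesis by (simp add: V_def pos_divide_le_eq mult.commute)
qed

text \<open>With U = 1 / V and w = (log U)_y = - l_y this is an instance of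
  \<open>oleinik_rigidity\<close>. The assumed bound gives (Dy U)^2 \<le> C V^(a - 3) (cosh x)^(- 2
  a): a < 3 together with V \<ge> C0 bounds the power of V, and a > 0 leaves an integrable power of
  cosh x, with \<gamma> = 2 a.\<close>

lemma axially_symmetric:
  assumes bound: "\<And>x y t. t \<le> t0 \<Longrightarrow> (Dy v x y t)\<^sup>2 \<le> C * v x y t powr (1 + a) * (inverse (cosh x))\<^sup>2"
    and t0: "t0 < 0" and a: "0 < a" "a < 3" and t: "t < 0" and C: "C > 0"
  shows "Dy l x y t = 0"
proof -
  define w where "w x y t = - Dy l x y t" for x y t
  define U where "U x y t = (inverse (cosh x))\<^sup>2 * exp (- l x y t)" for x y t
  have tw: "tempered (-1) w" unfolding w_def[abs_def] by (rule tempered_minus[OF tly])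
  have te: "tempered 0 (\<lambda>x y t. exp (- l x y t))" by (rule tempered_exp[OF tempered_minus[OF tl]])
  have "tempered (-2) U" unfolding U_def[abs_def]
    using tempered_mult[OF tempered_mult[OF tempered_sech tempered_sech] te] by (simp add: power2_eq_square)
  then have tU: "tempered 0 U" by (rule tempered_mono) simp
  have UV: "U x y t * V x y t = 1" for x y t
    by (simp add: U_def V_def v_def exp_minus field_simps)
  have Uy: "Dy U x y t = w x y t * U x y t" if "t < 0" for x y t
  proof -
    have "((\<lambda>y. U x y t) has_real_derivative w x y t * U x y t) (at y)"
      unfolding U_def w_def by (auto intro!: derivative_eq_intros dl(5)[OF that])
    then show ?thesis unfolding Dy_def by (rule DERIV_imp_deriv)
  qed
  have Ut: "Dt U x y t = - (Dx (Dx l) x y t + Dy (Dy l) x y t) - 2 * (inverse (cosh x))\<^sup>2" if "t < 0" for x y t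
  proof -
    have "((\<lambda>t. U x y t) has_real_derivative (inverse (cosh x))\<^sup>2 * (exp (- l x y t) * - Dt l x y t)) (at t)"
      unfolding U_def by (auto intro!: derivative_eq_intros dl(6)[OF that])
    then have "Dt U x y t = (inverse (cosh x))\<^sup>2 * (exp (- l x y t) * - Dt l x y t)"
      unfolding Dt_def by (rule DERIV_imp_deriv)
    also have "exp (- l x y t) * - Dt l x y t = - ((cosh x)\<^sup>2 * (Dx (Dx l) x y t + Dy (Dy l) x y t) + 2)"
    proof -
      have e: "exp (- l x y t) * exp (l x y t) = 1" by (simp add: exp_minus)
      show ?thesis unfolding pde[OF that] by (simp only: mult_minus_right mult.assoc[symmetric] e mult_1_left)
    qed
    also have "(inverse (cosh x))\<^sup>2 * \<dots> = - (Dx (Dx l) x y t + Dy (Dy l) x y t) - 2 * (inverse (cosh x))\<^sup>2"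
    proof -
      have "(inverse (cosh x))\<^sup>2 * (cosh x)\<^sup>2 = 1" by (simp add: power_inverse)
      moreover have "i * - (c * z + 2) = - ((i * c) * z) - 2 * i" for i c z :: real
        by (simp add: algebra_simps)
      ultimately show ?thesis by (simp only: mult_1_left)
    qed
    finally show ?thesis .
  qed
  have wxx: "Dx (Dx w) x y t = - Dx (Dx (Dy l)) x y t" "Dy (Dy w) x y t = - Dy (Dy (Dy l)) x y t"
    if "t < 0" for x y t
    unfolding w_def[abs_def] by (rule D2_minus[OF dl(2) that])+
  have eq: "Dt (Dy U) x y t = Dx (Dx w) x y t + Dy (Dy w) x y t" if t: "t < 0" for x y t
  proof -
    have "Dt (Dy U) x y t = Dy (Dt U) x y t" by (rule tempered_commute(2)[OF tU t, symmetric])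
    also have "\<dots> = Dy (\<lambda>x y t. - (Dx (Dx l) x y t + Dy (Dy l) x y t) - 2 * (inverse (cosh x))\<^sup>2) x y t"
      by (rule Dy_cong) (rule Ut[OF t])
    also have "\<dots> = - (Dy (Dx (Dx l)) x y t + Dy (Dy (Dy l)) x y t)"
      unfolding Dy_def[of "\<lambda>x y t. - (Dx (Dx l) x y t + Dy (Dy l) x y t) - 2 * (inverse (cosh x))\<^sup>2"]
      by (rule DERIV_imp_deriv)
        (auto intro!: derivative_eq_intros tempered_D(5)[OF dlx(1) t] tempered_D(5)[OF dly(2) t])
    finally show ?thesis by (simp add: wxx[OF t] tempered_commute2(3)[OF tl t])
  qed
  have perw: "w x (y + 2 * pi) t = w x y t" for x y t using periodic_D(2)[of l "2 * pi"] per by (simp add: w_def)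
  have U0: "U x y t > 0" for x y t by (simp add: U_def)
  have Ule: "C0 * U x y t \<le> 1" if "t < 0" for x y t
    using mult_right_mono[OF V_ge[OF that, of x y], of "U x y t"] U0[of x y t] UV[of x y t]
    by (simp add: mult.commute)
  have perwy: "Dy w x (y + 2 * pi) t = Dy w x y t" for x y t
    using periodic_D(2)[of w "2 * pi"] perw by blast
  have "w x y t = 0"
  proof (rule oleinik_rigidity[OF tw tU Uy eq _ perw perwy U0 Ule C0 _ _ t0 t])
    show "U x (y + 2 * pi) t = U x y t" for x y t by (simp add: U_def per)
    show "2 * a > 0" using a by simp
    fix x y t assume tt: "t \<le> t0"
    then have t: "t < 0" using t0 by simp
    have vV: "v x y t = V x y t * cosh x powr -2" by (simp add: V_def powr_minus)
    have vy: "Dy v x y t = v x y t * Dy l x y t"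
      unfolding Dy_def[of v] v_def by (rule DERIV_imp_deriv) (auto intro!: derivative_eq_intros dl(5)[OF t])
    have Uv: "U x y t = (inverse (cosh x))\<^sup>2 * inverse (v x y t)" by (simp add: U_def v_def exp_minus)
    have "Dy U x y t = - ((inverse (cosh x))\<^sup>2 * Dy v x y t * (inverse (v x y t))\<^sup>2)"
      using v_pos[of x y t] by (simp add: Uy[OF t] w_def vy Uv field_simps power2_eq_square)
    then have "(Dy U x y t)\<^sup>2 = (Dy v x y t)\<^sup>2 * (inverse (cosh x) ^ 4 * inverse (v x y t) ^ 4)"
      by (simp add: power_mult_distrib mult_ac)
    also have "\<dots> \<le> (C * v x y t powr (1 + a) * (inverse (cosh x))\<^sup>2) * (inverse (cosh x) ^ 4 * inverse (v x y t) ^ 4)"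
      using v_pos[of x y t] by (intro mult_right_mono bound[OF tt]) (auto intro: less_imp_le)
    also have "inverse (v x y t) ^ 4 = v x y t powr -4"
      using v_pos[of x y t] by (simp add: powr_minus power_inverse)
    also have "(C * v x y t powr (1 + a) * (inverse (cosh x))\<^sup>2) * (inverse (cosh x) ^ 4 * v x y t powr -4)
        = C * v x y t powr (a - 3) * inverse (cosh x) ^ 6"
    proof -
      have "v x y t powr (a - 3) = v x y t powr (1 + a) * v x y t powr -4" by (simp add: powr_add[symmetric])
      moreover have "inverse (cosh x) ^ 6 = (inverse (cosh x))\<^sup>2 * inverse (cosh x) ^ 4"
        by (simp add: power_add[symmetric])
      ultimately show ?thesis by (simp only: mult_ac)
    qed
    also have "\<dots> = C * V x y t powr (a - 3) * cosh x powr - (2 * a)"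
    proof -
      have "v x y t powr (a - 3) = V x y t powr (a - 3) * cosh x powr (-2 * (a - 3))"
        unfolding vV using V_pos[of x y t] by (simp add: powr_mult powr_powr)
      moreover have "inverse (cosh x) ^ 6 = cosh x powr -6" by (simp add: powr_minus power_inverse)
      moreover have "cosh x powr (-2 * (a - 3)) * cosh x powr -6 = cosh x powr - (2 * a)"
        by (simp add: powr_add[symmetric])
      ultimately show ?thesis by (simp only: mult.assoc)
    qed
    also have "\<dots> \<le> C * C0 powr (a - 3) * cosh x powr - (2 * a)"
      using C0 V_ge[OF t, of x y] a C by (intro mult_right_mono mult_left_mono powr_mono2') auto
    finally show "(Dy U x y t)\<^sup>2 \<le> C * C0 powr (a - 3) * cosh x powr - (2 * a)" .
  qed
  then show ?thesis by (simp add: w_def)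
qed


section \<open>The quantity \<open>G\<close> and its decay at the poles\<close>

lemmas dv = tempered_D[OF tempered_v]
lemmas dvx = tempered_D[OF dv(1)]
lemmas dvxx = tempered_D[OF dvx(1)]
lemmas dV = tempered_D[OF tempered_V]
lemmas dV1 = tempered_D[OF dV(1)]
lemmas dV2 = tempered_D[OF dV1(1)]
lemmas dV3 = tempered_D[OF dV2(1)]
lemmas dV4 = tempered_D[OF dV3(1)]

text \<open>\<open>G\<close> is \<open>Dx (Dx (Dx V)) - 4 * Dx V\<close> (see \<open>V_derivs\<close>), written so that its growth of order
  \<open>cosh x\<close> becomes apparent.\<close>

definition G where "G x y t = (2 * (cosh x)\<^sup>2 + 6 * (sinh x)\<^sup>2) * Dx v x y t
  + 6 * cosh x * sinh x * Dx (Dx v) x y t + (cosh x)\<^sup>2 * Dx (Dx (Dx v)) x y t"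

lemma tempered_v1: "tempered (-1) (Dx v)"
proof (rule tempered_cong)
  show "tempered (-1) (\<lambda>x y t. Dx l x y t * v x y t)"
    using tempered_mult[OF tlx tempered_v] by simp
  show "Dx l x y t * v x y t = Dx v x y t" if "t < 0" for x y t
    unfolding Dx_def[of v] v_def
    by (rule DERIV_imp_deriv[symmetric]) (auto intro!: derivative_eq_intros dl(4)[OF that])
qed

text \<open>Each term pairs a quadratic expression in cosh x and sinh x, of index 2, with an
  x-derivative of v, of index -1. The terms in v itself would have index 2; they cancel between Dx
  (Dx (Dx V)) and 4 * Dx V.\<close>

lemma tempered_G: "tempered 1 G"
proof -
  note v2 = tempered_D(1)[OF tempered_v1]
  note v3 = tempered_D(1)[OF v2]
  have c: "tempered 2 (\<lambda>x y t. (cosh x)\<^sup>2)" "tempered 2 (\<lambda>x y t. (sinh x)\<^sup>2)" "tempered 2 (\<lambda>x y t. cosh x * sinh x)"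
    using tempered_mult[OF tempered_cosh tempered_cosh] tempered_mult[OF tempered_sinh tempered_sinh]
      tempered_mult[OF tempered_cosh tempered_sinh] by (simp_all add: power2_eq_square)
  have m: "tempered 1 (\<lambda>x y t. f x y t * g x y t)" if "tempered 2 f" "tempered (-1) g" for f g
    using tempered_mult[OF that] by simp
  have "tempered 1 (\<lambda>x y t. (2 * (cosh x)\<^sup>2 + 6 * (sinh x)\<^sup>2) * Dx v x y t
     + 6 * (cosh x * sinh x) * Dx (Dx v) x y t + (cosh x)\<^sup>2 * Dx (Dx (Dx v)) x y t)"
    by (intro tempered_add m tempered_cmult c tempered_v1 v2 v3)
  then show ?thesis by (simp add: G_def[abs_def] mult.assoc)
qed

lemma V_derivs:
  assumes t: "t < 0"
  shows "Dx V x y t = 2 * cosh x * sinh x * v x y t + (cosh x)\<^sup>2 * Dx v x y t" (is "_ = ?V1 x")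
    "Dx (Dx V) x y t = 2 * ((cosh x)\<^sup>2 + (sinh x)\<^sup>2) * v x y t + 4 * cosh x * sinh x * Dx v x y t
      + (cosh x)\<^sup>2 * Dx (Dx v) x y t" (is "_ = ?V2 x")
    "Dx (Dx (Dx V)) x y t - 4 * Dx V x y t = G x y t"
proof -
  have 1: "Dx V x y t = ?V1 x" for x
    unfolding Dx_def[of V] V_def
    by (rule DERIV_imp_deriv) (auto intro!: derivative_eq_intros dv(4)[OF t] simp: algebra_simps)
  then show "Dx V x y t = ?V1 x" .
  have 2: "Dx (Dx V) x y t = ?V2 x" for x
    unfolding Dx_def[of "Dx V"] 1
    by (rule DERIV_imp_deriv)
      (auto intro!: derivative_eq_intros dv(4)[OF t] dvx(4)[OF t] simp: algebra_simps power2_eq_square)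
  then show "Dx (Dx V) x y t = ?V2 x" .
  have "Dx (Dx (Dx V)) x y t = 8 * cosh x * sinh x * v x y t + 6 * ((cosh x)\<^sup>2 + (sinh x)\<^sup>2) * Dx v x y t
      + 6 * cosh x * sinh x * Dx (Dx v) x y t + (cosh x)\<^sup>2 * Dx (Dx (Dx v)) x y t"
    unfolding Dx_def[of "Dx (Dx V)"] 2
    by (rule DERIV_imp_deriv)
      (auto intro!: derivative_eq_intros dv(4)[OF t] dvx(4)[OF t] dvxx(4)[OF t] simp: algebra_simps power2_eq_square)
  then show "Dx (Dx (Dx V)) x y t - 4 * Dx V x y t = G x y t"
    unfolding 1 G_def by (simp add: algebra_simps)
qed

lemma cosh_powr_m2_le:
  fixes x \<alpha> :: real
  assumes "\<alpha> \<le> 2" shows "(inverse (cosh x))\<^sup>2 \<le> cosh x powr - \<alpha>"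
proof -
  have "(inverse (cosh x))\<^sup>2 = cosh x powr -2" by (simp add: powr_minus power_inverse)
  also have "\<dots> \<le> cosh x powr - \<alpha>" using assms cosh_real_ge_1[of x] by (intro powr_mono) auto
  finally show ?thesis .
qed

text \<open>Put B = (cosh x)^2 v_x and A = B_x. Then A - tanh x B is the second latitude derivative
  of v, and A - 2 tanh x B is its Laplacian when v does not depend on the angle; this is the
  situation of \<open>polar_decay\<close>. With q' the x-derivative of A - tanh x B one has G = q' +
  B / (cosh x)^2 + 3 tanh x A. Here B is merely bounded, whence the condition \<alpha> \<le>
  2.\<close>

lemma G_decay:
  assumes t0: "t0 < 0" and \<alpha>: "0 < \<alpha>" "\<alpha> \<le> 2" and C: "C > 0"
    and third: "\<And>x t. t \<le> t0 \<Longrightarrow>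
      \<bar>Dx (\<lambda>x y t. cosh x * (sinh x * Dx v x y t + cosh x * Dx (Dx v) x y t)) x 0 t\<bar> \<le> C * cosh x powr - \<alpha>"
    and hoelder: "\<And>x y t. t \<le> t0 \<Longrightarrow>
      \<bar>(cosh x)\<^sup>2 * Dx (Dx v) x 0 t - (cosh y)\<^sup>2 * Dx (Dx v) y 0 t\<bar> \<le> C * \<bar>lat x - lat y\<bar> powr \<alpha>"
  obtains K where "\<And>x t. t \<le> t0 \<Longrightarrow> \<bar>G x 0 t\<bar> \<le> K * cosh x powr - \<alpha>"
proof -
  obtain N where N: "N > 0" "\<And>x y t. t \<in> {t0..t0} \<Longrightarrow> \<bar>v x y t\<bar> \<le> N * cosh x powr 0"
    by (rule tempered_bound[OF tempered_v t0, of t0]) blast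
  \<comment> \<open>A bound at the single time t0 is enough because v is nondecreasing in time; this
    makes the final constant independent of t.\<close>
  have vN: "0 \<le> v x y t" "v x y t \<le> N" if "t \<le> t0" for x y t
    using v_mono[OF that t0, of x y] N(2)[of t0 x y] v_pos[of x y t] by (auto intro: less_imp_le)
  define K1 where "K1 = C * 2 powr \<alpha> * (2 / \<alpha> + 1)"
  define K2 where "K2 = (cosh 1)\<^sup>2 * N + 2 * (K1 * 2 powr \<alpha> / \<alpha>)"
  have K1: "K1 \<ge> 0" using C \<alpha> by (simp add: K1_def)
  have "\<bar>G x 0 t\<bar> \<le> (C + K2 + 3 * K1) * cosh x powr - \<alpha>" if t: "t \<le> t0" for x t
  proof -
    have tn: "t < 0" using t t0 by simp
    define B where "B x = (cosh x)\<^sup>2 * Dx v x 0 t" for x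
    define A where "A x = 2 * cosh x * sinh x * Dx v x 0 t + (cosh x)\<^sup>2 * Dx (Dx v) x 0 t" for x
    define A' where "A' x = 2 * ((cosh x)\<^sup>2 + (sinh x)\<^sup>2) * Dx v x 0 t + 4 * cosh x * sinh x * Dx (Dx v) x 0 t
      + (cosh x)\<^sup>2 * Dx (Dx (Dx v)) x 0 t" for x
    define q' where "q' x = A' x - (inverse (cosh x))\<^sup>2 * B x - tanh x * A x" for x
    have dB: "(B has_real_derivative A x) (at x)" for x
      unfolding B_def[abs_def] A_def by (auto intro!: derivative_eq_intros dvx(4)[OF tn])
    have dA: "(A has_real_derivative A' x) (at x)" for x
      unfolding A_def[abs_def] A'_def
      by (auto intro!: derivative_eq_intros dvx(4)[OF tn] dvxx(4)[OF tn] simp: algebra_simps power2_eq_square)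
    have t': "1 + - (tanh x * tanh x) = (inverse (cosh x))\<^sup>2" for x :: real
      using sech_tanh_squares[of x] by (simp add: power2_eq_square)
    have dq: "((\<lambda>x. A x - tanh x * B x) has_real_derivative q' x) (at x)" for x
      using DERIV_diff[OF dA DERIV_mult[OF DERIV_tanh[unfolded t'] dB]] by (simp add: q'_def algebra_simps)
    have qeq: "A x - tanh x * B x = cosh x * (sinh x * Dx v x 0 t + cosh x * Dx (Dx v) x 0 t)" for x
      by (simp add: A_def B_def tanh_def field_simps power2_eq_square)
    have "Dx (\<lambda>x y t. cosh x * (sinh x * Dx v x y t + cosh x * Dx (Dx v) x y t)) x 0 t = q' x" for x
      unfolding Dx_def[of "\<lambda>x y t. cosh x * (sinh x * Dx v x y t + cosh x * Dx (Dx v) x y t)"] qeq[symmetric]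
      by (rule DERIV_imp_deriv[OF dq])
    then have q'b: "\<bar>q' x\<bar> \<le> C * cosh x powr - \<alpha>" for x using third[OF t, of x] by simp
    have "A x - 2 * tanh x * B x = (cosh x)\<^sup>2 * Dx (Dx v) x 0 t" for x
      by (simp add: A_def B_def tanh_def field_simps power2_eq_square)
    then have L: "\<bar>(A x - 2 * tanh x * B x) - (A y - 2 * tanh y * B y)\<bar> \<le> C * \<bar>lat x - lat y\<bar> powr \<alpha>" for x y
      using hoelder[OF t, of x y] by simp
    have Ab: "\<bar>A x\<bar> \<le> K1 * cosh x powr - \<alpha>" for x
      unfolding K1_def by (rule polar_decay[OF dB dq q'b L C \<alpha>(1)])
    have Ae: "\<bar>A x\<bar> \<le> K1 * 2 powr \<alpha> * exp (- \<alpha> * x)" for x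
      using Ab[of x] mult_left_mono[OF cosh_powr_le_exp[of \<alpha> x] K1] \<alpha> by (simp add: mult.assoc)
    have osc: "\<bar>B x - B y\<bar> \<le> K1 * 2 powr \<alpha> / \<alpha>" if "x \<ge> 0" "y \<ge> 0" for x y
      using exp_decay_oscillation[of B A 0 "K1 * 2 powr \<alpha>" \<alpha> x y] dB Ae \<alpha> K1 that by simp
    have osc': "\<bar>B x - B y\<bar> \<le> K1 * 2 powr \<alpha> / \<alpha>" if "x \<le> 0" "y \<le> 0" for x y
    proof -
      have d: "((\<lambda>x. B (- x)) has_real_derivative - A (- x)) (at x)" for x
        using DERIV_mirror[of B "A (- x)" x] dB[of "- x"] by simp
      have e: "\<bar>- A (- x)\<bar> \<le> K1 * 2 powr \<alpha> * exp (- \<alpha> * x)" for x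
        using Ab[of "- x"] mult_left_mono[OF cosh_powr_le_exp[of \<alpha> x] K1] \<alpha> by (simp add: mult.assoc)
      show ?thesis
        using exp_decay_oscillation[of "\<lambda>x. B (- x)" "\<lambda>x. - A (- x)" 0 "K1 * 2 powr \<alpha>" \<alpha> "- x" "- y"]
          d e \<alpha> K1 that by simp
    qed
    \<comment> \<open>The mean value theorem provides one point z at which B has a bound independent
      of t; the oscillation bounds carry it to all x.\<close>
    have "\<exists>z. 0 < z \<and> z < 1 \<and> v 1 0 t - v 0 0 t = (1 - 0) * Dx v z 0 t"
      by (rule MVT2) (use dv(4)[OF tn] in auto)
    then obtain z where z: "0 < z" "z < 1" "v 1 0 t - v 0 0 t = Dx v z 0 t" by auto
    have "\<bar>B z\<bar> = (cosh z)\<^sup>2 * \<bar>v 1 0 t - v 0 0 t\<bar>" using z by (simp add: B_def abs_mult)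
    also have "\<dots> \<le> (cosh 1)\<^sup>2 * N"
    proof (rule mult_mono)
      show "(cosh z)\<^sup>2 \<le> (cosh 1)\<^sup>2" using z by (intro power_mono) (auto simp: cosh_real_nonneg_le_iff)
      show "\<bar>v 1 0 t - v 0 0 t\<bar> \<le> N" using vN[OF t, of 1 0] vN[OF t, of 0 0] by (simp add: abs_le_iff)
    qed auto
    finally have Bz: "\<bar>B z\<bar> \<le> (cosh 1)\<^sup>2 * N" .
    have Bb: "\<bar>B x\<bar> \<le> K2" for x
    proof -
      have "\<bar>B 0 - B z\<bar> \<le> K1 * 2 powr \<alpha> / \<alpha>" by (rule osc) (use z in auto)
      moreover have "\<bar>B x - B 0\<bar> \<le> K1 * 2 powr \<alpha> / \<alpha>" using osc[of x 0] osc'[of x 0] by (cases "x \<ge> 0") auto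
      ultimately show ?thesis using Bz unfolding K2_def by (simp add: abs_le_iff)
    qed
    have "G x 0 t = A' x + 2 * tanh x * A x"
      by (simp add: G_def A'_def A_def tanh_def field_simps power2_eq_square)
    also have "\<dots> = q' x + (inverse (cosh x))\<^sup>2 * B x + 3 * (tanh x * A x)" by (simp add: q'_def)
    finally have Geq: "G x 0 t = q' x + (inverse (cosh x))\<^sup>2 * B x + 3 * (tanh x * A x)" .
    have K2: "K2 \<ge> 0" using Bb[of 0] by (rule order_trans[OF abs_ge_zero])
    have 1: "\<bar>(inverse (cosh x))\<^sup>2 * B x\<bar> \<le> cosh x powr - \<alpha> * K2"
      unfolding abs_mult using cosh_powr_m2_le[OF \<alpha>(2), of x] Bb[of x] by (intro mult_mono) auto
    have 2: "\<bar>tanh x * A x\<bar> \<le> 1 * (K1 * cosh x powr - \<alpha>)"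
      unfolding abs_mult by (intro mult_mono abs_tanh_le_1 Ab) auto
    have "\<bar>G x 0 t\<bar> \<le> \<bar>q' x\<bar> + \<bar>(inverse (cosh x))\<^sup>2 * B x\<bar> + 3 * \<bar>tanh x * A x\<bar>"
      unfolding Geq by (rule order_trans[OF abs_triangle_ineq])
        (intro add_mono abs_triangle_ineq, simp add: abs_mult)
    also have "\<dots> \<le> C * cosh x powr - \<alpha> + cosh x powr - \<alpha> * K2 + 3 * (1 * (K1 * cosh x powr - \<alpha>))"
      using 1 2 q'b[of x] by (intro add_mono mult_left_mono) auto
    also have "\<dots> = (C + K2 + 3 * K1) * cosh x powr - \<alpha>" by (simp add: algebra_simps)
    finally show ?thesis .
  qed
  then show thesis by (rule that)
qed

lemma V_lower: assumes "b < 0" shows "\<exists>m>0. \<forall>x. \<forall>t\<in>{a..b}. m * (cosh x)\<^sup>2 \<le> V x 0 t"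
proof -
  obtain M where M: "M > 0" "\<And>x y t. t \<in> {a..b} \<Longrightarrow> \<bar>l x y t\<bar> \<le> M * cosh x powr 0"
    by (rule tempered_bound[OF tl assms, of a]) blast
  have "exp (- M) * (cosh x)\<^sup>2 \<le> V x 0 t" if "t \<in> {a..b}" for x t
  proof -
    have "- M \<le> l x 0 t" using M(2)[OF that, of x 0] by (simp add: abs_le_iff)
    then show ?thesis unfolding V_def v_def by (simp add: mult.commute)
  qed
  then show ?thesis by (intro exI[of _ "exp (- M)"]) auto
qed

section \<open>Evolution of rotationally symmetric solutions\<close>

context
  assumes sym: "\<And>x y t. t < 0 \<Longrightarrow> Dy l x y t = 0"
begin

text \<open>For l independent of y, \<open>pde\<close> says V_t = V^2 (log V)_xx: its summand 2 is
  the contribution of log ((cosh x)^2), whose second derivative is 2 / (cosh x)^2.\<close>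

lemma pressure_equation:
  assumes t: "t < 0"
  shows "Dt V x y t = V x y t * Dx (Dx V) x y t - (Dx V x y t)\<^sup>2" "Dt V x y t = V x y t * Dt l x y t"
proof -
  have "Dy (Dy l) x y t = Dy (\<lambda>x y t. 0) x y t" by (rule Dy_cong) (rule sym[OF t])
  then have yy: "Dy (Dy l) x y t = 0" by (simp add: Dy_def)
  show 1: "Dt V x y t = V x y t * Dt l x y t"
    unfolding Dt_def[of V] V_def v_def
    by (rule DERIV_imp_deriv) (auto intro!: derivative_eq_intros dl(6)[OF t])
  have vx: "Dx v x y t = v x y t * Dx l x y t" for x
    unfolding Dx_def[of v] v_def by (rule DERIV_imp_deriv) (auto intro!: derivative_eq_intros dl(4)[OF t])
  have vxx: "Dx (Dx v) x y t = v x y t * ((Dx l x y t)\<^sup>2 + Dx (Dx l) x y t)"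
    unfolding Dx_def[of "Dx v"] vx
    by (rule DERIV_imp_deriv)
      (auto intro!: derivative_eq_intros dv(4)[OF t] dlx(4)[OF t] simp: vx algebra_simps power2_eq_square)
  have c: "(cosh x)\<^sup>2 = (sinh x)\<^sup>2 + 1" by (rule cosh_square_eq)
  define k e k1 k2 where "k = v x y t" and "e = (cosh x)\<^sup>2" and "k1 = Dx l x y t" and "k2 = Dx (Dx l) x y t"
  have s: "(sinh x)\<^sup>2 = e - 1" using c by (simp add: e_def)
  have e2: "(cosh x * sinh x)\<^sup>2 = e * (e - 1)" by (simp add: power_mult_distrib s e_def)
  have "V x y t * Dx (Dx V) x y t - (Dx V x y t)\<^sup>2
      = e * k * (2 * (e + (e - 1)) * k + 4 * (cosh x * sinh x) * (k * k1) + e * (k * (k1\<^sup>2 + k2)))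
        - (2 * (cosh x * sinh x) * k + e * (k * k1))\<^sup>2"
    unfolding V_derivs[OF t] vx vxx V_def k_def[symmetric] e_def[symmetric] k1_def[symmetric] k2_def[symmetric] s
    by (simp add: mult.assoc)
  also have "\<dots> = e * k * (k * (e * k2 + 2))"
  proof -
    have "(2 * (cosh x * sinh x) * k + e * (k * k1))\<^sup>2
        = 4 * (e * (e - 1)) * k\<^sup>2 + 4 * (cosh x * sinh x) * k * e * (k * k1) + e\<^sup>2 * (k * k1)\<^sup>2"
      by (simp only: power2_sum power_mult_distrib e2[unfolded power_mult_distrib]) (simp add: power_mult_distrib mult_ac)
    then show ?thesis by (simp add: algebra_simps power2_eq_square)
  qed
  also have "\<dots> = V x y t * Dt l x y t"
    unfolding pde[OF t] yy V_def by (simp add: k_def e_def k2_def v_def)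
  finally show "Dt V x y t = V x y t * Dx (Dx V) x y t - (Dx V x y t)\<^sup>2" using 1 by simp
qed

lemma V_time_derivs:
  assumes t: "t < 0"
  shows "Dt (Dx V) x y t = V x y t * Dx (Dx (Dx V)) x y t - Dx V x y t * Dx (Dx V) x y t"
    "Dt (Dx (Dx V)) x y t = V x y t * Dx (Dx (Dx (Dx V))) x y t - (Dx (Dx V) x y t)\<^sup>2"
    "Dt (Dx (Dx (Dx V))) x y t = V x y t * Dx (Dx (Dx (Dx (Dx V)))) x y t
      + Dx V x y t * Dx (Dx (Dx (Dx V))) x y t - 2 * Dx (Dx V) x y t * Dx (Dx (Dx V)) x y t"
proof -
  have 1: "Dt (Dx V) x y t = V x y t * Dx (Dx (Dx V)) x y t - Dx V x y t * Dx (Dx V) x y t" for x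
  proof -
    have "Dt (Dx V) x y t = Dx (Dt V) x y t" by (rule tempered_commute(1)[OF tempered_V t, symmetric])
    also have "\<dots> = deriv (\<lambda>x. V x y t * Dx (Dx V) x y t - (Dx V x y t)\<^sup>2) x"
      unfolding Dx_def[of "Dt V"] pressure_equation(1)[OF t] ..
    also have "\<dots> = V x y t * Dx (Dx (Dx V)) x y t - Dx V x y t * Dx (Dx V) x y t"
      by (rule DERIV_imp_deriv)
        (auto intro!: derivative_eq_intros dV(4)[OF t] dV1(4)[OF t] dV2(4)[OF t] simp: algebra_simps)
    finally show ?thesis .
  qed
  then show "Dt (Dx V) x y t = V x y t * Dx (Dx (Dx V)) x y t - Dx V x y t * Dx (Dx V) x y t" .
  have 2: "Dt (Dx (Dx V)) x y t = V x y t * Dx (Dx (Dx (Dx V))) x y t - (Dx (Dx V) x y t)\<^sup>2" for x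
  proof -
    have "Dt (Dx (Dx V)) x y t = Dx (Dt (Dx V)) x y t" by (rule tempered_commute(1)[OF dV(1) t, symmetric])
    also have "\<dots> = deriv (\<lambda>x. V x y t * Dx (Dx (Dx V)) x y t - Dx V x y t * Dx (Dx V) x y t) x"
      unfolding Dx_def[of "Dt (Dx V)"] 1 ..
    also have "\<dots> = V x y t * Dx (Dx (Dx (Dx V))) x y t - (Dx (Dx V) x y t)\<^sup>2"
      by (rule DERIV_imp_deriv)
        (auto intro!: derivative_eq_intros dV(4)[OF t] dV1(4)[OF t] dV2(4)[OF t] dV3(4)[OF t]
          simp: algebra_simps power2_eq_square)
    finally show ?thesis .
  qed
  then show "Dt (Dx (Dx V)) x y t = V x y t * Dx (Dx (Dx (Dx V))) x y t - (Dx (Dx V) x y t)\<^sup>2" .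
  have "Dt (Dx (Dx (Dx V))) x y t = Dx (Dt (Dx (Dx V))) x y t" by (rule tempered_commute(1)[OF dV1(1) t, symmetric])
  also have "\<dots> = deriv (\<lambda>x. V x y t * Dx (Dx (Dx (Dx V))) x y t - (Dx (Dx V) x y t)\<^sup>2) x"
    unfolding Dx_def[of "Dt (Dx (Dx V))"] 2 ..
  also have "\<dots> = V x y t * Dx (Dx (Dx (Dx (Dx V)))) x y t
      + Dx V x y t * Dx (Dx (Dx (Dx V))) x y t - 2 * Dx (Dx V) x y t * Dx (Dx (Dx V)) x y t"
    by (rule DERIV_imp_deriv)
      (auto intro!: derivative_eq_intros dV(4)[OF t] dV2(4)[OF t] dV4(4)[OF t] simp: algebra_simps)
  finally show "Dt (Dx (Dx (Dx V))) x y t = V x y t * Dx (Dx (Dx (Dx (Dx V)))) x y t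
      + Dx V x y t * Dx (Dx (Dx (Dx V))) x y t - 2 * Dx (Dx V) x y t * Dx (Dx (Dx V)) x y t" .
qed

text \<open>By \<open>V_time_derivs\<close>, both Dx V and Dx (Dx (Dx V)) solve f_t = V f_xx + V_x
  f_x - 2 V_xx f, and linear combinations inherit it.\<close>

lemma G_equation:
  assumes t: "t < 0"
  shows "Dt G x y t = V x y t * Dx (Dx G) x y t + Dx V x y t * Dx G x y t - 2 * Dx (Dx V) x y t * G x y t"
proof -
  have G: "G x y t = Dx (Dx (Dx V)) x y t - 4 * Dx V x y t" if "t < 0" for x y t
    using V_derivs(3)[OF that] by simp
  have "Dt G x y t = Dt (\<lambda>x y t. Dx (Dx (Dx V)) x y t - 4 * Dx V x y t) x y t" by (rule Dt_cong[OF _ t]) (rule G)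
  also have "\<dots> = Dt (Dx (Dx (Dx V))) x y t - 4 * Dt (Dx V) x y t"
    unfolding Dt_def[of "\<lambda>x y t. Dx (Dx (Dx V)) x y t - 4 * Dx V x y t"]
    by (rule DERIV_imp_deriv) (auto intro!: derivative_eq_intros dV1(6)[OF t] dV3(6)[OF t])
  finally have Gt: "Dt G x y t = Dt (Dx (Dx (Dx V))) x y t - 4 * Dt (Dx V) x y t" .
  have Gx: "Dx G x y t = Dx (Dx (Dx (Dx V))) x y t - 4 * Dx (Dx V) x y t" for x
    unfolding Dx_def[of G] G[OF t]
    by (rule DERIV_imp_deriv) (auto intro!: derivative_eq_intros dV1(4)[OF t] dV3(4)[OF t])
  have Gxx: "Dx (Dx G) x y t = Dx (Dx (Dx (Dx (Dx V)))) x y t - 4 * Dx (Dx (Dx V)) x y t"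
    unfolding Dx_def[of "Dx G"] Gx
    by (rule DERIV_imp_deriv) (auto intro!: derivative_eq_intros dV2(4)[OF t] dV4(4)[OF t])
  show ?thesis unfolding Gt Gx Gxx G[OF t] V_time_derivs[OF t] by (simp add: algebra_simps)
qed

end


text \<open>Once G = 0, V is determined in x by its value and first two derivatives at x = 0, and
  the evolution of these data is the system of \<open>rosenau_ode\<close>. The bound on
  \<open>Dt l\<close> is what later shows that the curvature blows up only if a does.\<close>

lemma rosenau_form:
  assumes sym: "\<And>x y t. t < 0 \<Longrightarrow> Dy l x y t = 0"
    and t0: "t0 < 0" and \<alpha>: "0 < \<alpha>" and G: "\<And>x t. t \<le> t0 \<Longrightarrow> \<bar>G x 0 t\<bar> \<le> K * cosh x powr - \<alpha>"
  obtains \<kappa> y0 a b where "\<bar>\<kappa>\<bar> < 1" "0 < y0" "y0 \<le> 1"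
    "\<And>t. t < 0 \<Longrightarrow> b t > 0"
    "\<And>x t. t < 0 \<Longrightarrow> V x 0 t = a t + b t * cosh (2 * x) + \<kappa> * b t * sinh (2 * x)"
    "\<And>t. t < 0 \<Longrightarrow> (b t)\<^sup>2 - (\<kappa> * b t)\<^sup>2 = (a t)\<^sup>2 - C0\<^sup>2"
    "\<And>t. t < 0 \<Longrightarrow> a t = C0 * (1 + y0 * exp (8 * C0 * t)) / (1 - y0 * exp (8 * C0 * t))"
    "\<And>x t. t < 0 \<Longrightarrow> Dt l x 0 t \<le> 4 * a t"
proof -
  obtain N where N: "N > 0" "\<And>x y t. t \<in> {t0..t0} \<Longrightarrow> \<bar>v x y t\<bar> \<le> N * cosh x powr 0"
    by (rule tempered_bound[OF tempered_v t0, of t0]) blast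
  have G0: "G x 0 t = 0" if t: "t < 0" for x t
  proof (rule pressure_rigidity[where V = V and G = G and \<alpha> = \<alpha> and K = K and N = N and ?c0.0 = C0 and ?t0.0 = t0])
    show "V x 0 t \<le> N * (cosh x)\<^sup>2" if "t \<le> t0" for x t
    proof -
      have "v x 0 t \<le> N" using v_mono[OF that t0, of x 0] N(2)[of t0 x 0] by simp
      then show ?thesis unfolding V_def by (simp add: mult.commute)
    qed
    show "(Dx V x 0 t)\<^sup>2 \<le> V x 0 t * Dx (Dx V) x 0 t" if "t < 0" for x t
    proof -
      have "V x 0 t * Dt l x 0 t \<ge> 0"
        using V_pos[of x 0 t] Dt_l_nonneg[OF that, of x 0] by (simp add: less_imp_le)
      then show ?thesis using pressure_equation[OF sym that, of x 0] by linarith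
    qed
  qed (use tempered_V tempered_G G_equation[OF sym] pressure_equation(1)[OF sym] V_lower C0 V_ge G \<alpha> t0 t in auto)
  have V3: "Dx (Dx (Dx V)) x 0 t = 4 * Dx V x 0 t" if "t < 0" for x t
    using V_derivs(3)[OF that, of x 0] G0[OF that, of x] by simp
  have V4: "Dx (Dx (Dx (Dx V))) x 0 t = 4 * Dx (Dx V) x 0 t" if t: "t < 0" for x t
    unfolding Dx_def[of "Dx (Dx (Dx V))"] V3[OF t]
    by (rule DERIV_imp_deriv) (auto intro!: derivative_eq_intros dV1(4)[OF t])
  define b where "b t = Dx (Dx V) 0 0 t / 4" for t
  define d where "d t = Dx V 0 0 t / 2" for t
  define a where "a t = V 0 0 t - b t" for t
  have form: "V x 0 t = a t + b t * cosh (2 * x) + d t * sinh (2 * x)" if t: "t < 0" for x t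
    using third_order_ode[of "\<lambda>x. V x 0 t" "\<lambda>x. Dx V x 0 t" "\<lambda>x. Dx (Dx V) x 0 t" x]
      dV(4)[OF t] dV1(4)[OF t] dV2(4)[OF t, where y = 0, unfolded V3[OF t]]
    by (simp add: a_def b_def d_def)
  have V2b: "Dx (Dx V) 0 0 t = 4 * b t" and V1d: "Dx V 0 0 t = 2 * d t" and V0: "V 0 0 t = a t + b t" for t
    by (simp_all add: a_def b_def d_def)
  have db: "(b has_real_derivative 4 * a t * b t) (at t)" if t: "t < 0" for t
  proof -
    have "(b has_real_derivative Dt (Dx (Dx V)) 0 0 t / 4) (at t)"
      unfolding b_def[abs_def] by (rule DERIV_cdivide[OF dV2(6)[OF t]])
    moreover have "Dt (Dx (Dx V)) 0 0 t / 4 = 4 * a t * b t"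
    proof -
      have "Dt (Dx (Dx V)) 0 0 t = V 0 0 t * (4 * Dx (Dx V) 0 0 t) - (Dx (Dx V) 0 0 t)\<^sup>2"
        using V_time_derivs(2)[OF sym t, of 0 0] V4[OF t, of 0] by simp
      then show ?thesis unfolding V2b V0 by (simp add: power2_eq_square algebra_simps)
    qed
    ultimately show ?thesis by simp
  qed
  have dd: "(d has_real_derivative 4 * a t * d t) (at t)" if t: "t < 0" for t
  proof -
    have "(d has_real_derivative Dt (Dx V) 0 0 t / 2) (at t)"
      unfolding d_def[abs_def] by (rule DERIV_cdivide[OF dV1(6)[OF t]])
    moreover have "Dt (Dx V) 0 0 t / 2 = 4 * a t * d t"
    proof -
      have "Dt (Dx V) 0 0 t = V 0 0 t * (4 * Dx V 0 0 t) - Dx V 0 0 t * Dx (Dx V) 0 0 t"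
        using V_time_derivs(1)[OF sym t, of 0 0] V3[OF t, of 0] by simp
      then show ?thesis unfolding V2b V0 V1d by (simp add: algebra_simps)
    qed
    ultimately show ?thesis by simp
  qed
  have da: "(a has_real_derivative 4 * ((b t)\<^sup>2 - (d t)\<^sup>2)) (at t)" if t: "t < 0" for t
  proof -
    have "(a has_real_derivative Dt V 0 0 t - 4 * a t * b t) (at t)"
      unfolding a_def[abs_def] using DERIV_diff[OF dV(6)[OF t] db[OF t]] by (simp add: a_def)
    moreover have "Dt V 0 0 t - 4 * a t * b t = 4 * ((b t)\<^sup>2 - (d t)\<^sup>2)"
      using pressure_equation(1)[OF sym t, of 0 0] unfolding V2b V0 V1d
      by (simp add: power2_eq_square algebra_simps)
    ultimately show ?thesis by simp
  qed
  \<comment> \<open>Otherwise V would stay bounded towards one of the poles, where it has to grow at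
    least like m (cosh x)^2.\<close>
  have bd: "\<bar>d t\<bar> < b t" if t: "t < 0" for t
  proof (rule ccontr)
    assume le: "\<not> \<bar>d t\<bar> < b t"
    obtain m where m: "m > 0" "\<forall>x. \<forall>t\<in>{t..t}. m * (cosh x)\<^sup>2 \<le> V x 0 t" using V_lower[OF t, of t] by blast
    obtain X where X: "X \<ge> 0" "X > 0" "cosh X \<ge> (\<bar>a t\<bar> + \<bar>d t\<bar>) / m + 1" by (rule cosh_eventually_large)
    define x where "x = (if d t \<ge> 0 then - X else X)"
    have cx: "cosh x = cosh X" "cosh (2 * x) = cosh (2 * X)" "d t * sinh (2 * x) = - (\<bar>d t\<bar> * sinh (2 * X))"
      by (auto simp: x_def)
    have "m * (cosh X)\<^sup>2 \<le> a t + b t * cosh (2 * X) - \<bar>d t\<bar> * sinh (2 * X)"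
      using m(2)[rule_format, of t x] form[OF t, of x] cx by simp
    also have "\<dots> \<le> a t + \<bar>d t\<bar> * cosh (2 * X) - \<bar>d t\<bar> * sinh (2 * X)"
      using le mult_right_mono[of "b t" "\<bar>d t\<bar>" "cosh (2 * X)"] by simp
    also have "\<dots> = a t + \<bar>d t\<bar> * exp (- (2 * X))"
      using cosh_minus_sinh[of "2 * X"] by (simp add: right_diff_distrib[symmetric])
    also have "\<dots> \<le> \<bar>a t\<bar> + \<bar>d t\<bar> * 1" using X by (intro add_mono mult_left_mono) auto
    finally have 1: "m * (cosh X)\<^sup>2 \<le> \<bar>a t\<bar> + \<bar>d t\<bar>" by simp
    have "(\<bar>a t\<bar> + \<bar>d t\<bar>) / m < cosh X" using X by simp
    then have "\<bar>a t\<bar> + \<bar>d t\<bar> < m * cosh X" using m(1) by (simp add: pos_divide_less_eq mult.commute)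
    also have "\<dots> \<le> m * (cosh X)\<^sup>2"
      using m(1) cosh_real_ge_1[of X] by (intro mult_left_mono) (auto simp: power2_eq_square)
    finally show False using 1 by simp
  qed
  have limV: "((\<lambda>t. V x 0 t) \<longlongrightarrow> C0) at_bot" for x
  proof -
    have "((\<lambda>t. (cosh x)\<^sup>2 * exp (l x 0 t)) \<longlongrightarrow> (cosh x)\<^sup>2 * (C0 / (cosh x)\<^sup>2)) at_bot"
      by (intro tendsto_intros lim)
    then show ?thesis by (simp add: V_def v_def)
  qed
  have ev: "\<forall>\<^sub>F t in at_bot. t < (0::real)" by (rule eventually_gt_at_bot)
  define k where "k = cosh (2::real) - 1"
  have k: "k > 0" using cosh_real_ge_1[of "2::real"] cosh_real_one_iff[of "2::real"] by (simp add: k_def less_le)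
  \<comment> \<open>The symmetric second difference of V at -1, 0, 1 removes a and d and leaves b
    (cosh 2 - 1).\<close>
  have bl: "(b \<longlongrightarrow> 0) at_bot"
  proof -
    have "((\<lambda>t. ((V 1 0 t + V (-1) 0 t) / 2 - V 0 0 t) / k) \<longlongrightarrow> ((C0 + C0) / 2 - C0) / k) at_bot"
      by (intro tendsto_intros limV) (use k in auto)
    then have "((\<lambda>t. ((V 1 0 t + V (-1) 0 t) / 2 - V 0 0 t) / k) \<longlongrightarrow> 0) at_bot" by simp
    then show ?thesis
    proof (rule Lim_transform_eventually)
      show "\<forall>\<^sub>F t in at_bot. ((V 1 0 t + V (-1) 0 t) / 2 - V 0 0 t) / k = b t"
        using ev
      proof (rule eventually_mono)
        fix t :: real assume t: "t < 0"
        have "(V 1 0 t + V (-1) 0 t) / 2 - V 0 0 t = b t * k" unfolding form[OF t] k_def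
          by (simp add: algebra_simps)
        then show "((V 1 0 t + V (-1) 0 t) / 2 - V 0 0 t) / k = b t" using k by simp
      qed
    qed
  qed
  have al: "(a \<longlongrightarrow> C0) at_bot" using tendsto_diff[OF limV[of 0] bl] by (simp add: a_def[abs_def])
  have dl0: "(d \<longlongrightarrow> 0) at_bot"
  proof (rule Lim_null_comparison[OF _ bl])
    show "\<forall>\<^sub>F t in at_bot. norm (d t) \<le> b t"
      using ev by (rule eventually_mono) (use bd in \<open>auto intro: less_imp_le\<close>)
  qed
  show thesis
  proof (rule rosenau_ode[OF da db dd bd al bl dl0 C0])
    fix \<kappa> y0 assume *: "\<bar>\<kappa>\<bar> < 1" "0 < y0" "y0 \<le> 1"
    "\<And>t. t < 0 \<Longrightarrow> d t = \<kappa> * b t" "\<And>t. t < 0 \<Longrightarrow> (b t)\<^sup>2 - (d t)\<^sup>2 = (a t)\<^sup>2 - C0\<^sup>2"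
    "\<And>t. t < 0 \<Longrightarrow> a t = C0 * (1 + y0 * exp (8 * C0 * t)) / (1 - y0 * exp (8 * C0 * t))"
    show thesis
    proof (rule that[OF *(1-3) _ _ _ *(6)])
      show "b t > 0" if "t < 0" for t using bd[OF that] by linarith
      show "V x 0 t = a t + b t * cosh (2 * x) + \<kappa> * b t * sinh (2 * x)" if "t < 0" for x t
        using form[OF that] *(4)[OF that] by simp
      show "(b t)\<^sup>2 - (\<kappa> * b t)\<^sup>2 = (a t)\<^sup>2 - C0\<^sup>2" if "t < 0" for t
        using *(4,5)[OF that] by simp
      fix x t :: real assume t: "t < 0"
      define c s where "c = cosh (2 * x)" and "s = sinh (2 * x)"
      have cs: "c\<^sup>2 = s\<^sup>2 + 1" unfolding c_def s_def by (rule cosh_square_eq)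
      have V1: "Dx V x 0 t = 2 * (b t * s + d t * c)"
        unfolding Dx_def[of V] form[OF t] c_def s_def
        by (rule DERIV_imp_deriv) (auto intro!: derivative_eq_intros)
      have Vx: "Dx V x 0 t = 2 * (b t * sinh (2 * x) + d t * cosh (2 * x))" for x
        unfolding Dx_def[of V] form[OF t]
        by (rule DERIV_imp_deriv) (auto intro!: derivative_eq_intros)
      have V2: "Dx (Dx V) x 0 t = 4 * (b t * c + d t * s)"
        unfolding Dx_def[of "Dx V"] Vx c_def s_def
        by (rule DERIV_imp_deriv) (auto intro!: derivative_eq_intros)
      \<comment> \<open>On these profiles the conserved quantity turns V Dt l into 4 a V - 4
        C0^2.\<close>
      have "V x 0 t * Dt l x 0 t = (a t + (b t * c + d t * s)) * (4 * (b t * c + d t * s)) - (2 * (b t * s + d t * c))\<^sup>2"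
        using pressure_equation[OF sym t, of x 0] unfolding V1 V2 form[OF t] c_def s_def by simp
      also have "\<dots> = 4 * a t * (b t * c + d t * s) + 4 * ((b t)\<^sup>2 - (d t)\<^sup>2) * (c\<^sup>2 - s\<^sup>2)"
        by (simp add: power2_eq_square algebra_simps)
      also have "\<dots> = 4 * a t * V x 0 t - 4 * C0\<^sup>2"
        using cs *(5)[OF t] unfolding form[OF t] c_def[symmetric] s_def[symmetric]
        by (simp add: power2_eq_square algebra_simps)
      also have "\<dots> \<le> V x 0 t * (4 * a t)" by simp
      finally show "Dt l x 0 t \<le> 4 * a t" using V_pos[of x 0 t] by simp
    qed
  qed
qed

end

section \<open>Scalar curvature, dilations and the explicit profile\<close>

lemma cyl_periodic: "cyl x (y + 2 * pi) = cyl x y"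
  by (simp add: cyl_def)

lemma sph_lat: "sph (lat x) y = cyl x y"
  using sph_eq_cyl[OF lat_facts(1), of x y] by (simp add: lat_facts(2))

lemma matrix_inv_eqI:
  fixes A N :: "'a::semiring_1^'n^'n"
  assumes "A ** N = mat 1" "N ** A = mat 1"
  shows "matrix_inv A = N"
proof -
  have "A ** matrix_inv A = mat 1 \<and> matrix_inv A ** A = mat 1"
    unfolding matrix_inv_def by (rule someI[where x = N]) (use assms in simp)
  then have "matrix_inv A = (N ** A) ** matrix_inv A" "A ** matrix_inv A = mat 1"
    using assms by (simp_all add: matrix_mul_lid)
  then show ?thesis by (simp add: matrix_mul_assoc[symmetric] matrix_mul_rid)
qed

text \<open>The curvature is read off the flow instead of being computed from Christoffel symbols:
  the flow equation identifies the diagonal Ricci components as - u' / 2 times those of the round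
  metric, and the trace with the diagonal inverse metric gives the formula.\<close>

lemma conformal_scalar_curvature:
  assumes flow: "ricci_flow_on (conformal_metric u) chart_domain {..<0}"
    and x: "x \<in> chart_domain" and t: "t < 0" and pos: "u (sph (x $ 1) (x $ 2)) t > 0"
    and ut: "((\<lambda>s. u (sph (x $ 1) (x $ 2)) s) has_real_derivative u') (at t)"
  shows "scalar_curvature (conformal_metric u t) x = - u' / u (sph (x $ 1) (x $ 2)) t"
proof -
  define k c where "k = u (sph (x $ 1) (x $ 2)) t" and "c = (cos (x $ 1))\<^sup>2"
  have "cos (x $ 1) > 0" using x by (intro cos_gt_zero_pi) (auto simp: chart_domain_def)
  then have c: "c > 0" by (simp add: c_def)
  have k: "k > 0" using pos by (simp add: k_def)
  define g where "g = conformal_metric u t x"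
  have g: "g $ 1 $ 1 = k" "g $ 2 $ 2 = k * c" "g $ 1 $ 2 = 0" "g $ 2 $ 1 = 0"
    by (simp_all add: g_def conformal_metric_def round_metric_def k_def c_def)
  define N :: "real^2^2" where "N = (\<chi> i j. if i \<noteq> j then 0 else if i = 1 then 1 / k else 1 / (k * c))"
  have N: "N $ 1 $ 1 = 1 / k" "N $ 2 $ 2 = 1 / (k * c)" "N $ 1 $ 2 = 0" "N $ 2 $ 1 = 0"
    by (simp_all add: N_def)
  have inv: "matrix_inv g = N"
  proof (rule matrix_inv_eqI)
    show "g ** N = mat 1" "N ** g = mat 1"
      using k c by (simp_all add: matrix_matrix_mult_def mat_def vec_eq_iff forall_2 sum_2 g N)
  qed
  have fl: "((\<lambda>s. conformal_metric u s x $ i $ j) has_real_derivative (- 2 * ricci (conformal_metric u t) i j x)) (at t)" for i j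
    using flow x t by (auto simp: ricci_flow_on_def)
  have "((\<lambda>s. u (sph (x $ 1) (x $ 2)) s) has_real_derivative (- 2 * ricci (conformal_metric u t) 1 1 x)) (at t)"
    using fl[of 1 1] by (simp add: conformal_metric_def round_metric_def)
  then have r1: "- 2 * ricci (conformal_metric u t) 1 1 x = u'" using ut by (rule DERIV_unique)
  have "((\<lambda>s. u (sph (x $ 1) (x $ 2)) s * c) has_real_derivative (- 2 * ricci (conformal_metric u t) 2 2 x)) (at t)"
    using fl[of 2 2] by (simp add: conformal_metric_def round_metric_def c_def)
  then have r2: "- 2 * ricci (conformal_metric u t) 2 2 x = u' * c"
    using DERIV_cmult_right[OF ut, of c] by (rule DERIV_unique)
  have "scalar_curvature (conformal_metric u t) x
      = 1 / k * ricci (conformal_metric u t) 1 1 x + 1 / (k * c) * ricci (conformal_metric u t) 2 2 x"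
    unfolding scalar_curvature_def g_def[symmetric] inv by (simp add: sum_2 N)
  also have "\<dots> = 1 / k * (- u' / 2) + 1 / (k * c) * (- (u' * c) / 2)"
  proof -
    have "ricci (conformal_metric u t) 1 1 x = - u' / 2" using r1 by simp
    moreover have "ricci (conformal_metric u t) 2 2 x = - (u' * c) / 2" using r2 by simp
    ultimately show ?thesis by (simp only:)
  qed
  also have "\<dots> = - u' / k" using k c by (simp add: field_simps)
  finally show ?thesis by (simp add: k_def)
qed

lemma dilation_cyl: "dilation s (cyl x y) = cyl (x + s) y"
    "cosh s + sinh s * cyl x y $ 3 = cosh (x + s) / cosh x"
proof -
  have d: "cosh s + sinh s * tanh x = cosh (x + s) / cosh x" for s x :: real
    by (simp add: tanh_def cosh_add field_simps)
  have e: "cosh s * tanh x + sinh s = sinh (x + s) / cosh x"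
    by (simp add: tanh_def sinh_add field_simps)
  show "cosh s + sinh s * cyl x y $ 3 = cosh (x + s) / cosh x" by (simp add: cyl_def d)
  show "dilation s (cyl x y) = cyl (x + s) y"
    unfolding dilation_def by (simp add: cyl_def d e vec_eq_iff forall_3) (simp add: tanh_def field_simps)
qed

text \<open>With w = exp (4 c t), so that e = w^2, the positive root is b = 2 c w / (1 - w^2). Then
  a + b = c (1 + w) / (1 - w) and b - a = - c (1 - w) / (1 + w), which are - c coth (2 c t) and c
  tanh (2 c t).\<close>

lemma rosenau_profile:
  fixes c t z :: real
  assumes c: "c > 0" and t: "t < 0"
  defines "e \<equiv> exp (8 * c * t)"
  assumes a: "a = c * (1 + e) / (1 - e)" and b: "b > 0" "b\<^sup>2 = a\<^sup>2 - c\<^sup>2"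
  shows "a * (1 - z) + b * (1 + z) = - c * coth (2 * c * t) + c * tanh (2 * c * t) * z"
proof -
  define w where "w = exp (4 * c * t)"
  have w: "0 < w" "w < 1" using c t by (auto simp: w_def mult_pos_neg)
  have e: "e = w\<^sup>2" by (simp add: e_def w_def exp_double[symmetric])
  have e1: "1 - w\<^sup>2 > 0" using w by (simp add: power_less_one_iff)
  have "a\<^sup>2 - c\<^sup>2 = (2 * c * w / (1 - w\<^sup>2))\<^sup>2"
    unfolding a e using e1 by (simp add: power_divide field_simps) (simp add: power2_eq_square algebra_simps)
  then have "b\<^sup>2 = (2 * c * w / (1 - w\<^sup>2))\<^sup>2" using b by simp
  moreover have "2 * c * w / (1 - w\<^sup>2) \<ge> 0" using c w e1 by simp
  ultimately have bw: "b = 2 * c * w / (1 - w\<^sup>2)" using b(1) by (simp add: power2_eq_iff_nonneg)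
  have f: "1 - w\<^sup>2 = (1 - w) * (1 + w)" by (simp add: power2_eq_square algebra_simps)
  have p: "a + b = c * (1 + w) / (1 - w)"
  proof -
    have "a + b = (c * (1 + w\<^sup>2) + 2 * c * w) / (1 - w\<^sup>2)"
      unfolding a bw e by (simp only: add_divide_distrib)
    also have "c * (1 + w\<^sup>2) + 2 * c * w = (c * (1 + w)) * (1 + w)" by (simp add: power2_eq_square algebra_simps)
    also have "\<dots> / (1 - w\<^sup>2) = c * (1 + w) / (1 - w)" unfolding f using w by (subst nonzero_mult_divide_mult_cancel_right) auto
    finally show ?thesis .
  qed
  have m: "b - a = - (c * (1 - w) / (1 + w))"
  proof -
    have "b - a = (2 * c * w - c * (1 + w\<^sup>2)) / (1 - w\<^sup>2)"
      unfolding a bw e by (simp only: diff_divide_distrib)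
    also have "2 * c * w - c * (1 + w\<^sup>2) = - ((1 - w) * (c * (1 - w)))" by (simp add: power2_eq_square algebra_simps)
    also have "\<dots> / (1 - w\<^sup>2) = - (c * (1 - w) / (1 + w))"
      unfolding f minus_divide_left[symmetric] using w by (subst nonzero_mult_divide_mult_cancel_left) auto
    finally show ?thesis .
  qed
  define r where "r = exp (2 * c * t)"
  have r: "r > 0" "w = r * r" by (simp_all add: r_def w_def exp_add[symmetric])
  have sh: "sinh (2 * c * t) = (w - 1) / (2 * r)" "cosh (2 * c * t) = (w + 1) / (2 * r)"
    unfolding sinh_field_def cosh_field_def exp_minus r_def[symmetric] using r by (simp_all add: field_simps)
  have "c * coth (2 * c * t) = - (c * (1 + w) / (1 - w))"
    unfolding coth_def sh using r(1) w by (simp add: field_simps)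
  moreover have "c * tanh (2 * c * t) = - (c * (1 - w) / (1 + w))"
  proof -
    have "tanh (2 * c * t) = (w - 1) / (1 + w)" unfolding tanh_def sh using r(1) by (simp add: add.commute)
    then have "c * tanh (2 * c * t) = (c * (w - 1)) / (1 + w)" by simp
    also have "c * (w - 1) = - (c * (1 - w))" by (simp add: algebra_simps)
    finally show ?thesis by (simp only: minus_divide_left)
  qed
  moreover have "a * (1 - z) + b * (1 + z) = (a + b) + (b - a) * z" by (simp add: algebra_simps)
  ultimately show ?thesis using p m by simp
qed

lemma continuous_on_vector3:
  assumes "continuous_on A f" "continuous_on A g" "continuous_on A h"
  shows "continuous_on A (\<lambda>x. vector [f x, g x, h x] :: real^3)"
proof -
  have "vector [a, b, c] = (\<chi> i. if i = 1 then a else if i = 2 then b else c :: real^3)" for a b c :: real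
    by (simp add: vec_eq_iff forall_3)
  moreover have "continuous_on A (\<lambda>x. if i = 1 then f x else if i = 2 then g x else h x)" for i :: 3
    using assms by (cases "i = 1"; cases "i = 2") auto
  ultimately show ?thesis by (simp add: continuous_on_vec_lambda)
qed

section \<open>From the sphere to the cylinder and back\<close>

theorem theorem9:
  fixes u :: "real^3 \<Rightarrow> real \<Rightarrow> real" and C0 \<alpha> t0 a C :: real
  assumes smooth: "smooth_on (\<lambda>(p, t). u p t) (sphere 0 1 \<times> {..<0})"
    and pos: "\<forall>p\<in>sphere 0 1. \<forall>t<0. u p t > 0"
    and ricci_flow: "ricci_flow_on (conformal_metric u) chart_domain {..<0}"
    and singular: "singular_at_time (conformal_metric u) chart_domain 0"
    and pde: "\<forall>t<0. \<forall>\<psi>\<in>{-pi/2<..<pi/2}. \<forall>\<theta>\<in>{0..2*pi}.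
      ((\<lambda>s. u (sph \<psi> \<theta>) s) has_real_derivative
         (laplacian_S2 (\<lambda>\<psi>' \<theta>'. ln (u (sph \<psi>' \<theta>') t)) \<psi> \<theta> - 2)) (at t)"
    and C0: "C0 > 0"
    and backward_limit: "\<forall>\<psi>\<in>{-pi/2..pi/2}. \<forall>\<theta>\<in>{0..2*pi}.
      ((\<lambda>t. inverse_factor u \<psi> \<theta> t) \<longlongrightarrow> C0 * (cos \<psi>)\<^sup>2) at_bot"
    and constants: "0 < \<alpha>" "\<alpha> < 1" "t0 < 0" "0 < a" "a < 3" "C > 0"
    and theta_bound: "\<forall>t\<le>t0. \<forall>\<psi>\<in>{-pi/2..pi/2}. \<forall>\<theta>\<in>{0..2*pi}.
      (deriv (\<lambda>y. inverse_factor u \<psi> y t) \<theta>)\<^sup>2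
        \<le> C * (inverse_factor u \<psi> \<theta> t powr (1 + a)) * (cos \<psi>)\<^sup>2"
    and third_derivative_bound: "\<forall>t\<le>t0. \<forall>\<psi>\<in>{-pi/2..pi/2}. \<forall>\<theta>\<in>{0..2*pi}.
      (cos \<psi> powr (1 - \<alpha>)) * \<bar>(deriv ^^ 3) (\<lambda>y. inverse_factor u y \<theta> t) \<psi>\<bar> \<le> C"
    and laplacian_holder: "\<forall>t\<le>t0. \<forall>\<theta>\<in>{0..2*pi}.
      \<forall>\<rho>\<in>{-pi/2<..<pi/2}. \<forall>\<psi>\<in>{-pi/2<..<pi/2}.
      \<bar>laplacian_S2 (\<lambda>\<psi>' \<theta>'. inverse_factor u \<psi>' \<theta>' t) \<rho> \<theta>
        - laplacian_S2 (\<lambda>\<psi>' \<theta>'. inverse_factor u \<psi>' \<theta>' t) \<psi> \<theta>\<bar> \<le> C * (\<bar>\<rho> - \<psi>\<bar> powr \<alpha>)"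
  shows "\<exists>\<mu>>0. \<exists>s. \<forall>t<0. \<forall>\<psi>\<in>{-pi/2..pi/2}. \<forall>\<theta>\<in>{0..2*pi}.
      inverse_factor (dilate_factor s u) \<psi> \<theta> t
        = - \<mu> * coth (2 * \<mu> * t) + \<mu> * tanh (2 * \<mu> * t) * (sin \<psi>)\<^sup>2"
proof -
  let ?S = "sphere 0 1 \<times> {..<0} :: ((real^3) \<times> real) set"
  obtain T F where T: "open T" "?S \<subseteq> T" and F: "\<And>k. Ck_on k F T"
    and Fu: "\<And>x. x \<in> ?S \<Longrightarrow> F x = (case x of (p, t) \<Rightarrow> u p t)"
    using smooth unfolding smooth_on_def by blast
  have Fu: "F (p, t) = u p t" if "p \<in> sphere 0 1" "t < 0" for p t using Fu[of "(p, t)"] that by simp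
  have Fc: "continuous_on ?S F" using continuous_on_subset[OF _ T(2)] F[of 0] by simp
  \<comment> \<open>The smooth extension F is used instead of u: it is differentiable in all ambient
    directions and agrees with u on the sphere for t < 0.\<close>
  define us where "us x y t = F (cyl x y, t)" for x y t
  have us: "us x y t = u (cyl x y) t" if "t < 0" for x y t
    unfolding us_def by (rule Fu[OF cyl_in_sphere that])
  have tus: "tempered 0 us" and tusx: "tempered (-1) (Dx us)" and tusy: "tempered (-1) (Dy us)"
    unfolding us_def[abs_def] using tempered_ambient[OF T(2) F] tempered_ambient_derivs[OF T(2) F] by auto
  have spos: "slab_pos us" unfolding slab_pos_def
  proof (intro allI impI)
    fix a b :: real assume b: "b < 0"
    show "\<exists>c>0. \<forall>x y. \<forall>t\<in>{a..b}. c \<le> us x y t"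
    proof (cases "a \<le> b")
      case True
      have cp: "compact (sphere 0 1 \<times> {a..b} :: ((real^3) \<times> real) set)" by (intro compact_Times) auto
      have ne: "(sphere 0 1 \<times> {a..b} :: ((real^3) \<times> real) set) \<noteq> {}" using cyl_in_sphere True by fastforce
      have "continuous_on (sphere 0 1 \<times> {a..b}) F" by (rule continuous_on_subset[OF Fc]) (use b in auto)
      then obtain q where q: "q \<in> sphere 0 1 \<times> {a..b}" "\<And>q'. q' \<in> sphere 0 1 \<times> {a..b} \<Longrightarrow> F q \<le> F q'"
        using continuous_attains_inf[OF cp ne] by blast
      have "F q > 0" using q(1) b Fu[of "fst q" "snd q"] pos by (cases q) auto
      moreover have "F q \<le> us x y t" if "t \<in> {a..b}" for x y t
        unfolding us_def using q(2)[of "(cyl x y, t)"] that cyl_in_sphere by blast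
      ultimately show ?thesis by blast
    qed (auto intro: exI[of _ 1])
  qed
  have usp: "us x y t > 0" if "t < 0" for x y t by (rule slab_pos_pos[OF spos that])
  define lu where "lu x y t = ln (us x y t)" for x y t
  define l where "l x y t = - lu x y t" for x y t
  have tlu: "tempered 0 lu" unfolding lu_def[abs_def] by (rule tempered_ln[OF spos tus])
  have tl: "tempered 0 l" unfolding l_def[abs_def] by (rule tempered_minus[OF tlu])
  have lD: "Dx (Dx l) x y t = - Dx (Dx lu) x y t" "Dy (Dy l) x y t = - Dy (Dy lu) x y t" "Dt l x y t = - Dt lu x y t"
    if "t < 0" for x y t
    unfolding l_def[abs_def] using D2_minus[OF tlu that] D_minus[OF tlu that] by auto
  have el: "exp (l x y t) = inverse (us x y t)" if "t < 0" for x y t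
    using usp[OF that, of x y] by (simp add: l_def lu_def exp_minus)
  have luD: "Dx lu x y t = inverse (us x y t) * Dx us x y t" "Dy lu x y t = inverse (us x y t) * Dy us x y t"
    "Dt lu x y t = inverse (us x y t) * Dt us x y t" if t: "t < 0" for x y t
    unfolding Dx_def[of lu] Dy_def[of lu] Dt_def[of lu] lu_def
    using usp[OF t, of x y]
    by (auto intro!: DERIV_imp_deriv derivative_eq_intros tempered_D(4-6)[OF tus t] simp: divide_inverse)
  have ti: "tempered 0 (\<lambda>x y t. inverse (us x y t))" by (rule tempered_inverse[OF spos tus])
  have tlx: "tempered (-1) (Dx l)"
    by (rule tempered_cong[OF tempered_minus[OF tempered_mult[OF ti tusx, simplified]]])
      (simp add: l_def[abs_def] D_minus[OF tlu] luD)
  have tly: "tempered (-1) (Dy l)"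
    by (rule tempered_cong[OF tempered_minus[OF tempered_mult[OF ti tusy, simplified]]])
      (simp add: l_def[abs_def] D_minus[OF tlu] luD)
  have per: "l x (y + 2 * pi) t = l x y t" for x y t by (simp add: l_def lu_def us_def cyl_periodic)
  have pern: "Dt l x (y + 2 * pi) t = Dt l x y t" "Dx (Dx l) x (y + 2 * pi) t = Dx (Dx l) x y t"
    "Dy (Dy l) x (y + 2 * pi) t = Dy (Dy l) x y t" for x y t
  proof -
    note p = periodic_D[of l "2 * pi"]
    show "Dt l x (y + 2 * pi) t = Dt l x y t" by (rule p(3)) (rule per)
    show "Dx (Dx l) x (y + 2 * pi) t = Dx (Dx l) x y t" by (rule periodic_D(1), rule p(1)) (rule per)
    show "Dy (Dy l) x (y + 2 * pi) t = Dy (Dy l) x y t" by (rule periodic_D(2), rule p(2)) (rule per)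
  qed
  have usu: "u (sph \<psi> \<theta>) t = us (merc \<psi>) \<theta> t" if "\<bar>\<psi>\<bar> < pi / 2" "t < 0" for \<psi> \<theta> t
    using us[OF that(2)] sph_eq_cyl[OF that(1)] by simp
  have latb: "lat x \<in> {- pi / 2..pi / 2}" "lat x \<in> {- pi / 2<..<pi / 2}" for x
  proof -
    have "- (pi / 2) < lat x" "lat x < pi / 2" using lat_facts(1)[of x] unfolding abs_less_iff by linarith+
    then show "lat x \<in> {- pi / 2..pi / 2}" "lat x \<in> {- pi / 2<..<pi / 2}" by simp_all
  qed
  have pde0: "Dt l x y t = exp (l x y t) * ((cosh x)\<^sup>2 * (Dx (Dx l) x y t + Dy (Dy l) x y t) + 2)"
    if t: "t < 0" and y: "y \<in> {0..2 * pi}" for x y t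
  proof -
    have lap: "laplacian_S2 (\<lambda>\<psi> \<theta>. ln (u (sph \<psi> \<theta>) t)) (lat x) y
        = (cosh x)\<^sup>2 * (Dx (Dx lu) x y t + Dy (Dy lu) x y t)"
      using laplacian_chart[OF tlu t _ lat_facts(1), of "\<lambda>\<psi> \<theta>. ln (u (sph \<psi> \<theta>) t)" x y] usu[OF _ t]
      by (simp add: lu_def lat_facts(2))
    have "((\<lambda>s. u (sph (lat x) y) s) has_real_derivative
        (cosh x)\<^sup>2 * (Dx (Dx lu) x y t + Dy (Dy lu) x y t) - 2) (at t)"
      using pde[rule_format, OF t latb(2) y, of x] unfolding lap .
    then have "((\<lambda>s. us x y s) has_real_derivative
        (cosh x)\<^sup>2 * (Dx (Dx lu) x y t + Dy (Dy lu) x y t) - 2) (at t)"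
      by (rule has_field_derivative_transform_within_open[of _ _ _ "{..<0}"])
        (use t in \<open>auto simp: us sph_lat\<close>)
    then have ut: "Dt us x y t = (cosh x)\<^sup>2 * (Dx (Dx lu) x y t + Dy (Dy lu) x y t) - 2"
      unfolding Dt_def by (rule DERIV_imp_deriv)
    show ?thesis unfolding lD[OF t] luD(3)[OF t] el[OF t] ut by (simp add: algebra_simps)
  qed
  have pde': "Dt l x y t = exp (l x y t) * ((cosh x)\<^sup>2 * (Dx (Dx l) x y t + Dy (Dy l) x y t) + 2)"
    if t: "t < 0" for x y t
  proof -
    \<comment> \<open>The equation is assumed only for angles in [0, 2 pi]. Bundling the four
      quantities lets one reduction modulo 2 pi serve all of them.\<close>
    define h where "h y = (Dt l x y t, l x y t, Dx (Dx l) x y t, Dy (Dy l) x y t)" for y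
    obtain y' where "y' \<in> {0..2 * pi}" "h y' = h y"
      by (rule periodic_reduce[of h y]) (simp add: h_def per pern)
    then have "Dt l x y t = Dt l x y' t" "l x y t = l x y' t" "Dx (Dx l) x y t = Dx (Dx l) x y' t"
      "Dy (Dy l) x y t = Dy (Dy l) x y' t" by (simp_all add: h_def)
    then show ?thesis using pde0[OF t \<open>y' \<in> {0..2 * pi}\<close>, of x] by (simp only:)
  qed
  have inv: "inverse_factor u (lat x) y t = exp (l x y t)" if "t < 0" for x y t
    using el[OF that] us[OF that] by (simp add: inverse_factor_def sph_lat)
  have inv': "inverse_factor u \<psi> y t = exp (l (merc \<psi>) y t)" if "\<bar>\<psi>\<bar> < pi / 2" "t < 0" for \<psi> y t
    using el[OF that(2)] usu[OF that] by (simp add: inverse_factor_def)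
  have lim: "((\<lambda>t. exp (l x y t)) \<longlongrightarrow> C0 / (cosh x)\<^sup>2) at_bot" for x y
  proof -
    obtain y' where y': "y' \<in> {0..2 * pi}" "(\<lambda>t. l x y' t) = (\<lambda>t. l x y t)"
      by (rule periodic_reduce[of "\<lambda>y t. l x y t" y]) (simp add: per)
    have "((\<lambda>t. inverse_factor u (lat x) y' t) \<longlongrightarrow> C0 * (cos (lat x))\<^sup>2) at_bot"
      by (rule backward_limit[rule_format, OF latb(1) y'(1)])
    then have "((\<lambda>t. exp (l x y' t)) \<longlongrightarrow> C0 * (cos (lat x))\<^sup>2) at_bot"
      by (rule Lim_transform_eventually) (rule eventually_mono[OF eventually_gt_at_bot[of 0]], rule inv)
    then show ?thesis using fun_cong[OF y'(2)] by (simp add: lat_facts(3) power_inverse divide_inverse)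
  qed
  interpret cylinder_flow l C0
    by (rule cylinder_flow.intro) (fact tl tlx tly per pde' C0 lim)+
  have vinv: "inverse_factor u (lat x) y t = v x y t" if "t < 0" for x y t using inv[OF that] by (simp add: v_def)
  have vinv': "inverse_factor u \<psi> y t = v (merc \<psi>) y t" if "\<bar>\<psi>\<bar> < pi / 2" "t < 0" for \<psi> y t
    using inv'[OF that] by (simp add: v_def)
  have sym: "Dy l x y t = 0" if t: "t < 0" for x y t
  proof (rule axially_symmetric[OF _ constants(3-5) t constants(6)])
    fix x y t assume t: "t \<le> t0"
    then have tn: "t < 0" using constants by simp
    define h where "h y = (Dy v x y t, v x y t)" for y
    obtain y' where y': "y' \<in> {0..2 * pi}" "h y' = h y"
      using periodic_reduce[of h y] periodic_D(2)[of v "2 * pi"] by (force simp: h_def v_def per)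
    have d: "deriv (\<lambda>y. inverse_factor u (lat x) y t) y' = Dy v x y' t" unfolding vinv[OF tn] Dy_def ..
    have "(Dy v x y' t)\<^sup>2 \<le> C * v x y' t powr (1 + a) * (inverse (cosh x))\<^sup>2"
      using theta_bound[rule_format, OF t latb(1)[of x] y'(1)] unfolding d unfolding vinv[OF tn] lat_facts(3) .
    then show "(Dy v x y t)\<^sup>2 \<le> C * v x y t powr (1 + a) * (inverse (cosh x))\<^sup>2"
      using y'(2) by (simp add: h_def)
  qed
  have l0: "l x y t = l x 0 t" if t: "t < 0" for x y t
    using DERIV_isconst_all[of "\<lambda>y. l x y t" y 0] dl(5)[OF t, of x] sym[OF t, of x] by simp
  have V0: "V x y t = V x 0 t" if t: "t < 0" for x y t by (simp add: V_def v_def l0[OF t, of x y])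
  \<comment> \<open>The second latitude derivative of v, written in the coordinate x.\<close>
  define Q where "Q x y t = cosh x * (sinh x * Dx v x y t + cosh x * Dx (Dx v) x y t)" for x y t
  have tQ: "tempered 2 Q"
  proof -
    have "tempered 1 (\<lambda>x y t. sinh x * Dx v x y t + cosh x * Dx (Dx v) x y t)"
      using tempered_add[OF tempered_mult[OF tempered_sinh dv(1)] tempered_mult[OF tempered_cosh dvx(1)]] by simp
    then show ?thesis unfolding Q_def[abs_def] using tempered_mult[OF tempered_cosh] by fastforce
  qed
  have z0: "0 \<in> {0..2 * pi}" by simp
  obtain K where K: "\<And>x t. t \<le> t0 \<Longrightarrow> \<bar>G x 0 t\<bar> \<le> K * cosh x powr - \<alpha>"
  proof (rule G_decay[OF constants(3,1) _ constants(6)])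
    show "\<alpha> \<le> 2" using constants by simp
    fix x t assume t: "t \<le> t0"
    then have tn: "t < 0" using constants by simp
    have dQ: "((\<lambda>x. cosh x * (sinh x * Dx v x 0 t + cosh x * Dx (Dx v) x 0 t)) has_real_derivative Dx Q x 0 t) (at x)" for x
      using tempered_D(4)[OF tQ tn, where y = 0 and x = x] by (simp add: Q_def)
    have "(deriv ^^ 3) (\<lambda>y. inverse_factor u y 0 t) (lat x) = cosh (merc (lat x)) * Dx Q (merc (lat x)) 0 t"
      by (rule deriv3_chart[where f = "\<lambda>x. v x 0 t" and f' = "\<lambda>x. Dx v x 0 t" and f'' = "\<lambda>x. Dx (Dx v) x 0 t"
            and q' = "\<lambda>x. Dx Q x 0 t"])
        (rule vinv'[OF _ tn] dv(4)[OF tn] dvx(4)[OF tn] dQ lat_facts(1) | assumption)+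
    then have d3: "(deriv ^^ 3) (\<lambda>y. inverse_factor u y 0 t) (lat x) = cosh x * Dx Q x 0 t" by (simp add: lat_facts(2))
    have "inverse (cosh x) powr (1 - \<alpha>) * \<bar>cosh x * Dx Q x 0 t\<bar> \<le> C"
      using third_derivative_bound[rule_format, OF t latb(1) z0, of x] by (simp add: d3 lat_facts(3))
    moreover have "inverse (cosh x) powr (1 - \<alpha>) * \<bar>cosh x * Dx Q x 0 t\<bar> = cosh x powr \<alpha> * \<bar>Dx Q x 0 t\<bar>"
    proof -
      have "inverse (cosh x) powr (1 - \<alpha>) * cosh x = cosh x powr (\<alpha> - 1) * cosh x powr 1"
        by (simp add: inverse_powr powr_minus[symmetric])
      also have "\<dots> = cosh x powr \<alpha>" by (simp only: powr_add[symmetric]) simp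
      finally show ?thesis by (simp add: abs_mult mult.assoc[symmetric])
    qed
    ultimately have "\<bar>Dx Q x 0 t\<bar> \<le> C * cosh x powr - \<alpha>"
      by (simp add: powr_minus pos_le_divide_eq divide_inverse[symmetric] mult.commute)
    then show "\<bar>Dx (\<lambda>x y t. cosh x * (sinh x * Dx v x y t + cosh x * Dx (Dx v) x y t)) x 0 t\<bar> \<le> C * cosh x powr - \<alpha>"
      by (simp add: Q_def[abs_def])
  next
    fix x y t assume t: "t \<le> t0"
    then have tn: "t < 0" using constants by simp
    have vy: "Dy v x y t = 0" for x y
      unfolding Dy_def[of v] v_def by (rule DERIV_imp_deriv) (auto intro!: derivative_eq_intros dl(5)[OF tn] simp: sym[OF tn])
    have "Dy (Dy v) x y t = Dy (\<lambda>x y t. 0) x y t" for x y by (rule Dy_cong) (rule vy)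
    then have vyy: "Dy (Dy v) x y t = 0" for x y by (simp add: Dy_def)
    have lap: "laplacian_S2 (\<lambda>\<psi>' \<theta>'. inverse_factor u \<psi>' \<theta>' t) (lat x) 0 = (cosh x)\<^sup>2 * Dx (Dx v) x 0 t" for x
      using laplacian_chart[OF tempered_v tn vinv'[OF _ tn] lat_facts(1), of x 0] by (simp add: lat_facts(2) vyy)
    show "\<bar>(cosh x)\<^sup>2 * Dx (Dx v) x 0 t - (cosh y)\<^sup>2 * Dx (Dx v) y 0 t\<bar> \<le> C * \<bar>lat x - lat y\<bar> powr \<alpha>"
      using laplacian_holder[rule_format, OF t z0 latb(2) latb(2), of x y] unfolding lap .
  qed (rule that)
  show ?thesis
  proof (rule rosenau_form[OF sym constants(3,1) K])
    fix \<kappa> y0 :: real and a' b' :: "real \<Rightarrow> real"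
    assume \<kappa>: "\<bar>\<kappa>\<bar> < 1" and y0: "0 < y0" "y0 \<le> 1" and b0: "\<And>t. t < 0 \<Longrightarrow> b' t > 0"
      and form: "\<And>x t. t < 0 \<Longrightarrow> V x 0 t = a' t + b' t * cosh (2 * x) + \<kappa> * b' t * sinh (2 * x)"
      and ab: "\<And>t. t < 0 \<Longrightarrow> (b' t)\<^sup>2 - (\<kappa> * b' t)\<^sup>2 = (a' t)\<^sup>2 - C0\<^sup>2"
      and a': "\<And>t. t < 0 \<Longrightarrow> a' t = C0 * (1 + y0 * exp (8 * C0 * t)) / (1 - y0 * exp (8 * C0 * t))"
      and Rle: "\<And>x t. t < 0 \<Longrightarrow> Dt l x 0 t \<le> 4 * a' t"
    have y01: "y0 = 1"
    proof (rule ccontr)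
      assume "y0 \<noteq> 1"
      then have lt: "y0 < 1" using y0 by simp
      \<comment> \<open>For y0 < 1 the denominator of a' stays at least 1 - y0 up to time 0, so 4
        a', and with it the curvature, would be bounded by this M.\<close>
      define M where "M = 4 * (C0 * 2 / (1 - y0))"
      obtain t x where tx: "- 1 < t" "t < 0" "x \<in> chart_domain" "\<bar>scalar_curvature (conformal_metric u t) x\<bar> > M"
        using singular[unfolded singular_at_time_def, rule_format, of "- 1" M] by auto
      have xb: "\<bar>x $ 1\<bar> < pi / 2" using tx(3) by (simp add: chart_domain_def)
      define X where "X = merc (x $ 1)"
      have "((\<lambda>s. us X (x $ 2) s) has_real_derivative Dt us X (x $ 2) t) (at t)"
        by (rule tempered_D(6)[OF tus tx(2)])
      then have "((\<lambda>s. u (sph (x $ 1) (x $ 2)) s) has_real_derivative Dt us X (x $ 2) t) (at t)"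
        by (rule has_field_derivative_transform_within_open[of _ _ _ "{..<0}"])
          (use tx usu[OF xb] in \<open>auto simp: X_def\<close>)
      then have "scalar_curvature (conformal_metric u t) x = - Dt us X (x $ 2) t / u (sph (x $ 1) (x $ 2)) t"
        using pos sph_in_sphere tx(2) by (intro conformal_scalar_curvature[OF ricci_flow tx(3,2)]) auto
      also have "\<dots> = Dt l X (x $ 2) t"
        by (simp add: lD[OF tx(2)] luD[OF tx(2)] usu[OF xb tx(2)] X_def divide_inverse)
      also have "\<dots> = Dt (\<lambda>a b s. l a 0 s) X (x $ 2) t" by (rule Dt_cong[OF _ tx(2)]) (rule l0)
      also have "\<dots> = Dt l X 0 t" by (simp add: Dt_def)
      finally have R: "scalar_curvature (conformal_metric u t) x = Dt l X 0 t" .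
      have "exp (8 * C0 * t) \<le> 1" using C0 tx(2) by (simp add: mult_nonneg_nonpos)
      then have ye: "y0 * exp (8 * C0 * t) \<le> y0" using y0 by (simp add: mult_left_le)
      have "a' t \<le> C0 * 2 / (1 - y0)" unfolding a'[OF tx(2)]
      proof (rule frac_le)
        show "C0 * (1 + y0 * exp (8 * C0 * t)) \<le> C0 * 2" using ye lt C0 by (intro mult_left_mono) auto
      qed (use ye lt C0 in auto)
      then have "Dt l X 0 t \<le> M" using Rle[OF tx(2), of X] by (simp add: M_def)
      then show False using tx(4) Dt_l_nonneg[OF tx(2), of X 0] by (simp add: R)
    qed
    \<comment> \<open>This is artanh (- \<kappa>) / 2, the translation of x that removes the sinh
      term from the profile.\<close>
    define s where "s = merc (arcsin (- \<kappa>)) / 2"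
    have as: "\<bar>arcsin (- \<kappa>)\<bar> < pi / 2" using arcsin_lt_bounded[of "- \<kappa>"] \<kappa> by (auto simp: abs_less_iff)
    have "tanh (2 * s) = - \<kappa>" using merc_facts(1)[OF as] \<kappa> by (simp add: s_def abs_less_iff)
    then have sh: "sinh (2 * s) = - \<kappa> * cosh (2 * s)" by (simp add: tanh_def divide_eq_eq)
    have "\<forall>t<0. \<forall>\<psi>\<in>{-pi/2..pi/2}. \<forall>\<theta>\<in>{0..2*pi}.
      inverse_factor (dilate_factor s u) \<psi> \<theta> t
        = - C0 * coth (2 * C0 * t) + C0 * tanh (2 * C0 * t) * (sin \<psi>)\<^sup>2"
    proof (intro allI impI ballI)
      fix t \<psi> \<theta> :: real assume t: "t < 0" and \<psi>: "\<psi> \<in> {-pi/2..pi/2}"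
      \<comment> \<open>The amplitude of the centred profile, equal to sqrt (1 - \<kappa>^2) b' t;
        hence b^2 = (a' t)^2 - C0^2, as \<open>rosenau_profile\<close> requires.\<close>
      define b where "b = b' t / cosh (2 * s)"
      have bpos: "b > 0" using b0[OF t] by (simp add: b_def)
      have ch: "(cosh (2 * s))\<^sup>2 * (1 - \<kappa>\<^sup>2) = 1"
        using cosh_square_eq[of "2 * s"] unfolding sh by (simp add: power_mult_distrib algebra_simps)
      then have \<kappa>2: "1 - \<kappa>\<^sup>2 = 1 / (cosh (2 * s))\<^sup>2" by (simp add: eq_divide_eq mult.commute)
      have "b\<^sup>2 = (b' t)\<^sup>2 * (1 - \<kappa>\<^sup>2)" by (simp add: b_def \<kappa>2 power_divide)
      then have b2: "b\<^sup>2 = (a' t)\<^sup>2 - C0\<^sup>2" using ab[OF t] by (simp add: power_mult_distrib algebra_simps)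
      have bc: "b' t * cosh (2 * s) + \<kappa> * b' t * sinh (2 * s) = b"
      proof -
        have "b' t * cosh (2 * s) + \<kappa> * b' t * sinh (2 * s) = b' t * (cosh (2 * s) * (1 - \<kappa>\<^sup>2))"
          unfolding sh by (simp add: algebra_simps power2_eq_square)
        also have "\<dots> = b" unfolding \<kappa>2 b_def by (simp add: power2_eq_square)
        finally show ?thesis .
      qed
      have bs: "b' t * sinh (2 * s) + \<kappa> * b' t * cosh (2 * s) = 0" unfolding sh by simp
      have a1: "a' t = C0 * (1 + exp (8 * C0 * t)) / (1 - exp (8 * C0 * t))" using a'[OF t] y01 by simp
      define rhs where "rhs \<psi> = - C0 * coth (2 * C0 * t) + C0 * tanh (2 * C0 * t) * (sin \<psi>)\<^sup>2" for \<psi>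
      have inner: "inverse_factor (dilate_factor s u) \<psi> \<theta> t - rhs \<psi> = 0"
        if "\<psi> \<in> {- pi / 2<..<pi / 2}" for \<psi>
      proof -
        have \<psi>: "\<bar>\<psi>\<bar> < pi / 2" using that by (auto simp: abs_less_iff)
        define x where "x = merc \<psi>"
        have "inverse_factor (dilate_factor s u) \<psi> \<theta> t = (cosh (x + s) / cosh x)\<^sup>2 / u (cyl (x + s) \<theta>) t"
          unfolding inverse_factor_def dilate_factor_def sph_eq_cyl[OF \<psi>] x_def[symmetric] dilation_cyl by simp
        also have "\<dots> = V (x + s) \<theta> t * (inverse (cosh x))\<^sup>2"
          using us[OF t, of "x + s" \<theta>] el[OF t, of "x + s" \<theta>] by (simp add: V_def v_def power_mult_distrib divide_inverse power_inverse)
        also have "V (x + s) \<theta> t = a' t + b * cosh (2 * x)"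
        proof -
          have "V (x + s) \<theta> t = a' t + b' t * cosh (2 * x + 2 * s) + \<kappa> * b' t * sinh (2 * x + 2 * s)"
            using V0[OF t, of "x + s" \<theta>] form[OF t, of "x + s"] by (simp add: distrib_left)
          also have "\<dots> = a' t + (b' t * cosh (2 * s) + \<kappa> * b' t * sinh (2 * s)) * cosh (2 * x)
              + (b' t * sinh (2 * s) + \<kappa> * b' t * cosh (2 * s)) * sinh (2 * x)"
            unfolding cosh_add sinh_add by (simp add: algebra_simps)
          finally show ?thesis unfolding bc bs by simp
        qed
        also have "(a' t + b * cosh (2 * x)) * (inverse (cosh x))\<^sup>2
            = a' t * (1 - (sin \<psi>)\<^sup>2) + b * (1 + (sin \<psi>)\<^sup>2)"
        proof -
          have "(inverse (cosh x))\<^sup>2 = 1 - (sin \<psi>)\<^sup>2"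
            using sech_tanh_squares[of x] merc_facts(1)[OF \<psi>] by (simp add: x_def)
          moreover have "cosh (2 * x) * (inverse (cosh x))\<^sup>2 = 1 + (sin \<psi>)\<^sup>2"
            unfolding merc_facts(1)[OF \<psi>, symmetric] x_def[symmetric] cosh_double
            by (simp add: tanh_def field_simps)
          ultimately show ?thesis by (simp only: distrib_right mult.assoc)
        qed
        also have "\<dots> = rhs \<psi>" unfolding rhs_def by (rule rosenau_profile[OF C0 t a1 bpos b2])
        finally show ?thesis by simp
      qed
      \<comment> \<open>The cylinder misses the poles; there the identity follows by continuity from
        the open interval of latitudes.\<close>
      have clos: "closure {- pi / 2<..<pi / 2} = {- pi / 2..pi / 2 :: real}"
        by (rule closure_greaterThanLessThan) simp
      have "inverse_factor (dilate_factor s u) \<psi> \<theta> t - rhs \<psi> = 0"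
      proof (rule continuous_constant_on_closure[OF _ inner])
        have uc: "continuous_on (sphere 0 1) (\<lambda>p. u p t)"
        proof -
          have "continuous_on (sphere 0 1) (\<lambda>p. F (p, t))"
            by (rule continuous_on_compose2[OF Fc]) (use t in \<open>auto intro!: continuous_intros\<close>)
          then show ?thesis by (rule continuous_on_eq) (use Fu t in auto)
        qed
        have sph3: "sph \<psi> \<theta> $ 3 = sin \<psi>" for \<psi> by (simp add: sph_def)
        have dp: "cosh s + sinh s * sin \<psi> > 0" for \<psi> by (rule dilation_denom_pos) simp
        have dilc: "continuous_on A (\<lambda>\<psi>. dilation s (sph \<psi> \<theta>))" for A
        proof -
          have "continuous_on A (\<lambda>\<psi>. (1 / (cosh s + sinh s * sin \<psi>)) *\<^sub>R
             (vector [cos \<psi> * cos \<theta>, cos \<psi> * sin \<theta>, cosh s * sin \<psi> + sinh s] :: real^3))"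
            by (intro continuous_intros continuous_on_vector3)
              (use dp in \<open>auto simp: less_imp_neq[THEN not_sym]\<close>)
          then show ?thesis by (simp add: dilation_def sph_def)
        qed
        have up: "u (dilation s (sph \<psi> \<theta>)) t \<noteq> 0" for \<psi>
          using pos[rule_format, OF dilation_in_sphere[OF sph_in_sphere] t] by (rule less_imp_neq[THEN not_sym])
        have ud: "continuous_on A (\<lambda>\<psi>. u (dilation s (sph \<psi> \<theta>)) t)" for A
          by (rule continuous_on_compose2[OF uc dilc]) (rule image_subsetI, rule dilation_in_sphere[OF sph_in_sphere])
        have "continuous_on {- pi / 2..pi / 2} (\<lambda>\<psi>. (cosh s + sinh s * sin \<psi>)\<^sup>2 / u (dilation s (sph \<psi> \<theta>)) t)"
          by (rule continuous_on_divide[OF _ ud]) (intro continuous_intros, rule ballI, rule up)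
        moreover have "inverse_factor (dilate_factor s u) \<psi> \<theta> t
            = (cosh s + sinh s * sin \<psi>)\<^sup>2 / u (dilation s (sph \<psi> \<theta>)) t" for \<psi>
          by (simp add: inverse_factor_def dilate_factor_def sph3)
        ultimately have "continuous_on {- pi / 2..pi / 2} (\<lambda>\<psi>. inverse_factor (dilate_factor s u) \<psi> \<theta> t)"
          by (simp only:)
        then show "continuous_on (closure {- pi / 2<..<pi / 2}) (\<lambda>\<psi>. inverse_factor (dilate_factor s u) \<psi> \<theta> t - rhs \<psi>)"
          unfolding clos rhs_def by (intro continuous_intros)
        show "\<psi> \<in> closure {- pi / 2<..<pi / 2}" unfolding clos using \<psi> by simp
      qed
      then show "inverse_factor (dilate_factor s u) \<psi> \<theta> t
        = - C0 * coth (2 * C0 * t) + C0 * tanh (2 * C0 * t) * (sin \<psi>)\<^sup>2" by (simp add: rhs_def)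
    qed
    then show ?thesis using C0 by blast
  qed
qed

end
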